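(* Let $F$ be a field of characteristic zero and let $M_{1,2}(F)$ be the $*$-superalgebra described in the context. For a composition $(n_1,n_2,n_3,n_4)$ of $3$ let $W_{(n_1,n_2,n_3,n_4)}$ be the space of $*$-polynomials in $y_1^\pm,y_2^\pm,y_3^\pm,z_1^\pm,z_2^\pm,z_3^\pm$ that are multihomogeneous of total degree $n_1$ in $y_1^+,y_2^+,y_3^+$, $n_2$ in $y_1^-,y_2^-,y_3^-$, $n_3$ in $z_1^+,z_2^+,z_3^+$ and $n_4$ in $z_1^-,z_2^-,z_3^-$. Then the following decompositions into irreducible modules hold, where in each case the listed polynomials are highest weight vectors generating the indicated copies: (1) $Id_2^*\cap W_{(3,0,0,0)}\cong 2W^{((2,1),\emptyset,\emptyset,\emptyset)}\oplus W^{((1^3),\emptyset,\emptyset,\emptyset)}$, with $[y_1^+,y_2^+]y_1^+$, $[(y_1^+)^2,y_2^+]$ and $St_3(y_1^+,y_2^+,y_3^+)$; (2) $Id_2^*\cap W_{(0,3,0,0)}\cong W^{(\emptyset,(2,1),\emptyset,\emptyset)}$, with $[(y_1^-)^2,y_2^-]$; (3) $Id_2^*\cap W_{(2,1,0,0)}\cong 2W^{((2),(1),\emptyset,\emptyset)}\oplus 3W^{((1^2),(1),\emptyset,\emptyset)}$, with $[(y_1^+)^2,y_1^-]$, $[y_1^+,y_1^-y_1^+]$ and $[y_1^+,y_2^+]y_1^-$, $y_1^+y_1^-y_2^+-y_2^+y_1^-y_1^+$, $y_1^-[y_1^+,y_2^+]$; (4) $Id_2^*\cap W_{(1,2,0,0)}\cong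 2W^{((1),(2),\emptyset,\emptyset)}\oplus 2W^{((1),(1^2),\emptyset,\emptyset)}$, with $[y_1^+,(y_1^-)^2]$, $y_1^-[y_1^+,y_1^-]$ and $[y_1^+,y_1^-y_2^--y_2^-y_1^-]$, $y_1^-[y_1^+,y_2^-]-y_2^-[y_1^+,y_1^-]$; (5) $Id_2^*\cap W_{(2,0,1,0)}\cong 2W^{((1^2),\emptyset,(1),\emptyset)}$, with $[y_1^+,y_2^+]z_1^+$, $z_1^+[y_1^+,y_2^+]$; (6) $Id_2^*\cap W_{(2,0,0,1)}\cong 2W^{((1^2),\emptyset,\emptyset,(1))}$, with $[y_1^+,y_2^+]z_1^-$, $z_1^-[y_1^+,y_2^+]$; (7) $Id_2^*\cap W_{(1,1,1,0)}\cong 2W^{((1),(1),(1),\emptyset)}$, with $[y_1^+,y_1^-]z_1^+$, $z_1^+[y_1^+,y_1^-]$; (8) $Id_2^*\cap W_{(1,1,0,1)}\cong 2W^{((1),(1),\emptyset,(1))}$, with $[y_1^+,y_1^-]z_1^-$, $z_1^-[y_1^+,y_1^-]$; (9) $Id_2^*\cap W_{(1,0,2,0)}\cong W^{((1),\emptyset,(2),\emptyset)}\oplus W^{((1),\emptyset,(1^2),\emptyset)}$, with $[y_1^+,(z_1^+)^2]$ and $[y_1^+,z_1^+z_2^+-z_2^+z_1^+]$; (10) $Id_2^*\cap W_{(1,0,0,2)}\cong W^{((1),\emptyset,\emptyset,(2))}\oplus W^{((1),\emptyset,\emptyset,(1^2))}$, with $[y_1^+,(z_1^-)^2]$ and $[y_1^+,z_1^-z_2^--z_2^-z_1^-]$;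 (11) $Id_2^*\cap W_{(1,0,1,1)}\cong 2W^{((1),\emptyset,(1),(1))}$, with $[y_1^+,z_1^+z_1^-]$, $[y_1^+,z_1^-z_1^+]$; (12) $Id_2^*\cap W_{(0,0,3,0)}\cong W^{(\emptyset,\emptyset,(3),\emptyset)}\oplus W^{(\emptyset,\emptyset,(1^3),\emptyset)}$, with $(z_1^+)^3$ and $St_3(z_1^+,z_2^+,z_3^+)$; (13) $Id_2^*\cap W_{(0,0,0,3)}\cong W^{(\emptyset,\emptyset,\emptyset,(3))}\oplus W^{(\emptyset,\emptyset,\emptyset,(1^3))}$, with $(z_1^-)^3$ and $St_3(z_1^-,z_2^-,z_3^-)$; (14) $Id_2^*\cap W_{(0,2,1,0)}\cong W^{(\emptyset,(2),(1),\emptyset)}\oplus W^{(\emptyset,(1^2),(1),\emptyset)}$, with $y_1^-z_1^+y_1^-$ and $y_1^-z_1^+y_2^--y_2^-z_1^+y_1^-$; (15) $Id_2^*\cap W_{(0,2,0,1)}\cong W^{(\emptyset,(2),\emptyset,(1))}\oplus W^{(\emptyset,(1^2),\emptyset,(1))}$, with $y_1^-z_1^-y_1^-$ and $y_1^-z_1^-y_2^--y_2^-z_1^-y_1^-$; (16) $Id_2^*\cap W_{(0,1,2,0)}\cong 2W^{(\emptyset,(1),(1^2),\emptyset)}$, with $z_1^+y_1^-z_2^+-z_2^+y_1^-z_1^+$, $[y_1^-,z_1^+z_2^+-z_2^+z_1^+]$; (17) $Id_2^*\cap W_{(0,1,0,2)}\cong 2W^{(\emptyset,(1),\emptyset,(1^2))}$,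 with $z_1^-y_1^-z_2^--z_2^-y_1^-z_1^-$, $[y_1^-,z_1^-z_2^--z_2^-z_1^-]$; (18) $Id_2^*\cap W_{(0,0,2,1)}\cong W^{(\emptyset,\emptyset,(2),(1))}\oplus W^{(\emptyset,\emptyset,(1^2),(1))}$, with $(z_1^+)^2z_1^--z_1^+z_1^-z_1^++z_1^-(z_1^+)^2$ and $[z_1^+,z_2^+]z_1^-+(z_1^+z_1^-z_2^+-z_2^+z_1^-z_1^+)+z_1^-[z_1^+,z_2^+]$; (19) $Id_2^*\cap W_{(0,0,1,2)}\cong W^{(\emptyset,\emptyset,(1),(2))}\oplus W^{(\emptyset,\emptyset,(1),(1^2))}$, with $(z_1^-)^2z_1^+-z_1^-z_1^+z_1^-+z_1^+(z_1^-)^2$ and $[z_1^-,z_2^-]z_1^++(z_1^-z_1^+z_2^--z_2^-z_1^+z_1^-)+z_1^+[z_1^-,z_2^-]$; (20) $Id_2^*\cap W_{(0,1,1,1)}\cong 2W^{(\emptyset,(1),(1),(1))}$, with $z_1^+y_1^-z_1^-+z_1^-y_1^-z_1^+$ and $[y_1^-,z_1^+z_1^-+z_1^-z_1^+]$. Here $Id_2^*$ stands for $Id_2^*(M_{1,2}(F))$.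
   Context: $F$ is a field of characteristic zero. $M_{1,2}(F)$ is the algebra of $3\times 3$ matrices over $F$ with $\mathbb{Z}_2$-grading whose even part is spanned by $e_{11},e_{22},e_{23},e_{32},e_{33}$ and odd part by $e_{12},e_{13},e_{21},e_{31}$ ($e_{ij}$ matrix units), with the orthosymplectic superinvolution $*$ sending the matrix with rows $(a,b,c),(d,e,f),(g,h,i)$ to the matrix with rows $(a,-g,d),(c,i,-f),(-b,-h,e)$. Thus the even symmetric, even skew, odd symmetric, odd skew parts are $\mathrm{span}\{e_{11},e_{22}+e_{33}\}$, $\mathrm{span}\{e_{22}-e_{33},e_{23},e_{32}\}$, $\mathrm{span}\{e_{12}-e_{31},e_{13}+e_{21}\}$, $\mathrm{span}\{e_{12}+e_{31},e_{13}-e_{21}\}$. The free $*$-superalgebra is the free associative algebra on variables $y_i^+$ (even symmetric), $y_i^-$ (even skew), $z_i^+$ (odd symmetric), $z_i^-$ (odd skew), $i\ge1$; a $*$-polynomial is a $*$-identity of $M_{1,2}(F)$ if it vanishes under every substitution of each variable by an element of the corresponding part of $M_{1,2}(F)$, and $Id_2^*(M_{1,2}(F))$ is the set of all $*$-identities. $[a,b]=ab-ba$ and $St_3(x_1,x_2,x_3)=\sum_{\theta\in S_3}\mathrm{sgn}(\theta)x_{\theta(1)}x_{\theta(2)}x_{\theta(3)}$. The space $Id_2^*(M_{1,2}(F))\cap W_{(n_1,n_2,n_3,n_4)}$ is a module for the product of four general linear groups acting by linear substitutions on the spans of the variables of each of the four types; for a multipartition $\langle\lambda\rangle=(\lambda(1),\lambda(2),\lambda(3),\lambda(4))$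 with $\lambda(i)\vdash n_i$ (partitions written with $\emptyset$ for the empty partition and $(1^k)$ for $(1,\dots,1)$), $W^{\langle\lambda\rangle}$ denotes the irreducible polynomial module of highest weight $\langle\lambda\rangle$, and $kW^{\langle\lambda\rangle}$ a direct sum of $k$ copies. *)

theory Defs
  imports "Jordan_Normal_Form.Matrix"
begin

text \<open>Variable types: YP = even symmetric (y^+), YM = even skew (y^-),
  ZP = odd symmetric (z^+), ZM = odd skew (z^-).  A variable is a type
  together with an index i (i >= 1).\<close>

datatype vt = YP | YM | ZP | ZM

type_synonym var = "vt \<times> nat"

text \<open>A noncommutative polynomial is its coefficient function on words.\<close>
type_synonym 'a npoly = "var list \<Rightarrow> 'a"

definition pvar :: "var \<Rightarrow> 'a::field npoly" where
  "pvar v = (\<lambda>w. if w = [v] then 1 else 0)"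

definition padd :: "'a::field npoly \<Rightarrow> 'a npoly \<Rightarrow> 'a npoly" (infixl "\<^bold>+" 65) where
  "p \<^bold>+ q = (\<lambda>w. p w + q w)"

definition psub :: "'a::field npoly \<Rightarrow> 'a npoly \<Rightarrow> 'a npoly" (infixl "\<^bold>-" 65) where
  "p \<^bold>- q = (\<lambda>w. p w - q w)"

definition psmul :: "'a::field \<Rightarrow> 'a npoly \<Rightarrow> 'a npoly" where
  "psmul c p = (\<lambda>w. c * p w)"

definition pmul :: "'a::field npoly \<Rightarrow> 'a npoly \<Rightarrow> 'a npoly" (infixl "\<^bold>*" 70) where
  "p \<^bold>* q = (\<lambda>w. \<Sum>k\<le>length w. p (take k w) * q (drop k w))"

definition pzero :: "'a::field npoly" where
  "pzero = (\<lambda>w. 0)"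

definition pcomm :: "'a::field npoly \<Rightarrow> 'a npoly \<Rightarrow> 'a npoly" where
  "pcomm p q = p \<^bold>* q \<^bold>- q \<^bold>* p"

definition St3 :: "'a::field npoly \<Rightarrow> 'a npoly \<Rightarrow> 'a npoly \<Rightarrow> 'a npoly" where
  "St3 x1 x2 x3 =
     x1 \<^bold>* x2 \<^bold>* x3 \<^bold>- x1 \<^bold>* x3 \<^bold>* x2 \<^bold>- x2 \<^bold>* x1 \<^bold>* x3
     \<^bold>+ x2 \<^bold>* x3 \<^bold>* x1 \<^bold>+ x3 \<^bold>* x1 \<^bold>* x2 \<^bold>- x3 \<^bold>* x2 \<^bold>* x1"

abbreviation yp :: "nat \<Rightarrow> 'a::field npoly" where "yp i \<equiv> pvar (YP, i)"
abbreviation ym :: "nat \<Rightarrow> 'a::field npoly" where "ym i \<equiv> pvar (YM, i)"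
abbreviation zp :: "nat \<Rightarrow> 'a::field npoly" where "zp i \<equiv> pvar (ZP, i)"
abbreviation zm :: "nat \<Rightarrow> 'a::field npoly" where "zm i \<equiv> pvar (ZM, i)"

text \<open>Indices 0,1,2 correspond to 1,2,3 in the paper.\<close>

definition even_mat :: "'a::field mat \<Rightarrow> bool" where
  "even_mat A \<longleftrightarrow> A \<in> carrier_mat 3 3 \<and>
     A $$ (0,1) = 0 \<and> A $$ (0,2) = 0 \<and> A $$ (1,0) = 0 \<and> A $$ (2,0) = 0"

definition odd_mat :: "'a::field mat \<Rightarrow> bool" where
  "odd_mat A \<longleftrightarrow> A \<in> carrier_mat 3 3 \<and>
     A $$ (0,0) = 0 \<and> A $$ (1,1) = 0 \<and> A $$ (1,2) = 0 \<and> A $$ (2,1) = 0 \<and> A $$ (2,2) = 0"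

text \<open>Orthosymplectic superinvolution: rows (a,b,c),(d,e,f),(g,h,i) go to
  rows (a,-g,d),(c,i,-f),(-b,-h,e).\<close>
definition sinv :: "'a::field mat \<Rightarrow> 'a mat" where
  "sinv A = mat 3 3 (\<lambda>(r,c).
     if (r,c) = (0,0) then A $$ (0,0) else
     if (r,c) = (0,1) then - A $$ (2,0) else
     if (r,c) = (0,2) then A $$ (1,0) else
     if (r,c) = (1,0) then A $$ (0,2) else
     if (r,c) = (1,1) then A $$ (2,2) else
     if (r,c) = (1,2) then - A $$ (1,2) else
     if (r,c) = (2,0) then - A $$ (0,1) else
     if (r,c) = (2,1) then - A $$ (2,1) else A $$ (1,1))"

fun vpart :: "vt \<Rightarrow> 'a::field mat set" where
  "vpart YP = {A. even_mat A \<and> sinv A = A}"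
| "vpart YM = {A. even_mat A \<and> sinv A = - A}"
| "vpart ZP = {A. odd_mat A \<and> sinv A = A}"
| "vpart ZM = {A. odd_mat A \<and> sinv A = - A}"

definition word_eval :: "(var \<Rightarrow> 'a::field mat) \<Rightarrow> var list \<Rightarrow> 'a mat" where
  "word_eval \<phi> w = foldr (\<lambda>v A. \<phi> v * A) w (1\<^sub>m 3)"

definition is_star_id :: "'a::field npoly \<Rightarrow> bool" where
  "is_star_id p \<longleftrightarrow> (\<forall>\<phi>. (\<forall>v. \<phi> v \<in> vpart (fst v)) \<longrightarrow>
     (\<forall>i<3. \<forall>j<3. (\<Sum>w\<in>{w. p w \<noteq> 0}. p w * word_eval \<phi> w $$ (i,j)) = 0))"

fun comp4 :: "nat \<Rightarrow> nat \<Rightarrow> nat \<Rightarrow> nat \<Rightarrow> vt \<Rightarrow> nat" where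
  "comp4 n1 n2 n3 n4 YP = n1"
| "comp4 n1 n2 n3 n4 YM = n2"
| "comp4 n1 n2 n3 n4 ZP = n3"
| "comp4 n1 n2 n3 n4 ZM = n4"

definition Wsp :: "(vt \<Rightarrow> nat) \<Rightarrow> 'a::field npoly set" where
  "Wsp n = {p. \<forall>w. p w \<noteq> 0 \<longrightarrow>
      (\<forall>v\<in>set w. snd v \<in> {1,2,3}) \<and> (\<forall>t. length (filter (\<lambda>v. fst v = t) w) = n t)}"

text \<open>g t acts on span of the variables of type t with index 1,2,3:
  x_{t,j} goes to sum_i (g t)_{ij} x_{t,i}; other variables are fixed.\<close>

definition lcoef :: "(vt \<Rightarrow> 'a::field mat) \<Rightarrow> var \<Rightarrow> var \<Rightarrow> 'a" where
  "lcoef g a b = (if fst a = fst b \<and> snd a \<in> {1,2,3} \<and> snd b \<in> {1,2,3}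
      then g (fst a) $$ (snd b - 1, snd a - 1) else if a = b then 1 else 0)"

definition wcoef :: "(vt \<Rightarrow> 'a::field mat) \<Rightarrow> var list \<Rightarrow> var list \<Rightarrow> 'a" where
  "wcoef g w u = (if length w = length u then (\<Prod>k<length u. lcoef g (w ! k) (u ! k)) else 0)"

definition gact :: "(vt \<Rightarrow> 'a::field mat) \<Rightarrow> 'a npoly \<Rightarrow> 'a npoly" where
  "gact g p = (\<lambda>u. \<Sum>w\<in>{w. p w \<noteq> 0}. p w * wcoef g w u)"

definition GL4 :: "(vt \<Rightarrow> 'a::field mat) set" where
  "GL4 = {g. \<forall>t. g t \<in> carrier_mat 3 3 \<and> invertible_mat (g t)}"

definition UT4 :: "(vt \<Rightarrow> 'a::field mat) set" where
  "UT4 = {g. \<forall>t. g t \<in> carrier_mat 3 3 \<and> upper_triangular (g t) \<and> (\<forall>i<3. g t $$ (i,i) = 1)}"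

definition Diag4 :: "(vt \<Rightarrow> 'a::field mat) set" where
  "Diag4 = {g. \<forall>t. g t \<in> carrier_mat 3 3 \<and> diagonal_mat (g t) \<and> (\<forall>i<3. g t $$ (i,i) \<noteq> 0)}"

definition pspan :: "'a::field npoly set \<Rightarrow> 'a npoly set" where
  "pspan S = {(\<lambda>w. \<Sum>i<m. c i * p i w) | (m::nat) c p. \<forall>i<m. p i \<in> S}"

definition gmod :: "'a::field npoly \<Rightarrow> 'a npoly set" where
  "gmod f = pspan {gact g f | g. g \<in> GL4}"

definition gsubmod :: "'a::field npoly set \<Rightarrow> bool" where
  "gsubmod N \<longleftrightarrow> pzero \<in> N \<and> (\<forall>x\<in>N. \<forall>y\<in>N. x \<^bold>+ y \<in> N) \<and>
     (\<forall>c. \<forall>x\<in>N. psmul c x \<in> N) \<and> (\<forall>g\<in>GL4. \<forall>x\<in>N. gact g x \<in> N)"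

definition irreducible_mod :: "'a::field npoly set \<Rightarrow> bool" where
  "irreducible_mod M \<longleftrightarrow> gsubmod M \<and> M \<noteq> {pzero} \<and>
     (\<forall>N. N \<subseteq> M \<longrightarrow> gsubmod N \<longrightarrow> N \<noteq> {pzero} \<longrightarrow> N = M)"

text \<open>Multipartition: one partition (list of nonincreasing parts) per variable type.\<close>
type_synonym mpart = "vt \<Rightarrow> nat list"

fun mp4 :: "nat list \<Rightarrow> nat list \<Rightarrow> nat list \<Rightarrow> nat list \<Rightarrow> mpart" where
  "mp4 l1 l2 l3 l4 YP = l1"
| "mp4 l1 l2 l3 l4 YM = l2"
| "mp4 l1 l2 l3 l4 ZP = l3"
| "mp4 l1 l2 l3 l4 ZM = l4"

definition ppart :: "nat list \<Rightarrow> nat \<Rightarrow> nat" where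
  "ppart l i = (if i < length l then l ! i else 0)"

definition hwv :: "mpart \<Rightarrow> 'a::field npoly \<Rightarrow> bool" where
  "hwv lam f \<longleftrightarrow> f \<noteq> pzero \<and> (\<forall>g\<in>UT4. gact g f = f) \<and>
     (\<forall>d\<in>Diag4. gact d f =
        psmul (\<Prod>t\<in>{YP,YM,ZP,ZM}. \<Prod>i<3. (d t $$ (i,i)) ^ ppart (lam t) i) f)"

definition decomp :: "(vt \<Rightarrow> nat) \<Rightarrow> ('a::field npoly \<times> mpart) list \<Rightarrow> bool" where
  "decomp n gens \<longleftrightarrow>
     (let S = {p \<in> Wsp n. is_star_id p}; m = length gens; M = (\<lambda>k. gmod (fst (gens ! k))) in
       (\<forall>k<m. fst (gens ! k) \<in> S \<and> hwv (snd (gens ! k)) (fst (gens ! k)) \<and> irreducible_mod (M k))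
       \<and> S = {(\<lambda>w. \<Sum>k<m. x k w) | x. \<forall>k<m. x k \<in> M k}
       \<and> (\<forall>x. (\<forall>k<m. x k \<in> M k) \<longrightarrow> (\<lambda>w. \<Sum>k<m. x k w) = pzero \<longrightarrow> (\<forall>k<m. x k = pzero)))"

end

theory Submission
  imports Defs "Jordan_Normal_Form.Char_Poly"
begin

text \<open>Submodules are stable only under invertible substitutions, whereas identifying or
  renaming variables is a singular one; \<open>gsubmod_gact\<close> therefore extends stability to
  all matrices. Letters and positions decouple: the group acts on the letters of a word, \<sigma>
  permutes its positions, so linearizations of a transformed polynomial are combinations of
  linearizations with scalars free of \<sigma> (\<open>lin_gact\<close>). Hence a subspace Q of
  coefficient vectors cuts out a submodule \<open>Phi\<close>, which bounds a generated module from
  above, while \<open>spec\<close> bounds it from below. Irreducibility needs no complete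
  reducibility: Q is chosen so that each of its nonzero vectors specializes to a nonzero multiple of
  the generator. Characteristic zero supplies infinitely many scalars for the extrapolation, the
  inverse of 6 in \<open>subsp_of_spec_lin\<close>, the inverse of 2 in \<open>vpart_iff\<close> and
  the inverse of 3 in \<open>gen_ok_planeI\<close>.\<close>

text \<open>
  In characteristic zero and degree three (with three variables of each type available) a submodule of
  the space of polynomials with fixed type content is determined by its multilinear elements, i.e. by a
  subspace of the six-dimensional space of coefficient vectors indexed by the permutations of three
  letters: full linearization and specialization of variables lie in the linear span of the group
  action. Under this correspondence the identities become the six-dimensional vectors killed by all
  evaluations on matrix triples, and the module generated by a highest weight vector becomes a subspace of
  dimension one, or two for the shape (2,1). Irreducibility, directness and completeness of each
  decomposition are thereby reduced to linear algebra in dimension six.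
\<close>

subsection \<open>Words of length three\<close>

definition Vars :: "var set" where
  "Vars = UNIV \<times> {1,2,3}"

text \<open>Describes a content by three types in a chosen order rather than by four multiplicities.
  The order fixes the meaning of the three slots of \<open>lin\<close> and
  \<open>spec\<close>.\<close>

definition tcount :: "vt \<Rightarrow> vt \<Rightarrow> vt \<Rightarrow> vt \<Rightarrow> nat" where
  "tcount a b c t = length (filter (\<lambda>s. s = t) [a, b, c])"

datatype s3 = P123 | P132 | P213 | P231 | P312 | P321

lemma UNIV_s3: "UNIV = {P123, P132, P213, P231, P312, P321}"
  using s3.exhaust by auto

lemma UNIV_vt: "UNIV = {YP, YM, ZP, ZM}"
  using vt.exhaust by auto

lemma finite_Vars: "finite Vars"
  by (simp add: Vars_def UNIV_vt)

fun pw :: "s3 \<Rightarrow> 'b \<Rightarrow> 'b \<Rightarrow> 'b \<Rightarrow> 'b list" where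
  "pw P123 a b c = [a, b, c]"
| "pw P132 a b c = [a, c, b]"
| "pw P213 a b c = [b, a, c]"
| "pw P231 a b c = [b, c, a]"
| "pw P312 a b c = [c, a, b]"
| "pw P321 a b c = [c, b, a]"

text \<open>\<open>lin x a b c\<close> is the coefficient vector of the full linearization of the component of \<open>x\<close> with
  letters \<open>a, b, c\<close>; \<open>spec q a b c\<close> substitutes these letters into the multilinear polynomial with
  coefficient vector \<open>q\<close>. For a repeated letter the composition multiplies by the order of the stabilizer.\<close>

definition lin :: "'a npoly \<Rightarrow> var \<Rightarrow> var \<Rightarrow> var \<Rightarrow> s3 \<Rightarrow> 'a" where
  "lin x a b c = (\<lambda>\<sigma>. x (pw \<sigma> a b c))"

definition spec :: "(s3 \<Rightarrow> 'a) \<Rightarrow> var \<Rightarrow> var \<Rightarrow> var \<Rightarrow> 'a::field npoly" where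
  "spec q a b c = (\<lambda>u. \<Sum>\<sigma>\<in>UNIV. if pw \<sigma> a b c = u then q \<sigma> else 0)"

lemma all_s3: "(\<forall>\<sigma>. P \<sigma>) \<longleftrightarrow> P P123 \<and> P P132 \<and> P P213 \<and> P P231 \<and> P P312 \<and> P P321"
  by (metis s3.exhaust)

lemma mset_eq_content:
  assumes "\<And>t. length (filter (\<lambda>v. fst v = t) w) = tcount a b c t"
  shows "mset (map fst w) = {#a, b, c#}"
proof (rule multiset_eqI)
  fix t
  have "count (mset (map fst w)) t = length (filter (\<lambda>v. fst v = t) w)"
    by (induction w) auto
  then show "count (mset (map fst w)) t = count {#a, b, c#} t"
    using assms[of t] by (simp add: tcount_def)
qed

lemma pw_of_mset:
  assumes "mset w = {#a, b, c#}"
  shows "\<exists>\<sigma>. w = pw \<sigma> a b c"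
proof -
  have "length w = 3"
    using arg_cong[OF assms, of size] by simp
  then obtain x y z where w: "w = [x, y, z]"
    by (auto simp: numeral_3_eq_3 length_Suc_conv)
  from assms have "w = pw P123 a b c \<or> w = pw P132 a b c \<or> w = pw P213 a b c
     \<or> w = pw P231 a b c \<or> w = pw P312 a b c \<or> w = pw P321 a b c"
    unfolding w by (auto simp: add_eq_conv_ex)
  then show ?thesis by blast
qed

text \<open>The permutation is read off from the types alone; the indices are then carried along to
  the slots.\<close>

lemma Wsp_support:
  assumes "x \<in> Wsp (tcount t0 t1 t2)" "x u \<noteq> 0"
  obtains \<sigma> i j k where "u = pw \<sigma> (t0,i) (t1,j) (t2,k)"
    "i \<in> {1,2,3}" "j \<in> {1,2,3}" "k \<in> {1,2,3}"
proof -
  from assms have c: "\<And>t. length (filter (\<lambda>v. fst v = t) u) = tcount t0 t1 t2 t"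
    and s: "\<forall>v\<in>set u. snd v \<in> {1,2,3}" by (auto simp: Wsp_def)
  from pw_of_mset[OF mset_eq_content[OF c]] obtain \<sigma> where \<sigma>: "map fst u = pw \<sigma> t0 t1 t2" ..
  have "\<exists>i j k. u = pw \<sigma> (t0,i) (t1,j) (t2,k) \<and> i \<in> {1,2,3} \<and> j \<in> {1,2,3} \<and> k \<in> {1,2,3}"
    using \<sigma> s by (cases \<sigma>) (auto simp: map_eq_Cons_conv)
  then show ?thesis using that by blast
qed

lemma tcount_pw:
  "length (filter (\<lambda>v. fst v = t) (pw \<sigma> (t0,i) (t1,j) (t2,k))) = tcount t0 t1 t2 t"
  by (cases \<sigma>) (auto simp: tcount_def)

lemma set_pw: "set (pw \<sigma> a b c) = {a, b, c}"
  by (cases \<sigma>) auto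

lemma Wsp_support3:
  assumes "x \<in> Wsp (tcount t0 t1 t2)" "x u \<noteq> 0"
  obtains a b c where "u = [a, b, c]" "a \<in> Vars" "b \<in> Vars" "c \<in> Vars"
proof -
  obtain \<sigma> i j k where u: "u = pw \<sigma> (t0,i) (t1,j) (t2,k)"
    "i \<in> {1,2,3}" "j \<in> {1,2,3}" "k \<in> {1,2,3}" using Wsp_support[OF assms] .
  then show ?thesis using that by (cases \<sigma>) (auto simp: Vars_def)
qed

text \<open>Replaces the support, which varies with \<open>x\<close>, by one fixed index set, so
  that sums for different polynomials can be added, compared and interchanged.\<close>

lemma sum_support:
  assumes "x \<in> Wsp (tcount t0 t1 t2)"
  shows "(\<Sum>w\<in>{w. x w \<noteq> 0}. x w * h w) = (\<Sum>a\<in>Vars. \<Sum>b\<in>Vars. \<Sum>c\<in>Vars. x [a,b,c] * (h [a,b,c] :: 'a::field))"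
proof -
  let ?f = "\<lambda>(a,b,c). [a,b,c] :: var list"
  have inj: "inj_on ?f (Vars \<times> Vars \<times> Vars)" by (auto simp: inj_on_def)
  have "(\<Sum>w\<in>{w. x w \<noteq> 0}. x w * h w) = (\<Sum>w\<in>?f ` (Vars \<times> Vars \<times> Vars). x w * h w)"
  proof (rule sum.mono_neutral_left)
    show "{w. x w \<noteq> 0} \<subseteq> ?f ` (Vars \<times> Vars \<times> Vars)"
    proof
      fix w assume "w \<in> {w. x w \<noteq> 0}"
      then obtain a b c where "w = [a,b,c]" "a \<in> Vars" "b \<in> Vars" "c \<in> Vars"
        using Wsp_support3[OF assms] by blast
      then show "w \<in> ?f ` (Vars \<times> Vars \<times> Vars)" by (intro image_eqI[of _ _ "(a,b,c)"]) auto
    qed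
  qed (auto simp: finite_Vars)
  also have "\<dots> = (\<Sum>(a,b,c)\<in>Vars \<times> Vars \<times> Vars. x [a,b,c] * h [a,b,c])"
    by (subst sum.reindex[OF inj]) (simp add: case_prod_beta)
  finally show ?thesis by (simp add: sum.cartesian_product case_prod_beta)
qed

section \<open>The action of substitutions on words of length three\<close>

lemma wcoef3:
  "wcoef g [a,b,c] [u,v,w] = lcoef g a u * lcoef g b v * lcoef g c w"
  by (simp add: wcoef_def lessThan_Suc mult_ac numeral_3_eq_3)

lemma gact_word3:
  assumes "x \<in> Wsp (tcount t0 t1 t2)"
  shows "gact g x [u,v,w] = (\<Sum>a\<in>Vars. \<Sum>b\<in>Vars. \<Sum>c\<in>Vars. x [a,b,c] * (lcoef g a u * lcoef g b v * lcoef g c w))"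
  unfolding gact_def sum_support[OF assms] wcoef3 ..

lemma gact_Wsp:
  assumes "x \<in> Wsp (tcount t0 t1 t2)"
  shows "gact g x \<in> Wsp (tcount t0 t1 t2)"
proof -
  have key: "(\<forall>v\<in>set u. snd v \<in> {1,2,3}) \<and> (\<forall>t. length (filter (\<lambda>v. fst v = t) u) = tcount t0 t1 t2 t)"
    if nz: "gact g x u \<noteq> 0" for u
  proof -
    from nz obtain w where w: "x w \<noteq> 0" and nz': "wcoef g w u \<noteq> 0"
      unfolding gact_def by (metis (mono_tags, lifting) mult_eq_0_iff sum.neutral mem_Collect_eq)
    from w assms have cont: "(\<forall>v\<in>set w. snd v \<in> {1,2,3})" 
      "(\<forall>t. length (filter (\<lambda>v. fst v = t) w) = tcount t0 t1 t2 t)"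
      by (auto simp: Wsp_def)
    obtain a b c where wabc: "w = [a,b,c]" using Wsp_support3[OF assms w] by blast
    from nz' wabc obtain p q r where u: "u = [p,q,r]"
      unfolding wcoef_def by (metis (no_types) length_Suc_conv length_0_conv)
    have "lcoef g a p \<noteq> 0" "lcoef g b q \<noteq> 0" "lcoef g c r \<noteq> 0"
      using nz' by (auto simp: wabc u wcoef3)
    then have "fst p = fst a" "fst q = fst b" "fst r = fst c"
      "snd p \<in> {1,2,3}" "snd q \<in> {1,2,3}" "snd r \<in> {1,2,3}"
      using cont(1) by (auto simp: lcoef_def wabc split: if_splits)
    moreover from this have "length (filter (\<lambda>v. fst v = t) u) = length (filter (\<lambda>v. fst v = t) w)" for t
      unfolding wabc u by simp
    ultimately show ?thesis using cont(2) by (simp add: u)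
  qed
  then show ?thesis by (simp add: Wsp_def)
qed

lemma Wsp_eqI:
  assumes "x \<in> Wsp (tcount t0 t1 t2)" "y \<in> Wsp (tcount t0 t1 t2)"
    and "\<And>u v w. u \<in> Vars \<Longrightarrow> v \<in> Vars \<Longrightarrow> w \<in> Vars \<Longrightarrow> x [u,v,w] = y [u,v,w]"
  shows "x = y"
proof
  fix u
  show "x u = y u"
  proof (cases "x u = 0 \<and> y u = 0")
    case False
    then obtain a b c where "u = [a,b,c]" "a \<in> Vars" "b \<in> Vars" "c \<in> Vars"
      using Wsp_support3[OF assms(1)] Wsp_support3[OF assms(2)] by blast
    then show ?thesis using assms(3) by simp
  qed simp
qed

lemma trisum_product:
  fixes f g h :: "'b \<Rightarrow> 'a::field"
  shows "(\<Sum>a\<in>A. f a) * (\<Sum>a\<in>A. g a) * (\<Sum>a\<in>A. h a) = (\<Sum>a\<in>A. \<Sum>b\<in>A. \<Sum>c\<in>A. f a * g b * h c)"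
  by (subst sum_product, subst sum_distrib_right, rule sum.cong, rule refl, rule sum_product)

lemma trisum_product_set:
  "(\<Sum>a\<in>A. \<Sum>b\<in>A. \<Sum>c\<in>A. F a b c) = (\<Sum>y\<in>A \<times> A \<times> A. F (fst y) (fst (snd y)) (snd (snd y)))"
  by (simp add: sum.cartesian_product case_prod_beta)

text \<open>Two successive linear substitutions of letters compose slot by slot. This serves both
  for products of group elements and for evaluating a transformed polynomial on matrices.\<close>

lemma trisum_compose:
  fixes X :: "'b \<Rightarrow> 'b \<Rightarrow> 'b \<Rightarrow> 'a::field"
  shows "(\<Sum>a\<in>A. \<Sum>b\<in>A. \<Sum>c\<in>A. (\<Sum>p\<in>A. \<Sum>q\<in>A. \<Sum>r\<in>A. X p q r * (H p a * H q b * H r c)) * (f a * g b * h c))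
   = (\<Sum>p\<in>A. \<Sum>q\<in>A. \<Sum>r\<in>A. X p q r * ((\<Sum>a\<in>A. H p a * f a) * (\<Sum>a\<in>A. H q a * g a) * (\<Sum>a\<in>A. H r a * h a)))"
  unfolding trisum_product unfolding trisum_product_set unfolding sum_distrib_left sum_distrib_right
  by (subst sum.swap) (intro sum.cong refl, simp add: mult_ac)

lemma sum_Vars: "(\<Sum>b\<in>Vars. f b) = (\<Sum>t\<in>{YP,YM,ZP,ZM}. f (t,1) + f (t,2) + (f (t,3) :: 'a::field))"
proof -
  have "(\<Sum>b\<in>Vars. f b) = (\<Sum>t\<in>{YP,YM,ZP,ZM}. \<Sum>i\<in>{1,2,3}. f (t,i))"
    unfolding Vars_def UNIV_vt by (simp only: sum.cartesian_product case_prod_eta)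
  then show ?thesis by (simp add: add.assoc)
qed

lemma sum_lcoef:
  assumes "a \<in> Vars"
  shows "(\<Sum>b\<in>Vars. lcoef g a b * f b) = (\<Sum>i<3. g (fst a) $$ (i, snd a - 1) * f (fst a, Suc i))"
proof -
  obtain t i where a: "a = (t,i)" and i: "i = 1 \<or> i = 2 \<or> i = 3"
    using assms by (auto simp: Vars_def)
  have "(\<Sum>b\<in>Vars. lcoef g a b * f b) = (\<Sum>s\<in>{YP,YM,ZP,ZM}. if s = t then
      g t $$ (0, i - 1) * f (t, 1) + g t $$ (1, i - 1) * f (t, 2) + g t $$ (2, i - 1) * f (t, 3) else 0)"
    unfolding sum_Vars using i by (intro sum.cong refl) (auto simp: lcoef_def a)
  also have "\<dots> = g t $$ (0, i - 1) * f (t, 1) + g t $$ (1, i - 1) * f (t, 2) + g t $$ (2, i - 1) * f (t, 3)"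
    by (cases t) simp_all
  finally show ?thesis by (simp add: a eval_nat_numeral)
qed

lemma index_mult_mat3:
  fixes A B :: "'a::field mat"
  assumes "A \<in> carrier_mat 3 3" "B \<in> carrier_mat 3 3" "i < 3" "j < 3"
  shows "(A * B) $$ (i,j) = (\<Sum>k<3. A $$ (i,k) * B $$ (k,j))"
  using assms by (simp add: scalar_prod_def lessThan_atLeast0)

lemma lcoef_mult:
  assumes "a \<in> Vars" "b \<in> Vars" "\<And>t. g t \<in> carrier_mat 3 3" "\<And>t. h t \<in> carrier_mat 3 3"
  shows "(\<Sum>c\<in>Vars. lcoef h a c * lcoef g c b) = lcoef (\<lambda>t. g t * h t) a b"
proof -
  obtain t i s j where a: "a = (t,i)" and i: "i \<in> {1,2,3}" and b: "b = (s,j)" and j: "j \<in> {1,2,3}"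
    using assms(1,2) unfolding Vars_def by blast
  have l: "lcoef g (t, Suc k) b = (if s = t then g t $$ (j - 1, k) else 0)" if "k < 3" for k
  proof -
    have "Suc k \<in> {1,2,3}" using that by auto
    then show ?thesis using j by (simp add: lcoef_def b)
  qed
  have *: "i - 1 < 3" "j - 1 < 3" using i j by auto
  have "(\<Sum>c\<in>Vars. lcoef h a c * lcoef g c b) = (\<Sum>k<3. h t $$ (k, i - 1) * (if s = t then g t $$ (j - 1, k) else 0))"
    unfolding sum_lcoef[OF assms(1)] using l by (simp add: a)
  also have "\<dots> = (if s = t then (g t * h t) $$ (j - 1, i - 1) else 0)"
    unfolding index_mult_mat3[OF assms(3,4) *(2,1)] by (simp add: mult.commute)
  also have "\<dots> = lcoef (\<lambda>t. g t * h t) a b"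
    using i j by (simp add: lcoef_def a b)
  finally show ?thesis .
qed

text \<open>A left action: column j of a matrix holds the image of the variable with index j, so
  applying \<open>h\<close> and then \<open>g\<close> corresponds to
  \<open>g t * h t\<close>.\<close>

lemma gact_gact:
  assumes x: "x \<in> Wsp (tcount t0 t1 t2)" and g: "\<And>t. g t \<in> carrier_mat 3 3" "\<And>t. h t \<in> carrier_mat 3 3"
  shows "gact g (gact h x) = gact (\<lambda>t. g t * h t) x"
proof (rule Wsp_eqI)
  note W = gact_Wsp[OF x]
  show "gact g (gact h x) \<in> Wsp (tcount t0 t1 t2)" "gact (\<lambda>t. g t * h t) x \<in> Wsp (tcount t0 t1 t2)"
    using W gact_Wsp by blast+
  fix u v w assume Vars: "u \<in> Vars" "v \<in> Vars" "w \<in> Vars"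
  show "gact g (gact h x) [u,v,w] = gact (\<lambda>t. g t * h t) x [u,v,w]"
    unfolding gact_word3[OF W] unfolding gact_word3[OF x] trisum_compose
    using Vars by (intro sum.cong refl) (simp add: lcoef_mult[OF _ _ g])
qed

section \<open>Linear subspaces, both of polynomials and of coefficient vectors\<close>

definition subsp :: "('b \<Rightarrow> 'a::field) set \<Rightarrow> bool" where
  "subsp T \<longleftrightarrow> (\<lambda>_. 0) \<in> T \<and> (\<forall>x\<in>T. \<forall>y\<in>T. (\<lambda>u. x u + y u) \<in> T) \<and> (\<forall>c. \<forall>x\<in>T. (\<lambda>u. c * x u) \<in> T)"

lemma subsp_zero: "subsp T \<Longrightarrow> (\<lambda>_. 0) \<in> T"
  by (simp add: subsp_def)

lemma subsp_add: "subsp T \<Longrightarrow> x \<in> T \<Longrightarrow> y \<in> T \<Longrightarrow> (\<lambda>u. x u + y u) \<in> T"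
  unfolding subsp_def by blast

lemma subsp_scale: "subsp T \<Longrightarrow> x \<in> T \<Longrightarrow> (\<lambda>u. c * x u) \<in> T"
  unfolding subsp_def by blast

lemma subsp_sum:
  assumes "subsp T" "\<And>i. i \<in> A \<Longrightarrow> y i \<in> T"
  shows "(\<lambda>w. \<Sum>i\<in>A. y i w) \<in> T"
  using assms(2)
proof (induction A rule: infinite_finite_induct)
  case (insert a A)
  then show ?case using subsp_add[OF assms(1), of "y a"] by simp
qed (simp_all add: subsp_zero[OF assms(1)])

text \<open>Four terms suit the cubic extrapolation; the seven terms of the inclusion-exclusion are
  two nested instances.\<close>

lemma subsp_lincomb4:
  assumes "subsp T" "x \<in> T" "y \<in> T" "z \<in> T" "w \<in> T"
  shows "(\<lambda>u. c1 * x u + c2 * y u + c3 * z u + c4 * w u) \<in> T"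
  using assms by (intro subsp_add subsp_scale)

lemma gsubmod_iff:
  "gsubmod N \<longleftrightarrow> subsp N \<and> (\<forall>g\<in>GL4. \<forall>x\<in>N. gact g x \<in> N)"
  unfolding gsubmod_def subsp_def pzero_def padd_def psmul_def by blast

lemma subsp_Wsp: "subsp (Wsp n :: 'a::field npoly set)"
proof -
  define P where "P w \<longleftrightarrow> (\<forall>v\<in>set w. snd v \<in> {1,2,3}) \<and> (\<forall>t. length (filter (\<lambda>v. fst v = t) w) = n t)"
    for w :: "var list"
  have "(Wsp n :: 'a npoly set) = {x. \<forall>w. \<not> P w \<longrightarrow> x w = 0}" unfolding Wsp_def P_def by blast
  then show ?thesis by (simp add: subsp_def)
qed

lemma spec_expand:
  "spec q a b c u = (if [a,b,c] = u then q P123 else 0) + (if [a,c,b] = u then q P132 else 0)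
    + (if [b,a,c] = u then q P213 else 0) + (if [b,c,a] = u then q P231 else 0)
    + (if [c,a,b] = u then q P312 else 0) + (if [c,b,a] = u then q P321 else 0)"
  by (simp add: spec_def UNIV_s3 add.assoc split del: if_split)

subsection \<open>Polarization\<close>

lemma invertible_mat_iff_det:
  fixes A :: "'a::field mat"
  assumes A: "A \<in> carrier_mat n n"
  shows "invertible_mat A \<longleftrightarrow> det A \<noteq> 0"
proof
  assume "det A \<noteq> 0"
  then have "A \<in> Units (ring_mat TYPE('a) n ())"
    by (rule det_non_zero_imp_unit[OF A])
  then show "invertible_mat A" using A
    unfolding invertible_mat_def inverts_mat_def Units_def by (auto simp: ring_mat_def)
next
  assume "invertible_mat A"
  then obtain B where B: "A * B = 1\<^sub>m n" "B * A = 1\<^sub>m (dim_row B)"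
    using A unfolding invertible_mat_def inverts_mat_def by auto
  have "dim_col B = n" "dim_row B = n"
    using arg_cong[OF B(1), of dim_col] arg_cong[OF B(2), of dim_col] A by auto
  then have "B \<in> carrier_mat n n" by auto
  then have "det A * det B = 1" using det_mult[OF A] B(1) by (metis det_one)
  then show "det A \<noteq> 0" by auto
qed

text \<open>\<open>char_matrix h (- r)\<close> is h + r I, which is singular only if - r is a root
  of the characteristic polynomial.\<close>

lemma finite_singular_shifts:
  fixes h :: "'a::field mat"
  assumes h: "h \<in> carrier_mat 3 3"
  shows "finite {r. \<not> invertible_mat (char_matrix h (- r))}"
proof -
  have inv: "invertible_mat (char_matrix h k)" if "poly (char_poly h) k \<noteq> 0" for k
  proof -
    have c: "char_matrix h k \<in> carrier_mat 3 3" using h by (simp add: char_matrix_def)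
    show ?thesis unfolding invertible_mat_iff_det[OF c]
      using that eigenvalue_root_char_poly[OF h] eigenvalue_det[OF h] by blast
  qed
  have "char_poly h \<noteq> 0" using degree_monic_char_poly[OF h] by auto
  then have "finite (uminus ` {k. poly (char_poly h) k = 0})"
    by (simp add: poly_roots_finite)
  moreover have "{r. \<not> invertible_mat (char_matrix h (- r))} \<subseteq> uminus ` {k. poly (char_poly h) k = 0}"
  proof
    fix r assume "r \<in> {r. \<not> invertible_mat (char_matrix h (- r))}"
    then have "poly (char_poly h) (- r) = 0" using inv by blast
    then show "r \<in> uminus ` {k. poly (char_poly h) k = 0}"
      by (intro image_eqI[of _ _ "- r"]) simp_all
  qed
  ultimately show ?thesis by (rule finite_subset[rotated])
qed

lemma lcoef_char_matrix:
  assumes "a \<in> Vars" "b \<in> Vars" "\<And>t. h t \<in> carrier_mat 3 3"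
  shows "lcoef (\<lambda>t. char_matrix (h t) (- r)) a b = lcoef h a b + (if a = b then r else 0)"
proof -
  have "dim_row (h t) = 3" "dim_col (h t) = 3" for t using assms(3) by (metis carrier_matD)+
  moreover obtain t i s j where "a = (t,i)" "i \<in> {1,2,3}" "b = (s,j)" "j \<in> {1,2,3}"
    using assms(1,2) unfolding Vars_def by blast
  ultimately show ?thesis by (auto simp: lcoef_def char_matrix_def)
qed

text \<open>The fourth finite difference of a cubic polynomial vanishes; 4, -6, 4, -1 are the signed
  binomial coefficients that express its value at 0 by those at r, 2r, 3r, 4r.\<close>

lemma cubic_extrapolation:
  fixes X :: "'a::field_char_0"
  shows "X * (a * b * c) = 4 * (X * ((a + 1 * r * p) * (b + 1 * r * q) * (c + 1 * r * s)))
    + (-6) * (X * ((a + 2 * r * p) * (b + 2 * r * q) * (c + 2 * r * s)))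
    + 4 * (X * ((a + 3 * r * p) * (b + 3 * r * q) * (c + 3 * r * s)))
    + (-1) * (X * ((a + 4 * r * p) * (b + 4 * r * q) * (c + 4 * r * s)))"
  by (simp add: algebra_simps)

text \<open>Inclusion-exclusion over the nonempty subsets of three summands leaves the products that
  use each summand once. The factors 1 and 0 and the nesting are kept so that the equation matches
  literally the combination formed in \<open>gsubmod_spec_lin\<close>.\<close>

lemma multilinear_coefficient:
  fixes X :: "'a::field_char_0"
  shows "1 * (1 * (X * ((1 * a0 + 1 * a1 + 1 * a2) * (1 * b0 + 1 * b1 + 1 * b2) * (1 * c0 + 1 * c1 + 1 * c2)))
    + (-1) * (X * ((1 * a0 + 1 * a1 + 0 * a2) * (1 * b0 + 1 * b1 + 0 * b2) * (1 * c0 + 1 * c1 + 0 * c2)))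
    + (-1) * (X * ((1 * a0 + 0 * a1 + 1 * a2) * (1 * b0 + 0 * b1 + 1 * b2) * (1 * c0 + 0 * c1 + 1 * c2)))
    + (-1) * (X * ((0 * a0 + 1 * a1 + 1 * a2) * (0 * b0 + 1 * b1 + 1 * b2) * (0 * c0 + 1 * c1 + 1 * c2))))
    + 1 * (X * ((1 * a0 + 0 * a1 + 0 * a2) * (1 * b0 + 0 * b1 + 0 * b2) * (1 * c0 + 0 * c1 + 0 * c2)))
    + 1 * (X * ((0 * a0 + 1 * a1 + 0 * a2) * (0 * b0 + 1 * b1 + 0 * b2) * (0 * c0 + 1 * c1 + 0 * c2)))
    + 1 * (X * ((0 * a0 + 0 * a1 + 1 * a2) * (0 * b0 + 0 * b1 + 1 * b2) * (0 * c0 + 0 * c1 + 1 * c2)))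
  = X * (a0 * b1 * c2) + X * (a0 * b2 * c1) + X * (a1 * b0 * c2) + X * (a1 * b2 * c0)
    + X * (a2 * b0 * c1) + X * (a2 * b1 * c0)"
  by (simp add: algebra_simps)

text \<open>The action of a singular matrix is the value at 0 of the cubic polynomial \<open>r \<mapsto> gact (h + r)\<close>,
  which extrapolates linearly from the values at \<open>r, 2r, 3r, 4r\<close>; these are invertible for generic \<open>r\<close>.\<close>

lemma gsubmod_gact:
  fixes x :: "'a::field_char_0 npoly"
  assumes N: "gsubmod N" and x: "x \<in> N" "x \<in> Wsp (tcount t0 t1 t2)"
    and h: "\<And>t. h t \<in> carrier_mat 3 3"
  shows "gact h x \<in> N"
proof -
  have sN: "subsp N" using N by (simp add: gsubmod_iff)
  \<comment> \<open>One shift \<open>r\<close> must serve all four types and all four multiples of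
    it, so finitely many finite sets of values are avoided at once.\<close>
  define bad where "bad = (\<Union>t. {r. \<not> invertible_mat (char_matrix (h t) (- r))})"
  have "finite bad" unfolding bad_def UNIV_vt using finite_singular_shifts[OF h] by auto
  then have "finite (\<Union>k\<in>{1,2,3,4}. (\<lambda>r. r / k) ` bad)" by simp
  from ex_new_if_finite[OF infinite_UNIV_char_0 this] obtain r where r: "r \<notin> (\<Union>k\<in>{1,2,3,4}. (\<lambda>r. r / k) ` bad)" ..
  define G where "G k = (\<lambda>t. char_matrix (h t) (- (k * r)))" for k
  have "k * r \<notin> bad" if "k \<in> {1,2,3,4}" for k
    using r that by (auto simp: mult.commute[of r] intro!: image_eqI)
  then have GL: "G k \<in> GL4" if "k \<in> {1,2,3,4}" for k
    using that carrier_matD[OF h] unfolding bad_def G_def GL4_def by (auto simp: char_matrix_def)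
  then have GN: "gact (G k) x \<in> N" if "k \<in> {1,2,3,4}" for k
    using that N x unfolding gsubmod_iff by blast
  let ?y = "\<lambda>u. 4 * gact (G 1) x u + (-6) * gact (G 2) x u + 4 * gact (G 3) x u + (-1) * gact (G 4) x u"
  have "?y \<in> N" by (rule subsp_lincomb4[OF sN]) (rule GN, simp)+
  moreover have "gact h x = ?y"
  proof (rule Wsp_eqI)
    show "gact h x \<in> Wsp (tcount t0 t1 t2)" by (rule gact_Wsp[OF x(2)])
    show "?y \<in> Wsp (tcount t0 t1 t2)" by (intro subsp_lincomb4[OF subsp_Wsp] gact_Wsp[OF x(2)])
    fix u v w assume Vars: "u \<in> Vars" "v \<in> Vars" "w \<in> Vars"
    show "gact h x [u,v,w] = ?y [u,v,w]"
      unfolding gact_word3[OF x(2)] sum_distrib_left sum.distrib[symmetric]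
    proof (intro sum.cong refl)
      fix a b c assume abc: "a \<in> Vars" "b \<in> Vars" "c \<in> Vars"
      have "lcoef (G k) p q = lcoef h p q + k * r * (if p = q then 1 else 0)" if "p \<in> Vars" "q \<in> Vars" for k p q
        using that by (simp add: G_def lcoef_char_matrix[OF _ _ h])
      then show "x [a,b,c] * (lcoef h a u * lcoef h b v * lcoef h c w)
         = 4 * (x [a,b,c] * (lcoef (G 1) a u * lcoef (G 1) b v * lcoef (G 1) c w))
         + (-6) * (x [a,b,c] * (lcoef (G 2) a u * lcoef (G 2) b v * lcoef (G 2) c w))
         + 4 * (x [a,b,c] * (lcoef (G 3) a u * lcoef (G 3) b v * lcoef (G 3) c w))
         + (-1) * (x [a,b,c] * (lcoef (G 4) a u * lcoef (G 4) b v * lcoef (G 4) c w))"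
        using abc Vars by (simp only: cubic_extrapolation)
    qed
  qed
  ultimately show ?thesis by simp
qed

section \<open>Renaming letters inside a submodule\<close>

definition typed3 :: "vt \<Rightarrow> vt \<Rightarrow> vt \<Rightarrow> var \<Rightarrow> var \<Rightarrow> var \<Rightarrow> bool" where
  "typed3 t0 t1 t2 a b c \<longleftrightarrow> a \<in> Vars \<and> b \<in> Vars \<and> c \<in> Vars \<and> fst a = t0 \<and> fst b = t1 \<and> fst c = t2"

lemma spec_Wsp:
  assumes "typed3 t0 t1 t2 a b c"
  shows "spec q a b c \<in> Wsp (tcount t0 t1 t2)"
proof -
  have "\<exists>\<sigma>. u = pw \<sigma> a b c" if "spec q a b c u \<noteq> 0" for u
  proof (rule ccontr)
    assume "\<nexists>\<sigma>. u = pw \<sigma> a b c"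
    then have "pw \<sigma> a b c \<noteq> u" for \<sigma> by blast
    then show False using that by (simp add: spec_def)
  qed
  moreover have "length (filter (\<lambda>v. fst v = t) (pw \<sigma> a b c)) = tcount t0 t1 t2 t" for \<sigma> t
    using assms tcount_pw[of t \<sigma> "fst a" "snd a" "fst b" "snd b" "fst c" "snd c"]
    by (cases a; cases b; cases c) (auto simp: typed3_def)
  moreover have "snd v \<in> {1,2,3}" if "v \<in> set (pw \<sigma> a b c)" for \<sigma> v
    using that assms by (auto simp: set_pw typed3_def Vars_def)
  ultimately show ?thesis unfolding Wsp_def by (intro CollectI allI impI conjI ballI) metis+
qed

text \<open>The side conditions P, Q, R stand for the requirements on the target letters, so that
  each factor is an entry of a matrix unit.\<close>

lemma trisum_delta:
  assumes "d \<in> Vars" "e \<in> Vars" "f \<in> Vars"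
  shows "(\<Sum>a\<in>Vars. \<Sum>b\<in>Vars. \<Sum>c\<in>Vars. X a b c *
      ((if a = d \<and> P then 1 else 0) * (if b = e \<and> Q then 1 else 0) * (if c = f \<and> R then 1 else 0)))
    = (if P \<and> Q \<and> R then X d e f else (0::'a::field))"
proof -
  have "X a b c * ((if a = d \<and> P then 1 else 0) * (if b = e \<and> Q then 1 else 0) * (if c = f \<and> R then 1 else 0))
    = (if c = f then if b = e then if a = d then if P \<and> Q \<and> R then X d e f else 0 else 0 else 0 else 0)" for a b c
    by simp
  then show ?thesis using assms by (simp only: sum.delta finite_Vars if_True)
qed

text \<open>\<open>spec (lin x d) c\<close> is the coefficient of \<open>s0 s1 s2\<close> in the action of the matrix that maps the
  letter \<open>d_i\<close> to \<open>s_i c_i\<close>; inclusion-exclusion over \<open>s \<in> {0,1}\<^sup>3\<close> extracts it.\<close>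

lemma gsubmod_spec_lin:
  fixes x :: "'a::field_char_0 npoly"
  assumes N: "gsubmod N" and x: "x \<in> N" "x \<in> Wsp (tcount t0 t1 t2)"
    and d: "typed3 t0 t1 t2 d0 d1 d2" and c: "typed3 t0 t1 t2 c0 c1 c2"
  shows "spec (lin x d0 d1 d2) c0 c1 c2 \<in> N"
proof -
  have sN: "subsp N" using N by (simp add: gsubmod_iff)
  \<comment> \<open>\<open>e d c\<close> is the matrix unit sending the letter \<open>d\<close> to
    \<open>c\<close>. \<open>M\<close> combines three of them with weights, and it is in general
    singular.\<close>
  define e where "e d c = (\<lambda>a b :: var. if a = d \<and> b = c then 1 else (0::'a))" for d c :: var
  define M where "M s0 s1 s2 = (\<lambda>t. mat 3 3 (\<lambda>(i,j). s0 * e d0 c0 (t, Suc j) (t, Suc i)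
     + s1 * e d1 c1 (t, Suc j) (t, Suc i) + s2 * e d2 c2 (t, Suc j) (t, Suc i)))" for s0 s1 s2 :: 'a
  have M: "M s0 s1 s2 t \<in> carrier_mat 3 3" for s0 s1 s2 t by (simp add: M_def)
  have l: "lcoef (M s0 s1 s2) a b = s0 * e d0 c0 a b + s1 * e d1 c1 a b + s2 * e d2 c2 a b"
    if ab: "a \<in> Vars" "b \<in> Vars" for s0 s1 s2 a b
  proof -
    obtain t i s j where a: "a = (t,i)" and i: "i \<in> {1,2,3}" and b: "b = (s,j)" and j: "j \<in> {1,2,3}"
      using ab unfolding Vars_def by blast
    show ?thesis
    proof (cases "s = t")
      case True
      have "i - 1 < 3" "j - 1 < 3" "Suc (i - 1) = i" "Suc (j - 1) = j" using i j by auto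
      then show ?thesis using i j by (simp add: lcoef_def M_def a b True)
    next
      \<comment> \<open>Source and target letters have equal types slot by slot, so no matrix unit
        joins letters of different types.\<close>
      case False
      then have "e d0 c0 a b = 0" "e d1 c1 a b = 0" "e d2 c2 a b = 0"
        using c d by (auto simp: e_def typed3_def a b)
      then show ?thesis using False by (simp add: lcoef_def a b)
    qed
  qed
  note G = gsubmod_gact[OF N x M]
  have GW: "gact g x \<in> Wsp (tcount t0 t1 t2)" for g by (rule gact_Wsp[OF x(2)])
  let ?z = "\<lambda>u. 1 * gact (M 1 1 1) x u + (-1) * gact (M 1 1 0) x u + (-1) * gact (M 1 0 1) x u + (-1) * gact (M 0 1 1) x u"
  let ?y = "\<lambda>u. 1 * ?z u + 1 * gact (M 1 0 0) x u + 1 * gact (M 0 1 0) x u + 1 * gact (M 0 0 1) x u"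
  have "?y \<in> N" by (intro subsp_lincomb4[OF sN] G)
  moreover have "spec (lin x d0 d1 d2) c0 c1 c2 = ?y"
  proof (rule Wsp_eqI)
    show "spec (lin x d0 d1 d2) c0 c1 c2 \<in> Wsp (tcount t0 t1 t2)" by (rule spec_Wsp[OF c])
    show "?y \<in> Wsp (tcount t0 t1 t2)"
      by (intro subsp_lincomb4[OF subsp_Wsp] GW)
    fix u v w assume Vars: "u \<in> Vars" "v \<in> Vars" "w \<in> Vars"
    have dV: "d0 \<in> Vars" "d1 \<in> Vars" "d2 \<in> Vars" using d by (auto simp: typed3_def)
    have word3: "[a,b,c] = [u,v,w] \<longleftrightarrow> u = a \<and> v = b \<and> w = c" for a b c by auto
    let ?t = "\<lambda>d0 c0 d1 c1 d2 c2. \<Sum>a\<in>Vars. \<Sum>b\<in>Vars. \<Sum>c\<in>Vars. x [a,b,c] * (e d0 c0 a u * e d1 c1 b v * e d2 c2 c w)"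
    \<comment> \<open>The six surviving products assign the three renamings to the three positions
      in all possible orders, which are the six terms of \<open>spec\<close>.\<close>
    have "?y [u,v,w] = ?t d0 c0 d1 c1 d2 c2 + ?t d0 c0 d2 c2 d1 c1 + ?t d1 c1 d0 c0 d2 c2
        + ?t d1 c1 d2 c2 d0 c0 + ?t d2 c2 d0 c0 d1 c1 + ?t d2 c2 d1 c1 d0 c0"
      unfolding gact_word3[OF x(2)] sum_distrib_left sum.distrib[symmetric]
      using Vars by (intro sum.cong refl) (simp only: l multilinear_coefficient)
    also have "\<dots> = spec (lin x d0 d1 d2) c0 c1 c2 [u,v,w]"
      unfolding e_def trisum_delta[OF dV(1,2,3)] trisum_delta[OF dV(1,3,2)] trisum_delta[OF dV(2,1,3)]
        trisum_delta[OF dV(2,3,1)] trisum_delta[OF dV(3,1,2)] trisum_delta[OF dV(3,2,1)]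
      by (simp only: spec_expand lin_def pw.simps word3)
    finally show "spec (lin x d0 d1 d2) c0 c1 c2 [u,v,w] = ?y [u,v,w]" ..
  qed
  ultimately show ?thesis by simp
qed

subsection \<open>Submodules and multilinear vectors\<close>

lemma trisum_perm:
  fixes F :: "'a \<Rightarrow> 'a \<Rightarrow> 'a \<Rightarrow> 'b::comm_monoid_add"
  shows "(\<Sum>a\<in>A. \<Sum>b\<in>A. \<Sum>c\<in>A. F a b c) = (\<Sum>a\<in>A. \<Sum>b\<in>A. \<Sum>c\<in>A. F a c b)"
  "(\<Sum>a\<in>A. \<Sum>b\<in>A. \<Sum>c\<in>A. F a b c) = (\<Sum>a\<in>A. \<Sum>b\<in>A. \<Sum>c\<in>A. F b a c)"
  "(\<Sum>a\<in>A. \<Sum>b\<in>A. \<Sum>c\<in>A. F a b c) = (\<Sum>a\<in>A. \<Sum>b\<in>A. \<Sum>c\<in>A. F b c a)"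
  "(\<Sum>a\<in>A. \<Sum>b\<in>A. \<Sum>c\<in>A. F a b c) = (\<Sum>a\<in>A. \<Sum>b\<in>A. \<Sum>c\<in>A. F c a b)"
  "(\<Sum>a\<in>A. \<Sum>b\<in>A. \<Sum>c\<in>A. F a b c) = (\<Sum>a\<in>A. \<Sum>b\<in>A. \<Sum>c\<in>A. F c b a)"
proof -
  have s23: "(\<Sum>a\<in>A. \<Sum>b\<in>A. \<Sum>c\<in>A. F a b c) = (\<Sum>a\<in>A. \<Sum>b\<in>A. \<Sum>c\<in>A. F a c b)" for F :: "'a \<Rightarrow> 'a \<Rightarrow> 'a \<Rightarrow> 'b"
    by (rule sum.cong[OF refl], rule sum.swap)
  have s12: "(\<Sum>a\<in>A. \<Sum>b\<in>A. \<Sum>c\<in>A. F a b c) = (\<Sum>a\<in>A. \<Sum>b\<in>A. \<Sum>c\<in>A. F b a c)" for F :: "'a \<Rightarrow> 'a \<Rightarrow> 'a \<Rightarrow> 'b"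
    by (rule sum.swap)
  show "(\<Sum>a\<in>A. \<Sum>b\<in>A. \<Sum>c\<in>A. F a b c) = (\<Sum>a\<in>A. \<Sum>b\<in>A. \<Sum>c\<in>A. F a c b)" by (rule s23)
  show "(\<Sum>a\<in>A. \<Sum>b\<in>A. \<Sum>c\<in>A. F a b c) = (\<Sum>a\<in>A. \<Sum>b\<in>A. \<Sum>c\<in>A. F b a c)" by (rule s12)
  show "(\<Sum>a\<in>A. \<Sum>b\<in>A. \<Sum>c\<in>A. F a b c) = (\<Sum>a\<in>A. \<Sum>b\<in>A. \<Sum>c\<in>A. F b c a)"
    by (rule trans[OF s23[of F] s12])
  show "(\<Sum>a\<in>A. \<Sum>b\<in>A. \<Sum>c\<in>A. F a b c) = (\<Sum>a\<in>A. \<Sum>b\<in>A. \<Sum>c\<in>A. F c a b)"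
    by (rule trans[OF s12[of F] s23])
  show "(\<Sum>a\<in>A. \<Sum>b\<in>A. \<Sum>c\<in>A. F a b c) = (\<Sum>a\<in>A. \<Sum>b\<in>A. \<Sum>c\<in>A. F c b a)"
    by (rule trans[OF s23[of F] trans[OF s12 s23]])
qed

text \<open>Permuting the positions of a word only permutes the order of summation; the product of
  the three \<open>lcoef\<close> is the same for every \<sigma>.\<close>

lemma lin_gact:
  assumes x: "x \<in> Wsp (tcount t0 t1 t2)"
  shows "lin (gact g x) u v w = (\<lambda>\<sigma>. \<Sum>a\<in>Vars. \<Sum>b\<in>Vars. \<Sum>c\<in>Vars. (lcoef g a u * lcoef g b v * lcoef g c w) * lin x a b c \<sigma>)"
proof
  fix \<sigma>
  show "lin (gact g x) u v w \<sigma> = (\<Sum>a\<in>Vars. \<Sum>b\<in>Vars. \<Sum>c\<in>Vars. (lcoef g a u * lcoef g b v * lcoef g c w) * lin x a b c \<sigma>)"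
  proof (cases \<sigma>)
    case P123
    show ?thesis unfolding P123 lin_def pw.simps gact_word3[OF x]
      by (intro sum.cong refl) (simp add: mult_ac)
  next
    case P132
    show ?thesis unfolding P132 lin_def pw.simps gact_word3[OF x]
      by (rule trans[OF trisum_perm(1)]) (intro sum.cong refl, simp add: mult_ac)
  next
    case P213
    show ?thesis unfolding P213 lin_def pw.simps gact_word3[OF x]
      by (rule trans[OF trisum_perm(2)]) (intro sum.cong refl, simp add: mult_ac)
  next
    case P231
    show ?thesis unfolding P231 lin_def pw.simps gact_word3[OF x]
      by (rule trans[OF trisum_perm(3)]) (intro sum.cong refl, simp add: mult_ac)
  next
    case P312
    show ?thesis unfolding P312 lin_def pw.simps gact_word3[OF x]
      by (rule trans[OF trisum_perm(4)]) (intro sum.cong refl, simp add: mult_ac)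
  next
    case P321
    show ?thesis unfolding P321 lin_def pw.simps gact_word3[OF x]
      by (rule trans[OF trisum_perm(5)]) (intro sum.cong refl, simp add: mult_ac)
  qed
qed

lemma lcoef_eq_0: "fst a \<noteq> fst b \<Longrightarrow> lcoef g a b = 0"
  by (auto simp: lcoef_def)

text \<open>The largest set of polynomials of this content whose linearizations all stay in
  \<open>Q\<close>; it serves as an upper bound for generated modules.\<close>

definition Phi :: "vt \<Rightarrow> vt \<Rightarrow> vt \<Rightarrow> (s3 \<Rightarrow> 'a::field) set \<Rightarrow> 'a npoly set" where
  "Phi t0 t1 t2 Q = {x \<in> Wsp (tcount t0 t1 t2). \<forall>a b c. typed3 t0 t1 t2 a b c \<longrightarrow> lin x a b c \<in> Q}"

lemma gsubmod_Phi:
  fixes Q :: "(s3 \<Rightarrow> 'a::field) set"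
  assumes Q: "subsp Q"
  shows "gsubmod (Phi t0 t1 t2 Q)"
proof -
  have "subsp (Phi t0 t1 t2 Q)"
    using Q subsp_Wsp[where 'a = 'a, of "tcount t0 t1 t2"] unfolding subsp_def Phi_def lin_def by simp
  moreover have "gact g x \<in> Phi t0 t1 t2 Q" if x: "x \<in> Phi t0 t1 t2 Q" for g x
  proof -
    have xW: "x \<in> Wsp (tcount t0 t1 t2)" using x by (simp add: Phi_def)
    have "lin (gact g x) u v w \<in> Q" if t: "typed3 t0 t1 t2 u v w" for u v w
    proof -
      have "(\<lambda>\<sigma>. (lcoef g a u * lcoef g b v * lcoef g c w) * lin x a b c \<sigma>) \<in> Q"
        if Vars: "a \<in> Vars" "b \<in> Vars" "c \<in> Vars" for a b c
      proof (cases "typed3 t0 t1 t2 a b c")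
        case True
        then show ?thesis using x unfolding Phi_def by (intro subsp_scale[OF Q]) blast
      next
        \<comment> \<open>Linearizations at wrongly typed letters are not controlled by
          \<open>Phi\<close>, but their scalar vanishes because \<open>lcoef\<close> preserves
          types.\<close>
        case False
        then have "fst a \<noteq> fst u \<or> fst b \<noteq> fst v \<or> fst c \<noteq> fst w"
          using t Vars by (auto simp: typed3_def)
        then have "lcoef g a u * lcoef g b v * lcoef g c w = 0"
          using lcoef_eq_0 by (metis mult_zero_left mult_zero_right)
        then show ?thesis using subsp_zero[OF Q] by (simp only: mult_zero_left)
      qed
      then show ?thesis unfolding lin_gact[OF xW] by (intro subsp_sum[OF Q])
    qed
    then show ?thesis using gact_Wsp[OF xW] by (simp add: Phi_def)
  qed
  ultimately show ?thesis by (simp add: gsubmod_iff)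
qed

text \<open>Both sides are the component of \<open>x\<close> on the rearrangements of one multiset
  of letters, multiplied by the order of the stabilizer.\<close>

lemma spec_lin_reorder:
  assumes "pw \<sigma> a b c = [p,q,r]"
  shows "spec (lin x a b c) a b c = spec (lin x p q r) p q r"
  using assms by (cases \<sigma>) (auto simp only: fun_eq_iff spec_expand lin_def pw.simps list.inject add_ac)

text \<open>For each of the six permutations exactly one triple of letters produces the given word.
  Repeated letters need no separate treatment: the stabilizer factor compensates for the smaller
  number of orderings.\<close>

lemma sum_spec_lin:
  fixes x :: "'a::field npoly"
  assumes "u \<in> Vars" "v \<in> Vars" "w \<in> Vars"
  shows "(\<Sum>a\<in>Vars. \<Sum>b\<in>Vars. \<Sum>c\<in>Vars. spec (lin x a b c) a b c [u,v,w]) = 6 * x [u,v,w]"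
proof -
  define F where "F a b c = (if [a,b,c] = [u,v,w] then x [a,b,c] else 0)" for a b c
  have "F a b c = (if c = w then if b = v then if a = u then x [u,v,w] else 0 else 0 else 0)" for a b c
    by (simp add: F_def)
  then have d: "(\<Sum>a\<in>Vars. \<Sum>b\<in>Vars. \<Sum>c\<in>Vars. F a b c) = x [u,v,w]"
    using assms by (simp only: sum.delta finite_Vars if_True)
  have "(\<Sum>a\<in>Vars. \<Sum>b\<in>Vars. \<Sum>c\<in>Vars. spec (lin x a b c) a b c [u,v,w])
    = (\<Sum>a\<in>Vars. \<Sum>b\<in>Vars. \<Sum>c\<in>Vars. F a b c) + (\<Sum>a\<in>Vars. \<Sum>b\<in>Vars. \<Sum>c\<in>Vars. F a c b)
     + (\<Sum>a\<in>Vars. \<Sum>b\<in>Vars. \<Sum>c\<in>Vars. F b a c) + (\<Sum>a\<in>Vars. \<Sum>b\<in>Vars. \<Sum>c\<in>Vars. F b c a)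
     + (\<Sum>a\<in>Vars. \<Sum>b\<in>Vars. \<Sum>c\<in>Vars. F c a b) + (\<Sum>a\<in>Vars. \<Sum>b\<in>Vars. \<Sum>c\<in>Vars. F c b a)"
    by (simp only: spec_expand lin_def pw.simps sum.distrib F_def)
  also have "\<dots> = 6 * x [u,v,w]"
    unfolding trisum_perm[of F, symmetric] d by simp
  finally show ?thesis .
qed

text \<open>Up to the factor 6, \<open>x\<close> is the sum of its components by letters, so it
  suffices to place these in the subspace.\<close>

lemma subsp_of_spec_lin:
  fixes x :: "'a::field_char_0 npoly"
  assumes T: "subsp T" and x: "x \<in> Wsp (tcount t0 t1 t2)"
    and c: "\<And>a b c. typed3 t0 t1 t2 a b c \<Longrightarrow> spec (lin x a b c) a b c \<in> T"
  shows "x \<in> T"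
proof -
  have mem: "spec (lin x a b c) a b c \<in> T \<inter> Wsp (tcount t0 t1 t2)" for a b c
  proof (cases "lin x a b c = (\<lambda>_. 0)")
    case True
    then have "spec (lin x a b c) a b c = (\<lambda>_. 0)" by (simp add: spec_def)
    then show ?thesis using subsp_zero[OF T] subsp_zero[OF subsp_Wsp] by simp
  next
    case False
    then obtain \<sigma> where "x (pw \<sigma> a b c) \<noteq> 0" by (auto simp: lin_def fun_eq_iff)
    \<comment> \<open>A nonzero component has letters of the right types, possibly in another order;
      it is rewritten with the letters in the order of the slots.\<close>
    from Wsp_support[OF x this] obtain \<rho> i j k where *: "pw \<sigma> a b c = pw \<rho> (t0,i) (t1,j) (t2,k)"
      "i \<in> {1,2,3}" "j \<in> {1,2,3}" "k \<in> {1,2,3}" .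
    obtain p q r where pqr: "pw \<sigma> a b c = [p,q,r]" by (cases \<sigma>) auto
    have ty: "typed3 t0 t1 t2 (t0,i) (t1,j) (t2,k)" using * by (simp add: typed3_def Vars_def)
    have "spec (lin x a b c) a b c = spec (lin x (t0,i) (t1,j) (t2,k)) (t0,i) (t1,j) (t2,k)"
      by (simp only: spec_lin_reorder[OF pqr] spec_lin_reorder[OF trans[OF *(1)[symmetric] pqr]])
    then show ?thesis using c[OF ty] spec_Wsp[OF ty] by simp
  qed
  let ?y = "\<lambda>u. 1/6 * (\<Sum>a\<in>Vars. \<Sum>b\<in>Vars. \<Sum>c\<in>Vars. spec (lin x a b c) a b c u)"
  have "?y \<in> T" using mem by (intro subsp_scale[OF T] subsp_sum[OF T]) blast
  moreover have "x = ?y"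
  proof (rule Wsp_eqI[OF x])
    show "?y \<in> Wsp (tcount t0 t1 t2)" using mem by (intro subsp_scale[OF subsp_Wsp] subsp_sum[OF subsp_Wsp]) blast
  qed (simp add: sum_spec_lin)
  ultimately show ?thesis by simp
qed

lemma Wsp_eq_0I:
  assumes x: "x \<in> Wsp (tcount t0 t1 t2)" and "\<And>a b c. typed3 t0 t1 t2 a b c \<Longrightarrow> lin x a b c = (\<lambda>_. 0)"
  shows "x = pzero"
proof -
  have "x u = 0" for u
  proof (rule ccontr)
    assume "x u \<noteq> 0"
    from Wsp_support[OF x this] obtain \<sigma> i j k where u: "u = pw \<sigma> (t0,i) (t1,j) (t2,k)"
      "i \<in> {1,2,3}" "j \<in> {1,2,3}" "k \<in> {1,2,3}" .
    then have "lin x (t0,i) (t1,j) (t2,k) = (\<lambda>_. 0)"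
      by (intro assms(2)) (simp add: typed3_def Vars_def)
    then show False using \<open>x u \<noteq> 0\<close> u(1) by (simp add: lin_def fun_eq_iff)
  qed
  then show ?thesis by (simp add: pzero_def fun_eq_iff)
qed

section \<open>Spans and the module generated by a polynomial\<close>

lemma pspanE:
  assumes "x \<in> pspan S"
  obtains m :: nat and c p where "x = (\<lambda>w. \<Sum>i<m. c i * p i w)" "\<forall>i<m. p i \<in> S"
  using assms unfolding pspan_def mem_Collect_eq by (elim exE conjE)

lemma subsp_pspan: "subsp (pspan S)"
proof -
  have "(\<lambda>_. 0) \<in> pspan S"
    unfolding pspan_def by (intro CollectI exI[of _ "0::nat"]) simp
  moreover have "(\<lambda>u. x u + y u) \<in> pspan S" if xy: "x \<in> pspan S" "y \<in> pspan S" for x y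
  proof -
    obtain m :: nat and c p where x: "x = (\<lambda>w. \<Sum>i<m. c i * p i w)" "\<forall>i<m. p i \<in> S"
      using xy(1) by (rule pspanE)
    obtain n :: nat and d q where y: "y = (\<lambda>w. \<Sum>i<n. d i * q i w)" "\<forall>i<n. q i \<in> S"
      using xy(2) by (rule pspanE)
    define c' where "c' i = (if i < m then c i else d (i - m))" for i
    define p' where "p' i = (if i < m then p i else q (i - m))" for i
    have "(\<Sum>i<m + n. c' i * p' i w) = x w + y w" for w
    proof -
      have "(\<Sum>i<m + n. c' i * p' i w) = (\<Sum>i<m. c' i * p' i w) + (\<Sum>i<n. c' (m + i) * p' (m + i) w)"
        by (induction n) (simp_all add: add.assoc)
      then show ?thesis by (simp add: x y c'_def p'_def)
    qed
    moreover have "\<forall>i<m + n. p' i \<in> S" using x(2) y(2) by (simp add: p'_def)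
    ultimately show ?thesis unfolding pspan_def
      by (intro CollectI exI[of _ "m + n"] exI[of _ c'] exI[of _ p']) auto
  qed
  moreover have "(\<lambda>u. a * x u) \<in> pspan S" if xS: "x \<in> pspan S" for a x
  proof -
    obtain m :: nat and c p where x: "x = (\<lambda>w. \<Sum>i<m. c i * p i w)" "\<forall>i<m. p i \<in> S"
      using xS by (rule pspanE)
    then show ?thesis unfolding pspan_def
      by (intro CollectI exI[of _ "m"] exI[of _ "\<lambda>i. a * c i"] exI[of _ p]) (auto simp: sum_distrib_left mult.assoc)
  qed
  ultimately show ?thesis unfolding subsp_def by blast
qed

lemma pspan_superset: "S \<subseteq> pspan S"
proof
  fix x assume "x \<in> S"
  then show "x \<in> pspan S" unfolding pspan_def
    by (intro CollectI exI[of _ "Suc 0"] exI[of _ "\<lambda>_. 1"] exI[of _ "\<lambda>_. x"]) auto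
qed

lemma pspan_minimal:
  assumes "subsp T" "S \<subseteq> T" shows "pspan S \<subseteq> T"
  using assms unfolding pspan_def by (auto intro!: subsp_sum subsp_scale)

text \<open>Since \<open>gact\<close> sums over the support of its argument, its linearity is not
  immediate; inside \<open>Wsp\<close> the sum runs over a fixed index set.\<close>

lemma gact_pspan:
  assumes "S \<subseteq> Wsp (tcount t0 t1 t2)" "x \<in> pspan S" "\<And>y. y \<in> S \<Longrightarrow> gact g y \<in> pspan S"
  shows "gact g x \<in> pspan S"
proof -
  obtain m :: nat and c p where x: "x = (\<lambda>w. \<Sum>i<m. c i * p i w)" "\<forall>i<m. p i \<in> S"
    using assms(2) by (rule pspanE)
  have xW: "x \<in> Wsp (tcount t0 t1 t2)" using pspan_minimal[OF subsp_Wsp assms(1)] assms(2) by blast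
  have pW: "p i \<in> Wsp (tcount t0 t1 t2)" if "i < m" for i using assms(1) x(2) that by blast
  have "gact g x = (\<lambda>u. \<Sum>i<m. c i * gact g (p i) u)"
  proof (rule Wsp_eqI)
    show "gact g x \<in> Wsp (tcount t0 t1 t2)" by (rule gact_Wsp[OF xW])
    show "(\<lambda>u. \<Sum>i<m. c i * gact g (p i) u) \<in> Wsp (tcount t0 t1 t2)"
      using pW by (intro subsp_sum[OF subsp_Wsp] subsp_scale[OF subsp_Wsp] gact_Wsp) simp
    fix u v w
    have "gact g x [u,v,w] = (\<Sum>y\<in>Vars \<times> Vars \<times> Vars. \<Sum>i<m. c i * (p i [fst y, fst (snd y), snd (snd y)]
        * (lcoef g (fst y) u * lcoef g (fst (snd y)) v * lcoef g (snd (snd y)) w)))"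
      unfolding gact_word3[OF xW] trisum_product_set by (simp add: x(1) sum_distrib_right mult.assoc)
    also have "\<dots> = (\<Sum>i<m. c i * gact g (p i) [u,v,w])"
      by (subst sum.swap) (simp add: gact_word3[OF pW] trisum_product_set sum_distrib_left)
    finally show "gact g x [u,v,w] = (\<Sum>i<m. c i * gact g (p i) [u,v,w])" .
  qed
  then show ?thesis using x(2) assms(3) by (auto intro!: subsp_sum subsp_scale subsp_pspan)
qed

lemma GL4_mult:
  assumes "g \<in> GL4" "h \<in> GL4" shows "(\<lambda>t. g t * h t) \<in> GL4"
proof -
  have c: "g t \<in> carrier_mat 3 3" "h t \<in> carrier_mat 3 3" and i: "invertible_mat (g t)" "invertible_mat (h t)" for t
    using assms by (auto simp: GL4_def)
  have "invertible_mat (g t * h t)" for t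
    using i[of t]
    by (simp add: invertible_mat_iff_det[OF c(1)] invertible_mat_iff_det[OF c(2)]
        invertible_mat_iff_det[OF mult_carrier_mat[OF c]] det_mult[OF c])
  then show ?thesis using mult_carrier_mat[OF c] by (simp add: GL4_def)
qed

lemma gact_in_gmod: "g \<in> GL4 \<Longrightarrow> gact g f \<in> gmod f"
  unfolding gmod_def by (rule subsetD[OF pspan_superset], rule CollectI, rule exI[of _ g]) simp

lemma gsubmod_gmod:
  assumes "f \<in> Wsp (tcount t0 t1 t2)"
  shows "gsubmod (gmod f)"
proof -
  have "gact h x \<in> gmod f" if h: "h \<in> GL4" and x: "x \<in> gmod f" for h x
    unfolding gmod_def
  proof (rule gact_pspan[of _ t0 t1 t2])
    show "{gact g f |g. g \<in> GL4} \<subseteq> Wsp (tcount t0 t1 t2)" using gact_Wsp[OF assms] by auto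
    show "x \<in> pspan {gact g f |g. g \<in> GL4}" using x by (simp add: gmod_def)
    fix y assume "y \<in> {gact g f |g. g \<in> GL4}"
    then obtain g where y: "y = gact g f" and g: "g \<in> GL4" by auto
    have "gact h y = gact (\<lambda>t. h t * g t) f"
      unfolding y using g h by (intro gact_gact[OF assms]) (simp_all add: GL4_def)
    then show "gact h y \<in> pspan {gact g f |g. g \<in> GL4}"
      using gact_in_gmod[OF GL4_mult[OF h g]] by (simp add: gmod_def)
  qed
  moreover have "subsp (gmod f)" unfolding gmod_def by (rule subsp_pspan)
  ultimately show ?thesis by (simp add: gsubmod_iff)
qed

lemma gact_one:
  assumes "f \<in> Wsp (tcount t0 t1 t2)"
  shows "gact (\<lambda>_. 1\<^sub>m 3) f = f"
proof (rule Wsp_eqI[OF gact_Wsp[OF assms] assms])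
  fix u v w assume Vars: "u \<in> Vars" "v \<in> Vars" "w \<in> Vars"
  have l: "lcoef (\<lambda>_. 1\<^sub>m 3) a b = (if a = b \<and> True then 1 else 0)" if "a \<in> Vars" "b \<in> Vars" for a b
    using that by (cases a; cases b) (auto simp: lcoef_def Vars_def)
  show "gact (\<lambda>_. 1\<^sub>m 3) f [u,v,w] = f [u,v,w]"
  proof -
    have "gact (\<lambda>_. 1\<^sub>m 3) f [u,v,w] = (\<Sum>a\<in>Vars. \<Sum>b\<in>Vars. \<Sum>c\<in>Vars. f [a,b,c] *
      ((if a = u \<and> True then 1 else 0) * (if b = v \<and> True then 1 else 0) * (if c = w \<and> True then 1 else 0)))"
      unfolding gact_word3[OF assms] using Vars by (intro sum.cong refl) (simp only: l)
    then show ?thesis unfolding trisum_delta[OF Vars] by simp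
  qed
qed

lemma gmod_self:
  assumes "f \<in> Wsp (tcount t0 t1 t2)"
  shows "f \<in> gmod f"
proof -
  have "invertible_mat (1\<^sub>m 3 :: 'a mat)"
    by (simp add: invertible_mat_iff_det[OF one_carrier_mat])
  then have "(\<lambda>_. 1\<^sub>m 3 :: 'a mat) \<in> GL4" by (simp add: GL4_def)
  then show ?thesis using gact_in_gmod[of _ f] gact_one[OF assms] by metis
qed

lemma gmod_minimal:
  assumes "gsubmod N" "f \<in> N" shows "gmod f \<subseteq> N"
  unfolding gmod_def using assms by (intro pspan_minimal) (auto simp: gsubmod_iff)

subsection \<open>Star identities\<close>

definition m3 :: "'a \<Rightarrow> 'a \<Rightarrow> 'a \<Rightarrow> 'a \<Rightarrow> 'a \<Rightarrow> 'a \<Rightarrow> 'a \<Rightarrow> 'a \<Rightarrow> 'a \<Rightarrow> 'a::field mat" where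
  "m3 a b c d e f g h i = mat 3 3 (\<lambda>(r,s). [[a,b,c],[d,e,f],[g,h,i]] ! r ! s)"

lemma m3_carrier: "m3 a b c d e f g h i \<in> carrier_mat 3 3"
  by (simp add: m3_def)

lemma m3_index:
  "m3 a b c d e f g h i $$ (0,0) = a" "m3 a b c d e f g h i $$ (0,1) = b" "m3 a b c d e f g h i $$ (0,2) = c"
  "m3 a b c d e f g h i $$ (1,0) = d" "m3 a b c d e f g h i $$ (1,1) = e" "m3 a b c d e f g h i $$ (1,2) = f"
  "m3 a b c d e f g h i $$ (2,0) = g" "m3 a b c d e f g h i $$ (2,1) = h" "m3 a b c d e f g h i $$ (2,2) = i"
  by (simp_all add: m3_def)

lemma all_less_3: "(\<forall>i<3. P i) \<longleftrightarrow> P 0 \<and> P 1 \<and> P (2::nat)"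
  by (auto simp: less_Suc_eq numeral_3_eq_3 numeral_2_eq_2)

lemma mat3_eqI:
  assumes "A \<in> carrier_mat 3 3" "B \<in> carrier_mat 3 3"
    and "\<forall>i<3. \<forall>j<3. A $$ (i,j) = B $$ (i,j)"
  shows "A = B"
  using assms by (intro eq_matI) auto

lemma m3_mult:
  "m3 a b c d e f g h i * m3 a' b' c' d' e' f' g' h' i' =
   m3 (a*a' + b*d' + c*g') (a*b' + b*e' + c*h') (a*c' + b*f' + c*i')
      (d*a' + e*d' + f*g') (d*b' + e*e' + f*h') (d*c' + e*f' + f*i')
      (g*a' + h*d' + i*g') (g*b' + h*e' + i*h') (g*c' + h*f' + i*i')"
proof (rule mat3_eqI[OF mult_carrier_mat[OF m3_carrier m3_carrier] m3_carrier])
  have s: "(\<Sum>k<3. F k) = F 0 + F 1 + F (2::nat)" for F :: "nat \<Rightarrow> 'a"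
    by (simp add: numeral_3_eq_3 numeral_2_eq_2)
  have "(0::nat) < 3" "(1::nat) < 3" "(2::nat) < 3" by simp_all
  note ix = index_mult_mat3[OF m3_carrier m3_carrier]
  show "\<forall>r<3. \<forall>s<3. (m3 a b c d e f g h i * m3 a' b' c' d' e' f' g' h' i') $$ (r,s) =
   m3 (a*a' + b*d' + c*g') (a*b' + b*e' + c*h') (a*c' + b*f' + c*i')
      (d*a' + e*d' + f*g') (d*b' + e*e' + f*h') (d*c' + e*f' + f*i')
      (g*a' + h*d' + i*g') (g*b' + h*e' + i*h') (g*c' + h*f' + i*i') $$ (r,s)"
    unfolding all_less_3
    by (simp only: ix \<open>(0::nat) < 3\<close> \<open>(1::nat) < 3\<close> \<open>(2::nat) < 3\<close> s m3_index simp_thms)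
qed

text \<open>A uniform parametrization of the four homogeneous parts: the even skew part has
  dimension three, the other parts have dimension two.\<close>

fun gen_mat :: "vt \<Rightarrow> 'a \<Rightarrow> 'a \<Rightarrow> 'a \<Rightarrow> 'a::field mat" where
  "gen_mat YP a b c = m3 a 0 0 0 b 0 0 0 b"
| "gen_mat YM a b c = m3 0 0 0 0 a b 0 c (- a)"
| "gen_mat ZP a b c = m3 0 a b b 0 0 (- a) 0 0"
| "gen_mat ZM a b c = m3 0 a b (- b) 0 0 a 0 0"

lemma gen_mat_carrier: "gen_mat t a b c \<in> carrier_mat 3 3"
  by (cases t) (simp_all add: m3_carrier)

lemma sinv_m3: "sinv (m3 a b c d e f g h i) = m3 a (- g) d c i (- f) (- b) (- h) e"
proof (rule mat3_eqI[OF _ m3_carrier])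
  show "\<forall>r<3. \<forall>s<3. sinv (m3 a b c d e f g h i) $$ (r,s) = m3 a (- g) d c i (- f) (- b) (- h) e $$ (r,s)"
    unfolding all_less_3 m3_index by (simp add: sinv_def m3_def)
qed (simp add: sinv_def)

lemma uminus_m3: "- m3 a b c d e f g h i = m3 (-a) (-b) (-c) (-d) (-e) (-f) (-g) (-h) (-i)"
proof (rule mat3_eqI[OF _ m3_carrier])
  show "\<forall>r<3. \<forall>s<3. (- m3 a b c d e f g h i) $$ (r,s) = m3 (-a) (-b) (-c) (-d) (-e) (-f) (-g) (-h) (-i) $$ (r,s)"
    unfolding all_less_3 m3_index by (simp add: m3_def)
qed (simp add: m3_def)

lemma m3_inject:
  "m3 a b c d e f g h i = m3 a' b' c' d' e' f' g' h' i' \<longleftrightarrow>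
   a = a' \<and> b = b' \<and> c = c' \<and> d = d' \<and> e = e' \<and> f = f' \<and> g = g' \<and> h = h' \<and> i = i'"
  by (metis m3_index)

lemma m3_exhaust:
  assumes "A \<in> carrier_mat 3 3"
  obtains a b c d e f g h i where "A = m3 a b c d e f g h i"
proof -
  have "A = m3 (A $$ (0,0)) (A $$ (0,1)) (A $$ (0,2)) (A $$ (1,0)) (A $$ (1,1)) (A $$ (1,2))
     (A $$ (2,0)) (A $$ (2,1)) (A $$ (2,2))"
    by (rule mat3_eqI[OF assms m3_carrier]) (simp only: all_less_3 m3_index simp_thms)
  then show ?thesis using that by blast
qed

text \<open>The symmetry conditions force some entries to equal their own negatives; these vanish
  because 2 is invertible.\<close>

lemma vpart_iff:
  fixes A :: "'a::field_char_0 mat"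
  shows "A \<in> vpart t \<longleftrightarrow> (\<exists>a b c. A = gen_mat t a b c)"
proof
  have "2 * x = 0" if "- x = x" for x :: 'a using that by (metis add.right_inverse mult_2)
  then have neg: "- x = x \<longleftrightarrow> x = 0" "x = - x \<longleftrightarrow> x = 0" for x :: 'a by (metis minus_zero mult_eq_0_iff zero_neq_numeral)+
  note ix = mem_Collect_eq even_mat_def odd_mat_def m3_index
  assume A: "A \<in> vpart t"
  then have "A \<in> carrier_mat 3 3" by (cases t) (auto simp: even_mat_def odd_mat_def)
  then obtain a b c d e f g h i where m: "A = m3 a b c d e f g h i" by (rule m3_exhaust)
  show "\<exists>a b c. A = gen_mat t a b c"
  proof (cases t)
    case YP
    have "b = 0 \<and> c = 0 \<and> d = 0 \<and> g = 0 \<and> i = e \<and> - f = f \<and> - h = h"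
      using A unfolding m YP vpart.simps ix sinv_m3 uminus_m3 m3_inject by (elim conjE, intro conjI)
    then show ?thesis unfolding neg by (intro exI[of _ a] exI[of _ e]) (simp add: YP m m3_inject)
  next
    case YM
    have "b = 0 \<and> c = 0 \<and> d = 0 \<and> g = 0 \<and> i = - e \<and> a = - a"
      using A unfolding m YM vpart.simps ix sinv_m3 uminus_m3 m3_inject by (elim conjE, intro conjI)
    then show ?thesis unfolding neg by (intro exI[of _ e] exI[of _ f] exI[of _ h]) (simp add: YM m m3_inject)
  next
    case ZP
    have "a = 0 \<and> e = 0 \<and> f = 0 \<and> h = 0 \<and> i = 0 \<and> d = c \<and> - b = g"
      using A unfolding m ZP vpart.simps ix sinv_m3 uminus_m3 m3_inject by (elim conjE, intro conjI)
    then show ?thesis by (intro exI[of _ b] exI[of _ c]) (simp add: ZP m m3_inject)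
  next
    case ZM
    have "a = 0 \<and> e = 0 \<and> f = 0 \<and> h = 0 \<and> i = 0 \<and> d = - c \<and> - g = - b"
      using A unfolding m ZM vpart.simps ix sinv_m3 uminus_m3 m3_inject by (elim conjE, intro conjI)
    then show ?thesis by (intro exI[of _ b] exI[of _ c]) (simp add: ZM m m3_inject)
  qed
next
  assume "\<exists>a b c. A = gen_mat t a b c"
  then show "A \<in> vpart t"
    \<comment> \<open>\<open>auto\<close> rewrites the index 1 to \<open>Suc 0\<close>, hence the
      second copy of the entry rules that mention 1.\<close>
    by (cases t) (auto simp: even_mat_def odd_mat_def m3_index sinv_m3 uminus_m3 m3_inject m3_carrier
          m3_index(2,4,5,6,8)[unfolded One_nat_def])
qed

lemma gen_mat_vpart: "gen_mat t a b c \<in> vpart t" for a :: "'a::field_char_0"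
  unfolding vpart_iff by blast

lemma vpart_carrier: "A \<in> vpart t \<Longrightarrow> A \<in> carrier_mat 3 3" for A :: "'a::field_char_0 mat"
  unfolding vpart_iff using gen_mat_carrier by blast

lemma word_eval3:
  fixes \<phi> :: "var \<Rightarrow> 'a::field mat"
  assumes "\<phi> a \<in> carrier_mat 3 3" "\<phi> b \<in> carrier_mat 3 3" "\<phi> c \<in> carrier_mat 3 3"
  shows "word_eval \<phi> [a,b,c] = \<phi> a * (\<phi> b * \<phi> c)"
  using assms by (simp add: word_eval_def)

lemma index_mult_mat3_3:
  fixes A B C :: "'a::field mat"
  assumes "A \<in> carrier_mat 3 3" "B \<in> carrier_mat 3 3" "C \<in> carrier_mat 3 3" "i < 3" "j < 3"
  shows "(A * (B * C)) $$ (i,j) = (\<Sum>k<3. \<Sum>l<3. A $$ (i,k) * B $$ (k,l) * C $$ (l,j))"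
  using assms
  by (subst index_mult_mat3) (auto simp: index_mult_mat3 sum_distrib_left mult.assoc
      simp del: index_mult_mat intro!: sum.cong)

text \<open>Expands matrix products into entries over fixed index sets: the condition becomes
  visibly linear in \<open>x\<close> and takes the shape to which \<open>trisum_compose\<close>
  applies.\<close>

lemma is_star_id_Wsp:
  fixes x :: "'a::field_char_0 npoly"
  assumes x: "x \<in> Wsp (tcount t0 t1 t2)"
  shows "is_star_id x \<longleftrightarrow> (\<forall>\<phi>. (\<forall>v. \<phi> v \<in> vpart (fst v)) \<longrightarrow> (\<forall>i<3. \<forall>j<3.
    (\<Sum>k<3. \<Sum>l<3. \<Sum>a\<in>Vars. \<Sum>b\<in>Vars. \<Sum>c\<in>Vars. x [a,b,c] * (\<phi> a $$ (i,k) * \<phi> b $$ (k,l) * \<phi> c $$ (l,j))) = 0))"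
proof -
  have "(\<Sum>w\<in>{w. x w \<noteq> 0}. x w * word_eval \<phi> w $$ (i,j)) =
     (\<Sum>k<3. \<Sum>l<3. \<Sum>a\<in>Vars. \<Sum>b\<in>Vars. \<Sum>c\<in>Vars. x [a,b,c] * (\<phi> a $$ (i,k) * \<phi> b $$ (k,l) * \<phi> c $$ (l,j)))"
    if \<phi>: "\<forall>v. \<phi> v \<in> vpart (fst v)" and ij: "i < 3" "j < 3" for \<phi> :: "var \<Rightarrow> 'a mat" and i j
  proof -
    have c: "\<phi> v \<in> carrier_mat 3 3" for v using \<phi> vpart_carrier by blast
    have "(\<Sum>w\<in>{w. x w \<noteq> 0}. x w * word_eval \<phi> w $$ (i,j)) =
       (\<Sum>y\<in>Vars \<times> Vars \<times> Vars. \<Sum>z\<in>{..<3} \<times> {..<3}. x [fst y, fst (snd y), snd (snd y)] *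
         (\<phi> (fst y) $$ (i,fst z) * \<phi> (fst (snd y)) $$ (fst z,snd z) * \<phi> (snd (snd y)) $$ (snd z,j)))"
      unfolding sum_support[OF x] trisum_product_set word_eval3[OF c c c] index_mult_mat3_3[OF c c c ij]
      by (simp add: sum.cartesian_product case_prod_beta sum_distrib_left)
    also have "\<dots> = (\<Sum>k<3. \<Sum>l<3. \<Sum>a\<in>Vars. \<Sum>b\<in>Vars. \<Sum>c\<in>Vars. x [a,b,c] * (\<phi> a $$ (i,k) * \<phi> b $$ (k,l) * \<phi> c $$ (l,j)))"
      unfolding trisum_product_set
      by (subst sum.swap) (simp add: sum.cartesian_product[of _ "{..<3}"] case_prod_beta)
    finally show ?thesis .
  qed
  then show ?thesis unfolding is_star_id_def by simp
qed

lemma gsubmod_star_id: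
  "gsubmod {p \<in> Wsp (tcount t0 t1 t2). is_star_id (p :: 'a::field_char_0 npoly)}"
proof -
  have "subsp {p \<in> Wsp (tcount t0 t1 t2). is_star_id (p :: 'a npoly)}"
  proof -
    have e: "{p \<in> Wsp (tcount t0 t1 t2). is_star_id (p :: 'a npoly)} = {x \<in> Wsp (tcount t0 t1 t2).
     (\<forall>\<phi>. (\<forall>v. \<phi> v \<in> vpart (fst v)) \<longrightarrow> (\<forall>i<3. \<forall>j<3.
    (\<Sum>k<3. \<Sum>l<3. \<Sum>a\<in>Vars. \<Sum>b\<in>Vars. \<Sum>c\<in>Vars. x [a,b,c] * (\<phi> a $$ (i,k) * \<phi> b $$ (k,l) * \<phi> c $$ (l,j))) = 0))}"
      using is_star_id_Wsp by blast
    show ?thesis unfolding e using subsp_Wsp[where 'a = 'a, of "tcount t0 t1 t2"] unfolding subsp_def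
      by (auto simp: distrib_right sum.distrib mult.assoc sum_distrib_left[symmetric])
  qed
  moreover have "is_star_id (gact g x)"
    if x: "x \<in> Wsp (tcount t0 t1 t2)" and id: "is_star_id x" for g and x :: "'a npoly"
    unfolding is_star_id_Wsp[OF gact_Wsp[OF x]]
  proof (intro allI impI)
    fix \<phi> :: "var \<Rightarrow> 'a mat" and i j :: nat
    assume \<phi>: "\<forall>v. \<phi> v \<in> vpart (fst v)" and ij: "i < 3" "j < 3"
    \<comment> \<open>Evaluating \<open>gact g x\<close> at \<phi> is evaluating \<open>x\<close> at
      the linearly transformed substitution \<psi>.\<close>
    define \<psi> where "\<psi> v = (if v \<in> Vars then mat 3 3 (\<lambda>(r,s). \<Sum>b\<in>Vars. lcoef g v b * \<phi> b $$ (r,s)) else \<phi> v)" for v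
    obtain \<alpha> \<beta> \<gamma> where abc: "\<And>v. \<phi> v = gen_mat (fst v) (\<alpha> v) (\<beta> v) (\<gamma> v)"
      using \<phi> unfolding vpart_iff by metis
    have "\<psi> v \<in> vpart (fst v)" for v
    proof (cases "v \<in> Vars")
      case True
      let ?s = "\<lambda>\<alpha>. \<Sum>i<3. g (fst v) $$ (i, snd v - 1) * \<alpha> (fst v, Suc i)"
      \<comment> \<open>\<open>gen_mat\<close> is linear in its parameters and \<open>lcoef\<close>
        only mixes variables of one type, so \<psi> stays in the prescribed part.\<close>
      have "\<psi> v = gen_mat (fst v) (?s \<alpha>) (?s \<beta>) (?s \<gamma>)"
      proof (rule mat3_eqI[OF _ gen_mat_carrier])
        show "\<forall>r<3. \<forall>s<3. \<psi> v $$ (r,s) = gen_mat (fst v) (?s \<alpha>) (?s \<beta>) (?s \<gamma>) $$ (r,s)"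
          unfolding all_less_3 using True
          by (cases "fst v") (simp_all add: \<psi>_def sum_lcoef abc m3_index sum_negf m3_index(2,4,5,6,8)[unfolded One_nat_def])
      qed (simp add: \<psi>_def True)
      then show ?thesis using gen_mat_vpart by simp
    next
      case False
      then show ?thesis using \<phi> by (simp only: \<psi>_def if_False)
    qed
    then have z: "(\<Sum>k<3. \<Sum>l<3. \<Sum>a\<in>Vars. \<Sum>b\<in>Vars. \<Sum>c\<in>Vars. x [a,b,c] * (\<psi> a $$ (i,k) * \<psi> b $$ (k,l) * \<psi> c $$ (l,j))) = 0"
      using id ij unfolding is_star_id_Wsp[OF x] by blast
    have "(\<Sum>k<3. \<Sum>l<3. \<Sum>a\<in>Vars. \<Sum>b\<in>Vars. \<Sum>c\<in>Vars. gact g x [a,b,c] * (\<phi> a $$ (i,k) * \<phi> b $$ (k,l) * \<phi> c $$ (l,j)))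
      = (\<Sum>k<3. \<Sum>l<3. \<Sum>a\<in>Vars. \<Sum>b\<in>Vars. \<Sum>c\<in>Vars. x [a,b,c] * (\<psi> a $$ (i,k) * \<psi> b $$ (k,l) * \<psi> c $$ (l,j)))"
      unfolding gact_word3[OF x] trisum_compose using ij
      by (intro sum.cong refl) (simp add: \<psi>_def)
    then show "(\<Sum>k<3. \<Sum>l<3. \<Sum>a\<in>Vars. \<Sum>b\<in>Vars. \<Sum>c\<in>Vars. gact g x [a,b,c] * (\<phi> a $$ (i,k) * \<phi> b $$ (k,l) * \<phi> c $$ (l,j))) = 0"
      using z by simp
  qed
  ultimately show ?thesis unfolding gsubmod_iff using gact_Wsp by blast
qed

subsection \<open>Reduction of a decomposition to coefficient vectors\<close>

definition poly_of :: "('a::field \<times> var list) list \<Rightarrow> 'a npoly" where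
  "poly_of pl = (\<lambda>u. \<Sum>(c,w)\<leftarrow>pl. if w = u then c else 0)"

lemma poly_of_Nil: "poly_of [] = (\<lambda>u. 0)"
  by (simp add: poly_of_def)

lemma poly_of_Cons: "poly_of ((c,w) # pl) = (\<lambda>u. (if w = u then c else 0) + poly_of pl u)"
  by (simp add: poly_of_def)

text \<open>This rule and the ones for sums, differences and products turn each generator into
  \<open>poly_of\<close> of an explicit list.\<close>

lemma pvar_poly_of: "pvar v = poly_of [(1,[v])]"
  by (auto simp: pvar_def poly_of_def)

lemma padd_poly_of: "poly_of p \<^bold>+ poly_of q = poly_of (p @ q)"
  by (simp add: padd_def poly_of_def)

lemma poly_of_neg: "poly_of (map (\<lambda>(c,w). (- c, w)) q) u = - poly_of q u"
  by (induction q) (auto simp: poly_of_def)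

lemma psub_poly_of: "poly_of p \<^bold>- poly_of q = poly_of (p @ map (\<lambda>(c,w). (- c, w)) q)"
  unfolding padd_poly_of[symmetric] by (simp add: psub_def padd_def poly_of_neg fun_eq_iff)

text \<open>Of all splittings of \<open>w\<close> only the one after \<open>length u\<close> letters
  can contribute.\<close>

lemma pmul_monomials:
  "(\<Sum>k\<le>length w. (if u = take k w then c else 0) * (if v = drop k w then d else 0)) =
   (if u @ v = w then c * d else (0::'a::field))"
proof (cases "u @ v = w")
  case True
  have "(if u = take k w then c else 0) * (if v = drop k w then d else 0) = (if k = length u then c * d else 0)"
    if "k \<le> length w" for k
  proof -
    have "u = take k w \<longleftrightarrow> k = length u" using that True by (metis append_eq_conv_conj length_take min.absorb2)
    moreover have "v = drop k w" if "k = length u" using that True by auto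
    ultimately show ?thesis by auto
  qed
  then have "(\<Sum>k\<le>length w. (if u = take k w then c else 0) * (if v = drop k w then d else 0))
    = (\<Sum>k\<le>length w. if k = length u then c * d else 0)" by (intro sum.cong) auto
  then show ?thesis using True by auto
next
  case False
  then have "(if u = take k w then c else 0) * (if v = drop k w then d else 0) = 0" for k
    by auto
  then show ?thesis using False by (simp only: sum.neutral_const if_False)
qed

lemma pmul_poly_of:
  "poly_of p \<^bold>* poly_of q = poly_of (concat (map (\<lambda>(c,u). map (\<lambda>(d,v). (c * d, u @ v)) q) p))"
proof
  fix w
  have mono: "(\<Sum>k\<le>length w. (if u = take k w then c else 0) * poly_of q (drop k w))
     = poly_of (map (\<lambda>(d,v). (c * d, u @ v)) q) w" for c u
  proof (induction q)
    case (Cons a q)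
    obtain d v where a: "a = (d,v)" by force
    show ?case using Cons by (simp only: a poly_of_Cons list.map prod.case distrib_left sum.distrib pmul_monomials)
  qed (simp add: poly_of_Nil)
  have app: "poly_of (p @ q) w = poly_of p w + poly_of q w" for p q
    by (simp add: poly_of_def)
  show "(poly_of p \<^bold>* poly_of q) w = poly_of (concat (map (\<lambda>(c,u). map (\<lambda>(d,v). (c * d, u @ v)) q) p)) w"
    unfolding pmul_def
  proof (induction p)
    case (Cons a p)
    obtain c u where a: "a = (c,u)" by force
    show ?case using Cons
      by (simp only: a poly_of_Cons list.map concat.simps prod.case distrib_right sum.distrib mono app)
  qed (simp add: poly_of_Nil)
qed

text \<open>A word may occur several times in the list and its coefficients may cancel. Summing over
  all listed words in place of the support accounts for both, since the additional words have
  coefficient 0.\<close>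

lemma sum_poly_of:
  "(\<Sum>w\<in>{w. poly_of pl w \<noteq> 0}. poly_of pl w * h w) = (\<Sum>(c,w)\<leftarrow>pl. c * h w)"
proof -
  have A: "(\<Sum>w\<in>A. poly_of pl w * h w) = (\<Sum>(c,w)\<leftarrow>pl. c * h w)"
    if "finite A" "snd ` set pl \<subseteq> A" for A
    using that(2)
  proof (induction pl)
    case (Cons a pl)
    obtain c u where a: "a = (c,u)" by force
    have "(\<Sum>w\<in>A. (if u = w then c else 0) * h w) = (\<Sum>w\<in>A. if w = u then c * h u else 0)"
      by (intro sum.cong) auto
    also have "\<dots> = c * h u" using that(1) Cons.prems a by simp
    finally show ?case using Cons by (simp add: a poly_of_Cons distrib_right sum.distrib)
  qed (simp add: poly_of_Nil)
  have "poly_of pl w = 0" if "w \<notin> snd ` set pl" for w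
    using that by (induction pl) (auto simp: poly_of_def)
  then have "(\<Sum>w\<in>{w. poly_of pl w \<noteq> 0}. poly_of pl w * h w) = (\<Sum>w\<in>snd ` set pl. poly_of pl w * h w)"
    by (intro sum.mono_neutral_left) auto
  then show ?thesis using A[of "snd ` set pl"] by simp
qed

lemma poly_of_Wsp:
  assumes "\<forall>w\<in>snd ` set pl. (\<forall>v\<in>set w. snd v \<in> {1,2,3}) \<and> (\<forall>t. length (filter (\<lambda>v. fst v = t) w) = n t)"
  shows "poly_of pl \<in> Wsp n"
proof -
  have "poly_of pl w = 0" if "w \<notin> snd ` set pl" for w
    using that by (induction pl) (auto simp: poly_of_def)
  then show ?thesis using assms unfolding Wsp_def by blast
qed

lemma is_star_id_poly_of:
  "is_star_id (poly_of pl) \<longleftrightarrow> (\<forall>\<phi>. (\<forall>v. \<phi> v \<in> vpart (fst v)) \<longrightarrow>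
     (\<forall>i<3. \<forall>j<3. (\<Sum>(c,w)\<leftarrow>pl. c * word_eval \<phi> w $$ (i,j)) = 0))"
  unfolding is_star_id_def sum_poly_of ..

lemma spec_poly_of:
  "spec q a b c = poly_of [(q P123, [a,b,c]), (q P132, [a,c,b]), (q P213, [b,a,c]),
     (q P231, [b,c,a]), (q P312, [c,a,b]), (q P321, [c,b,a])]"
  by (simp add: fun_eq_iff spec_expand poly_of_def add.assoc split del: if_split)

section \<open>Highest weight conditions on lists of monomials\<close>

definition delta :: "var \<Rightarrow> var \<Rightarrow> 'a::field" where
  "delta a b = (if a = b then 1 else 0)"

lemma poly_of_word3:
  assumes "\<forall>w\<in>snd ` set pl. length w = 3"
  shows "poly_of pl [p,q,r] = (\<Sum>(c,w)\<leftarrow>pl. c * (delta (w!0) p * delta (w!1) q * delta (w!2) r))"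
  using assms
proof (induction pl)
  case (Cons a pl)
  obtain c w where a: "a = (c,w)" by force
  then obtain x y z where w: "w = [x,y,z]" using Cons.prems by (auto simp: numeral_3_eq_3 length_Suc_conv)
  show ?case using Cons by (simp add: a w poly_of_Cons delta_def)
qed (simp add: poly_of_Nil)

lemma gact_poly_of_word3:
  assumes "\<forall>w\<in>snd ` set pl. length w = 3"
  shows "gact g (poly_of pl) [p,q,r] = (\<Sum>(c,w)\<leftarrow>pl. c * (lcoef g (w!0) p * lcoef g (w!1) q * lcoef g (w!2) r))"
  unfolding gact_def sum_poly_of using assms
proof (induction pl)
  case (Cons a pl)
  obtain c w where a: "a = (c,w)" by force
  then obtain x y z where w: "w = [x,y,z]" using Cons.prems by (auto simp: numeral_3_eq_3 length_Suc_conv)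
  show ?case using Cons by (simp add: a w wcoef3)
qed simp

lemma gact_poly_of_eqI:
  assumes pl: "\<forall>w\<in>snd ` set pl. length w = 3"
    and eq: "\<And>p q r. (\<Sum>(c,w)\<leftarrow>pl. c * (lcoef g (w!0) p * lcoef g (w!1) q * lcoef g (w!2) r))
        = k * (\<Sum>(c,w)\<leftarrow>pl. c * (delta (w!0) p * delta (w!1) q * delta (w!2) r))"
  shows "gact g (poly_of pl) = psmul k (poly_of pl)"
proof
  fix u
  show "gact g (poly_of pl) u = psmul k (poly_of pl) u"
  proof (cases "length u = 3")
    case True
    then obtain p q r where u: "u = [p,q,r]" by (auto simp: numeral_3_eq_3 length_Suc_conv)
    show ?thesis unfolding u psmul_def gact_poly_of_word3[OF pl] poly_of_word3[OF pl] by (rule eq)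
  next
    case False
    have "(\<Sum>(c,w)\<leftarrow>pl. c * wcoef g w u) = 0" using pl False
      by (induction pl) (auto simp: wcoef_def)
    moreover have "poly_of pl u = 0" using pl False
      by (induction pl) (auto simp: poly_of_def)
    ultimately show ?thesis by (simp add: gact_def sum_poly_of psmul_def)
  qed
qed

text \<open>An upper unitriangular matrix adds to each variable only variables of smaller index. The
  first equation uses \<open>Suc 0\<close>, the form into which simplification brings the index 1;
  \<open>lcoef_Diag4\<close> follows the same convention.\<close>

lemma lcoef_UT4:
  assumes "g \<in> UT4"
  shows "lcoef g (t,Suc 0) p = delta (t,1) p"
    "lcoef g (t,2) p = g t $$ (0,1) * delta (t,1) p + delta (t,2) p"
    "lcoef g (t,3) p = g t $$ (0,2) * delta (t,1) p + g t $$ (1,2) * delta (t,2) p + delta (t,3) p"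
proof -
  have g: "g t \<in> carrier_mat 3 3" "upper_triangular (g t)" and d: "\<forall>i<3. g t $$ (i,i) = 1"
    using assms unfolding UT4_def by blast+
  have u: "g t $$ (i,j) = 0" if "j < i" "i < 3" for i j
    using g(2) that carrier_matD(1)[OF g(1)] unfolding upper_triangular_def by simp
  have e: "g t $$ (0,0) = 1" "g t $$ (1,1) = 1" "g t $$ (2,2) = 1"
    "g t $$ (1,0) = 0" "g t $$ (2,0) = 0" "g t $$ (2,1) = 0"
    using d u[of 0 1] u[of 0 2] u[of 1 2] by simp_all
  obtain s i where p: "p = (s,i)" by force
  have "s \<noteq> t \<or> i \<notin> {1,2,3} \<or> (s = t \<and> (i = 1 \<or> i = 2 \<or> i = 3))" by auto
  then show "lcoef g (t,Suc 0) p = delta (t,1) p"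
    "lcoef g (t,2) p = g t $$ (0,1) * delta (t,1) p + delta (t,2) p"
    "lcoef g (t,3) p = g t $$ (0,2) * delta (t,1) p + g t $$ (1,2) * delta (t,2) p + delta (t,3) p"
    by (elim disjE conjE; simp add: p lcoef_def delta_def e e(2,4,6)[unfolded One_nat_def])+
qed

lemma lcoef_Diag4:
  assumes "d \<in> Diag4"
  shows "lcoef d (t,Suc 0) p = d t $$ (0,0) * delta (t,1) p" "lcoef d (t,2) p = d t $$ (1,1) * delta (t,2) p"
    "lcoef d (t,3) p = d t $$ (2,2) * delta (t,3) p"
proof -
  have g: "d t \<in> carrier_mat 3 3" "diagonal_mat (d t)" using assms unfolding Diag4_def by blast+
  have u: "d t $$ (i,j) = 0" if "i < 3" "j < 3" "i \<noteq> j" for i j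
    using g(2) that carrier_matD[OF g(1)] unfolding diagonal_mat_def by simp
  have e: "d t $$ (0,1) = 0" "d t $$ (0,2) = 0" "d t $$ (1,2) = 0"
    "d t $$ (1,0) = 0" "d t $$ (2,0) = 0" "d t $$ (2,1) = 0"
    using u[of 0 1] u[of 0 2] u[of 1 2] u[of 1 0] u[of 2 0] u[of 2 1] by simp_all
  obtain s i where p: "p = (s,i)" by force
  have "s \<noteq> t \<or> i \<notin> {1,2,3} \<or> (s = t \<and> (i = 1 \<or> i = 2 \<or> i = 3))" by auto
  then show "lcoef d (t,Suc 0) p = d t $$ (0,0) * delta (t,1) p" "lcoef d (t,2) p = d t $$ (1,1) * delta (t,2) p"
    "lcoef d (t,3) p = d t $$ (2,2) * delta (t,3) p"
    by (elim disjE conjE; simp add: p lcoef_def delta_def e e(1,3,4,6)[unfolded One_nat_def])+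
qed

lemma hwv_poly_of:
  assumes pl: "\<forall>w\<in>snd ` set pl. length w = 3" and nz: "poly_of pl u \<noteq> 0"
    and U: "\<And>g p q r. g \<in> UT4 \<Longrightarrow> (\<Sum>(c,w)\<leftarrow>pl. c * (lcoef g (w!0) p * lcoef g (w!1) q * lcoef g (w!2) r))
        = (\<Sum>(c,w)\<leftarrow>pl. c * (delta (w!0) p * delta (w!1) q * delta (w!2) r))"
    and D: "\<And>d p q r. d \<in> Diag4 \<Longrightarrow> (\<Sum>(c,w)\<leftarrow>pl. c * (lcoef d (w!0) p * lcoef d (w!1) q * lcoef d (w!2) r))
        = (\<Prod>t\<in>{YP,YM,ZP,ZM}. \<Prod>i<3. (d t $$ (i,i)) ^ ppart (lam t) i) *
          (\<Sum>(c,w)\<leftarrow>pl. c * (delta (w!0) p * delta (w!1) q * delta (w!2) r))"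
  shows "hwv lam (poly_of pl)"
proof -
  have "gact g (poly_of pl) = poly_of pl" if "g \<in> UT4" for g
    using gact_poly_of_eqI[OF pl, of g 1] U[OF that] by (simp add: psmul_def)
  moreover have "gact d (poly_of pl) = psmul (\<Prod>t\<in>{YP,YM,ZP,ZM}. \<Prod>i<3. (d t $$ (i,i)) ^ ppart (lam t) i) (poly_of pl)"
    if "d \<in> Diag4" for d
    by (rule gact_poly_of_eqI[OF pl D[OF that]])
  moreover have "poly_of pl \<noteq> pzero" using nz by (auto simp: pzero_def)
  ultimately show ?thesis unfolding hwv_def by blast
qed

text \<open>A certificate that \<open>Q\<close> is the space of multilinear vectors of
  \<open>gmod f\<close>. The last three clauses give, in this order, the upper bound by
  \<open>Phi\<close>, the lower bound by specializations, and the recovery of \<open>f\<close> from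
  any nonzero vector of \<open>Q\<close>, which yields irreducibility.\<close>

definition gen_ok :: "vt \<Rightarrow> vt \<Rightarrow> vt \<Rightarrow> 'a::field npoly \<Rightarrow> mpart \<Rightarrow> (s3 \<Rightarrow> 'a) set \<Rightarrow> bool" where
  "gen_ok t0 t1 t2 f lam Q \<longleftrightarrow> f \<in> Wsp (tcount t0 t1 t2) \<and> is_star_id f \<and> hwv lam f \<and> subsp Q \<and>
    (\<forall>a b c. typed3 t0 t1 t2 a b c \<longrightarrow> lin f a b c \<in> Q) \<and>
    (\<forall>q\<in>Q. \<forall>a b c. typed3 t0 t1 t2 a b c \<longrightarrow> spec q a b c \<in> gmod f) \<and>
    (\<forall>q\<in>Q. q \<noteq> (\<lambda>_. 0) \<longrightarrow> (\<exists>a b c k. typed3 t0 t1 t2 a b c \<and> f = psmul k (spec q a b c)))"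

text \<open>A nonzero element of a submodule has a nonzero linearization, which lies in
  \<open>Q\<close>; some specialization of it stays in the submodule and gives back \<open>f\<close>
  up to a scalar.\<close>

lemma gen_ok_irreducible:
  fixes f :: "'a::field_char_0 npoly"
  assumes ok: "gen_ok t0 t1 t2 f lam Q"
  shows "irreducible_mod (gmod f)"
  unfolding irreducible_mod_def
proof (intro conjI allI impI)
  have f: "f \<in> Wsp (tcount t0 t1 t2)" and Q: "subsp Q" using ok by (auto simp: gen_ok_def)
  show "gsubmod (gmod f)" by (rule gsubmod_gmod[OF f])
  have "f \<noteq> pzero" using ok by (auto simp: gen_ok_def hwv_def)
  then show "gmod f \<noteq> {pzero}" using gmod_self[OF f] by auto
  have "f \<in> Phi t0 t1 t2 Q" using ok unfolding gen_ok_def Phi_def by blast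
  then have sub: "gmod f \<subseteq> Phi t0 t1 t2 Q" by (rule gmod_minimal[OF gsubmod_Phi[OF Q]])
  fix N assume N: "N \<subseteq> gmod f" "gsubmod N" "N \<noteq> {pzero}"
  have "pzero \<in> N" using N(2) by (simp add: gsubmod_def)
  then obtain x where x: "x \<in> N" "x \<noteq> pzero" using N(3) by blast
  have xP: "x \<in> Phi t0 t1 t2 Q" using x N sub by blast
  then have xW: "x \<in> Wsp (tcount t0 t1 t2)" by (simp add: Phi_def)
  obtain a b c where abc: "typed3 t0 t1 t2 a b c" and nz: "lin x a b c \<noteq> (\<lambda>_. 0)"
    using Wsp_eq_0I[OF xW] x(2) by blast
  have "lin x a b c \<in> Q" using xP abc unfolding Phi_def by blast
  then obtain a' b' c' k where a': "typed3 t0 t1 t2 a' b' c'" and fk: "f = psmul k (spec (lin x a b c) a' b' c')"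
    using ok nz unfolding gen_ok_def by blast
  have "spec (lin x a b c) a' b' c' \<in> N" by (rule gsubmod_spec_lin[OF N(2) x(1) xW abc a'])
  then have "f \<in> N" unfolding fk using N(2) by (simp add: gsubmod_def)
  then show "N = gmod f" using gmod_minimal[OF N(2)] N(1) by blast
qed

lemma spec_sum:
  "spec (\<lambda>\<sigma>. \<Sum>k\<in>A. r k \<sigma>) a b c = (\<lambda>u. \<Sum>k\<in>A. spec (r k) a b c u)"
  unfolding spec_def by (rule ext, subst sum.swap) (intro sum.cong refl, simp)

text \<open>Independence transfers because \<open>lin\<close> is linear and a polynomial with all
  typed linearizations zero is zero. For completeness, the linearization of an identity is split in
  the space of coefficient vectors and each summand is specialized back into its own module.\<close>

lemma decompI:
  fixes gens :: "('a::field_char_0 npoly \<times> mpart) list"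
  assumes n: "n = tcount t0 t1 t2"
    and ok: "list_all2 (\<lambda>(f,lam) Q. gen_ok t0 t1 t2 f lam Q) gens Qs"
    and indep: "\<And>q. \<forall>k<length gens. q k \<in> Qs ! k \<Longrightarrow> \<forall>\<sigma>. (\<Sum>k<length gens. q k \<sigma>) = 0 \<Longrightarrow>
        \<forall>k<length gens. \<forall>\<sigma>. q k \<sigma> = 0"
    and compl: "\<And>q. is_star_id (spec q (t0,1) (t1,2) (t2,3)) \<Longrightarrow>
        \<exists>r. (\<forall>k<length gens. r k \<in> Qs ! k) \<and> (\<forall>\<sigma>. q \<sigma> = (\<Sum>k<length gens. r k \<sigma>))"
  shows "decomp n gens"
proof -
  define W :: "'a npoly set" where "W = Wsp (tcount t0 t1 t2)"
  define S where "S = {p \<in> W. is_star_id p}"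
  define m where "m = length gens"
  define f where "f k = fst (gens ! k)" for k
  have ok': "gen_ok t0 t1 t2 (f k) (snd (gens ! k)) (Qs ! k)" if "k < m" for k
    using list_all2_nthD[OF ok, of k] that by (simp add: m_def f_def case_prod_beta)
  have fW: "f k \<in> Wsp (tcount t0 t1 t2)" if "k < m" for k using ok'[OF that] by (simp add: gen_ok_def)
  have fS: "f k \<in> S" if "k < m" for k using ok'[OF that] by (simp add: gen_ok_def S_def W_def)
  have gS: "gsubmod S" unfolding S_def W_def by (rule gsubmod_star_id)
  have sS: "subsp S" using gS by (simp add: gsubmod_iff)
  have MS: "gmod (f k) \<subseteq> S" if "k < m" for k by (rule gmod_minimal[OF gS fS[OF that]])
  have sM: "subsp (gmod (f k))" if "k < m" for k using gsubmod_gmod[OF fW[OF that]] by (simp add: gsubmod_iff)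
  have MP: "gmod (f k) \<subseteq> Phi t0 t1 t2 (Qs ! k)" if "k < m" for k
  proof (rule gmod_minimal[OF gsubmod_Phi])
    show "subsp (Qs ! k)" using ok'[OF that] by (simp add: gen_ok_def)
    show "f k \<in> Phi t0 t1 t2 (Qs ! k)" using ok'[OF that] unfolding gen_ok_def Phi_def by blast
  qed
  define T where "T = {(\<lambda>w. \<Sum>k<m. x k w) | x. \<forall>k<m. x k \<in> gmod (f k)}"
  have TI: "(\<lambda>w. \<Sum>k<m. x k w) \<in> T" if "\<forall>k<m. x k \<in> gmod (f k)" for x
    unfolding T_def using that by (intro CollectI exI[of _ x]) simp
  have TE: "\<exists>x. y = (\<lambda>w. \<Sum>k<m. x k w) \<and> (\<forall>k<m. x k \<in> gmod (f k))" if "y \<in> T" for y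
    using that unfolding T_def by (rule CollectD)
  have sT: "subsp T" unfolding subsp_def
  proof (intro conjI allI ballI)
    show "(\<lambda>_. 0) \<in> T" using TI[of "\<lambda>_ _. 0"] subsp_zero[OF sM] by simp
    fix x y assume xy: "x \<in> T" "y \<in> T"
    obtain x' where x': "x = (\<lambda>w. \<Sum>k<m. x' k w)" "\<forall>k<m. x' k \<in> gmod (f k)" using TE[OF xy(1)] by (elim exE conjE)
    obtain y' where y': "y = (\<lambda>w. \<Sum>k<m. y' k w)" "\<forall>k<m. y' k \<in> gmod (f k)" using TE[OF xy(2)] by (elim exE conjE)
    from x' y' show "(\<lambda>u. x u + y u) \<in> T" using TI[of "\<lambda>k u. x' k u + y' k u"] subsp_add[OF sM]
      by (simp add: sum.distrib)
  next
    fix c x assume xT: "x \<in> T"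
    obtain x' where x': "x = (\<lambda>w. \<Sum>k<m. x' k w)" "\<forall>k<m. x' k \<in> gmod (f k)" using TE[OF xT] by (elim exE conjE)
    then show "(\<lambda>u. c * x u) \<in> T" using TI[of "\<lambda>k u. c * x' k u"] subsp_scale[OF sM]
      by (simp add: sum_distrib_left)
  qed
  have TS: "T \<subseteq> S"
  proof
    fix y assume yT: "y \<in> T"
    obtain x where x: "y = (\<lambda>w. \<Sum>k<m. x k w)" "\<forall>k<m. x k \<in> gmod (f k)" using TE[OF yT] by (elim exE conjE)
    show "y \<in> S" unfolding x(1) using x(2) MS by (intro subsp_sum[OF sS]) auto
  qed
  have "S \<subseteq> T"
  proof
    fix x assume x: "x \<in> S"
    then have xW: "x \<in> Wsp (tcount t0 t1 t2)" by (simp add: S_def W_def)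
    show "x \<in> T"
    proof (rule subsp_of_spec_lin[OF sT xW])
      fix a b c assume abc: "typed3 t0 t1 t2 a b c"
      \<comment> \<open>The indices 1, 2, 3 keep the letters distinct even when types coincide, so
        that the six coefficients can be examined on a multilinear polynomial.\<close>
      have "typed3 t0 t1 t2 (t0,1) (t1,2) (t2,3)" by (simp add: typed3_def Vars_def)
      from gsubmod_spec_lin[OF gS x xW abc this] have "is_star_id (spec (lin x a b c) (t0,1) (t1,2) (t2,3))"
        by (simp add: S_def)
      from compl[OF this] obtain r where r: "\<forall>k<m. r k \<in> Qs ! k" "\<forall>\<sigma>. lin x a b c \<sigma> = (\<Sum>k<m. r k \<sigma>)"
        unfolding m_def by blast
      have l: "lin x a b c = (\<lambda>\<sigma>. \<Sum>k<m. r k \<sigma>)" using r(2) by blast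
      have "spec (r k) a b c \<in> gmod (f k)" if k: "k < m" for k
        using ok'[OF k] r(1) k abc unfolding gen_ok_def by blast
      then have "(\<lambda>u. \<Sum>k<m. spec (r k) a b c u) \<in> T" by (intro TI) simp
      then show "spec (lin x a b c) a b c \<in> T" by (simp add: l spec_sum)
    qed
  qed
  then have ST: "S = T" using TS by (rule subset_antisym)
  have dir: "\<forall>k<m. x k = pzero" if x: "\<forall>k<m. x k \<in> gmod (f k)" and z: "(\<lambda>w. \<Sum>k<m. x k w) = pzero" for x
  proof (intro allI impI)
    fix k assume k: "k < m"
    have xP: "x l \<in> Phi t0 t1 t2 (Qs ! l)" if "l < m" for l using x MP that by blast
    show "x k = pzero"
    proof (rule Wsp_eq_0I)
      show "x k \<in> Wsp (tcount t0 t1 t2)" using xP[OF k] by (simp add: Phi_def)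
      fix a b c assume abc: "typed3 t0 t1 t2 a b c"
      have "\<forall>l<m. lin (x l) a b c \<in> Qs ! l" using xP abc unfolding Phi_def by blast
      moreover have "\<forall>\<sigma>. (\<Sum>l<m. lin (x l) a b c \<sigma>) = 0"
        using fun_cong[OF z] by (simp add: lin_def pzero_def)
      ultimately have "\<forall>l<m. \<forall>\<sigma>. lin (x l) a b c \<sigma> = 0"
        using indep[of "\<lambda>l. lin (x l) a b c"] unfolding m_def by blast
      then show "lin (x k) a b c = (\<lambda>_. 0)" using k by blast
    qed
  qed
  have "\<forall>x. (\<forall>k<m. x k \<in> gmod (f k)) \<longrightarrow> (\<lambda>w. \<Sum>k<m. x k w) = pzero \<longrightarrow> (\<forall>k<m. x k = pzero)"
    by (rule allI, rule impI, rule impI, rule dir)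
  moreover have "\<forall>k<m. f k \<in> S \<and> hwv (snd (gens ! k)) (f k) \<and> irreducible_mod (gmod (f k))"
  proof (intro allI impI conjI)
    fix k assume k: "k < m"
    show "f k \<in> S" "irreducible_mod (gmod (f k))" by (fact fS[OF k], fact gen_ok_irreducible[OF ok'[OF k]])
    show "hwv (snd (gens ! k)) (f k)" using ok'[OF k] by (simp add: gen_ok_def)
  qed
  ultimately show ?thesis
    unfolding decomp_def Let_def n f_def[symmetric] m_def[symmetric] W_def[symmetric] S_def[symmetric] T_def[symmetric]
    by (intro conjI ST)
qed

subsection \<open>Verification of generators\<close>

fun vec6 :: "'a \<Rightarrow> 'a \<Rightarrow> 'a \<Rightarrow> 'a \<Rightarrow> 'a \<Rightarrow> 'a \<Rightarrow> s3 \<Rightarrow> 'a" where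
  "vec6 a b c d e f P123 = a"
| "vec6 a b c d e f P132 = b"
| "vec6 a b c d e f P213 = c"
| "vec6 a b c d e f P231 = d"
| "vec6 a b c d e f P312 = e"
| "vec6 a b c d e f P321 = f"

definition line :: "('b \<Rightarrow> 'a::field) \<Rightarrow> ('b \<Rightarrow> 'a) set" where
  "line u = {q. \<exists>x. \<forall>\<sigma>. q \<sigma> = x * u \<sigma>}"

definition plane :: "('b \<Rightarrow> 'a::field) \<Rightarrow> ('b \<Rightarrow> 'a) \<Rightarrow> ('b \<Rightarrow> 'a) set" where
  "plane u v = {q. \<exists>x y. \<forall>\<sigma>. q \<sigma> = x * u \<sigma> + y * v \<sigma>}"

lemma subsp_line: "subsp (line u)"
  unfolding subsp_def line_def
proof (intro conjI ballI allI CollectI; (elim CollectE exE)?)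
  show "\<exists>x. \<forall>\<sigma>. 0 = x * u \<sigma>" by (rule exI[of _ 0]) simp
  show "\<exists>x. \<forall>\<sigma>. p \<sigma> + q \<sigma> = x * u \<sigma>" if "\<forall>\<sigma>. p \<sigma> = a * u \<sigma>" "\<forall>\<sigma>. q \<sigma> = b * u \<sigma>" for p q a b
    using that by (intro exI[of _ "a + b"]) (simp add: distrib_right)
  show "\<exists>x. \<forall>\<sigma>. c * p \<sigma> = x * u \<sigma>" if "\<forall>\<sigma>. p \<sigma> = a * u \<sigma>" for c p a
    using that by (intro exI[of _ "c * a"]) (simp add: mult.assoc)
qed

lemma subsp_plane: "subsp (plane u v)"
  unfolding subsp_def plane_def
proof (intro conjI ballI allI CollectI; (elim CollectE exE)?)
  show "\<exists>x y. \<forall>\<sigma>. 0 = x * u \<sigma> + y * v \<sigma>" by (rule exI[of _ 0], rule exI[of _ 0]) simp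
  show "\<exists>x y. \<forall>\<sigma>. p \<sigma> + q \<sigma> = x * u \<sigma> + y * v \<sigma>"
    if "\<forall>\<sigma>. p \<sigma> = a * u \<sigma> + a' * v \<sigma>" "\<forall>\<sigma>. q \<sigma> = b * u \<sigma> + b' * v \<sigma>" for p q a b a' b'
    using that by (intro exI[of _ "a + b"] exI[of _ "a' + b'"]) (simp add: algebra_simps)
  show "\<exists>x y. \<forall>\<sigma>. c * p \<sigma> = x * u \<sigma> + y * v \<sigma>" if "\<forall>\<sigma>. p \<sigma> = a * u \<sigma> + a' * v \<sigma>" for c p a a'
    using that by (intro exI[of _ "c * a"] exI[of _ "c * a'"]) (simp add: algebra_simps)
qed

lemma is_star_id_poly_ofI:
  fixes pl :: "('a::field_char_0 \<times> var list) list"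
  assumes pl: "\<forall>w\<in>snd ` set pl. length w = 3"
    and z: "\<And>\<alpha> \<beta> \<gamma>. \<forall>i<3. \<forall>j<3. (\<Sum>(c,w)\<leftarrow>pl. c * (gen_mat (fst (w!0)) (\<alpha> (w!0)) (\<beta> (w!0)) (\<gamma> (w!0)) *
       (gen_mat (fst (w!1)) (\<alpha> (w!1)) (\<beta> (w!1)) (\<gamma> (w!1)) *
        gen_mat (fst (w!2)) (\<alpha> (w!2)) (\<beta> (w!2)) (\<gamma> (w!2)))) $$ (i,j)) = 0"
  shows "is_star_id (poly_of pl)"
  unfolding is_star_id_poly_of
proof (intro allI impI)
  fix \<phi> :: "var \<Rightarrow> 'a mat" and i j :: nat
  assume \<phi>: "\<forall>v. \<phi> v \<in> vpart (fst v)" and ij: "i < 3" "j < 3"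
  obtain \<alpha> \<beta> \<gamma> where abc: "\<And>v. \<phi> v = gen_mat (fst v) (\<alpha> v) (\<beta> v) (\<gamma> v)"
    using \<phi> unfolding vpart_iff by metis
  have "(\<Sum>(c,w)\<leftarrow>pl. c * word_eval \<phi> w $$ (i,j)) = (\<Sum>(c,w)\<leftarrow>pl. c * (\<phi> (w!0) * (\<phi> (w!1) * \<phi> (w!2))) $$ (i,j))"
    using pl
  proof (induction pl)
    case (Cons a pl)
    obtain c w where a: "a = (c,w)" by force
    then obtain x y z where w: "w = [x,y,z]" using Cons.prems by (auto simp: numeral_3_eq_3 length_Suc_conv)
    have "word_eval \<phi> w = \<phi> (w!0) * (\<phi> (w!1) * \<phi> (w!2))"
      unfolding w by (subst word_eval3) (simp_all add: abc gen_mat_carrier)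
    then show ?case using Cons by (simp add: a)
  qed simp
  then show "(\<Sum>(c,w)\<leftarrow>pl. c * word_eval \<phi> w $$ (i,j)) = 0"
    using z[of \<alpha> \<beta> \<gamma>] ij unfolding abc by simp
qed

text \<open>Each choice of three matrices and one entry is one linear equation for the six
  coefficients of a multilinear identity.\<close>

lemma is_star_id_spec_eval:
  fixes q :: "s3 \<Rightarrow> 'a::field_char_0"
  assumes id: "is_star_id (spec q (t0,1) (t1,2) (t2,3))"
    and ABC: "A = gen_mat t0 a b c" "B = gen_mat t1 d e f" "C = gen_mat t2 g h k"
    and ij: "i < 3" "j < 3"
  shows "q P123 * (A * (B * C)) $$ (i,j) + q P132 * (A * (C * B)) $$ (i,j) + q P213 * (B * (A * C)) $$ (i,j)
    + q P231 * (B * (C * A)) $$ (i,j) + q P312 * (C * (A * B)) $$ (i,j) + q P321 * (C * (B * A)) $$ (i,j) = 0"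
proof -
  define \<phi> where "\<phi> v = (if v = (t0,1) then A else if v = (t1,2) then B else if v = (t2,3) then C
     else gen_mat (fst v) 0 0 0)" for v :: var
  have "\<phi> v \<in> vpart (fst v)" for v
    using gen_mat_vpart unfolding \<phi>_def ABC by auto
  then have "(\<Sum>(c,w)\<leftarrow>[(q P123, [(t0,1),(t1,2),(t2,3)]), (q P132, [(t0,1),(t2,3),(t1,2)]), (q P213, [(t1,2),(t0,1),(t2,3)]),
     (q P231, [(t1,2),(t2,3),(t0,1)]), (q P312, [(t2,3),(t0,1),(t1,2)]), (q P321, [(t2,3),(t1,2),(t0,1)])].
      c * word_eval \<phi> w $$ (i,j)) = 0"
    using id ij unfolding spec_poly_of is_star_id_poly_of by blast
  moreover have c: "A \<in> carrier_mat 3 3" "B \<in> carrier_mat 3 3" "C \<in> carrier_mat 3 3"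
    unfolding ABC by (rule gen_mat_carrier)+
  moreover have "\<phi> (t0,1) = A" "\<phi> (t1,2) = B" "\<phi> (t2,3) = C" by (simp_all add: \<phi>_def)
  ultimately show ?thesis by (simp add: word_eval3 add.assoc del: index_mult_mat One_nat_def)
qed

lemma weight_expand:
  "(\<Prod>t\<in>{YP,YM,ZP,ZM}. \<Prod>i<3. F t i) = F YP 0 * F YP 1 * F YP 2 * (F YM 0 * F YM 1 * F YM 2)
    * (F ZP 0 * F ZP 1 * F ZP 2) * (F ZM 0 * F ZM 1 * F ZM (2::nat) :: 'a::field)"
  by (simp add: numeral_3_eq_3 numeral_2_eq_2 mult.assoc)

text \<open>For a literal list every clause reduces by simplification to polynomial arithmetic;
  \<open>p\<close>, \<open>q\<close>, \<open>r\<close> stay symbolic, so products of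
  \<open>delta\<close> are compared formally without a case split over words.\<close>

definition hwv_check :: "vt \<Rightarrow> vt \<Rightarrow> vt \<Rightarrow> ('a::field \<times> var list) list \<Rightarrow> mpart \<Rightarrow> bool" where
  "hwv_check t0 t1 t2 pl lam \<longleftrightarrow>
    (\<forall>w\<in>snd ` set pl. length w = 3 \<and> (\<forall>v\<in>set w. snd v \<in> {1,2,3}) \<and>
        (\<forall>t. length (filter (\<lambda>v. fst v = t) w) = tcount t0 t1 t2 t)) \<and>
    (\<forall>\<alpha> \<beta> \<gamma>. \<forall>i<3. \<forall>j<3. (\<Sum>(c,w)\<leftarrow>pl. c * (gen_mat (fst (w!0)) (\<alpha> (w!0)) (\<beta> (w!0)) (\<gamma> (w!0)) *
       (gen_mat (fst (w!1)) (\<alpha> (w!1)) (\<beta> (w!1)) (\<gamma> (w!1)) *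
        gen_mat (fst (w!2)) (\<alpha> (w!2)) (\<beta> (w!2)) (\<gamma> (w!2)))) $$ (i,j)) = 0) \<and>
    (\<forall>g p q r. g \<in> UT4 \<longrightarrow> (\<Sum>(c,w)\<leftarrow>pl. c * (lcoef g (w!0) p * lcoef g (w!1) q * lcoef g (w!2) r))
        = (\<Sum>(c,w)\<leftarrow>pl. c * (delta (w!0) p * delta (w!1) q * delta (w!2) r))) \<and>
    (\<forall>d p q r. d \<in> Diag4 \<longrightarrow> (\<Sum>(c,w)\<leftarrow>pl. c * (lcoef d (w!0) p * lcoef d (w!1) q * lcoef d (w!2) r))
        = (\<Prod>t\<in>{YP,YM,ZP,ZM}. \<Prod>i<3. (d t $$ (i,i)) ^ ppart (lam t) i) *
          (\<Sum>(c,w)\<leftarrow>pl. c * (delta (w!0) p * delta (w!1) q * delta (w!2) r)))"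

lemma hwv_check_sound:
  fixes pl :: "('a::field_char_0 \<times> var list) list"
  assumes chk: "hwv_check t0 t1 t2 pl lam" and nz: "poly_of pl u \<noteq> 0"
  shows "poly_of pl \<in> Wsp (tcount t0 t1 t2)" "is_star_id (poly_of pl)" "hwv lam (poly_of pl)"
proof -
  have pl3: "\<forall>w\<in>snd ` set pl. length w = 3" using chk unfolding hwv_check_def by blast
  show "poly_of pl \<in> Wsp (tcount t0 t1 t2)"
    by (rule poly_of_Wsp) (use chk in \<open>unfold hwv_check_def, blast\<close>)
  show "is_star_id (poly_of pl)"
    by (rule is_star_id_poly_ofI[OF pl3]) (use chk in \<open>unfold hwv_check_def, blast\<close>)
  show "hwv lam (poly_of pl)"
    by (rule hwv_poly_of[OF pl3 nz]) (use chk in \<open>unfold hwv_check_def, blast\<close>)+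
qed

lemma typed3_iff:
  "typed3 t0 t1 t2 a b c \<longleftrightarrow> (\<exists>i\<in>{1,2,3}. \<exists>j\<in>{1,2,3}. \<exists>k\<in>{1,2,3}. a = (t0,i) \<and> b = (t1,j) \<and> c = (t2,k))"
  by (cases a; cases b; cases c) (auto simp: typed3_def Vars_def)

lemma spec_scale: "spec (\<lambda>\<sigma>. x * q \<sigma>) a b c = psmul x (spec q a b c)"
  by (auto simp: spec_def psmul_def sum_distrib_left fun_eq_iff intro!: sum.cong)

lemma spec_add: "spec (\<lambda>\<sigma>. p \<sigma> + q \<sigma>) a b c = spec p a b c \<^bold>+ spec q a b c"
  by (auto simp: spec_def padd_def sum.distrib[symmetric] fun_eq_iff intro!: sum.cong)

text \<open>\<open>k\<close> is meant to be the inverse order of the stabilizer of the letters a, b,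
  c, that is 1, 1/2 or 1/6. The scalars 0, 1, -1 are those of a generator that is symmetric or
  alternating in each type: permuting its letters changes \<open>u\<close> at most by a sign, and
  other letters give 0.\<close>

lemma gen_ok_lineI:
  fixes f :: "'a::field_char_0 npoly"
  assumes fpl: "f = poly_of pl" and chk: "hwv_check t0 t1 t2 pl lam"
    and lin: "\<forall>i\<in>{1,2,3}. \<forall>j\<in>{1,2,3}. \<forall>k\<in>{1,2,3}. \<exists>x\<in>{0,1,-1}. \<forall>\<sigma>. lin (poly_of pl) (t0,i) (t1,j) (t2,k) \<sigma> = x * u \<sigma>"
    and c: "typed3 t0 t1 t2 a b c" and u: "\<forall>\<sigma>. lin (poly_of pl) a b c \<sigma> = u \<sigma>" and nz: "\<not> (\<forall>\<sigma>. u \<sigma> = 0)"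
    and k: "\<forall>w. poly_of pl w = k * spec u a b c w"
  shows "gen_ok t0 t1 t2 f lam (line u)"
  unfolding gen_ok_def
proof (intro conjI allI impI ballI)
  obtain \<sigma> where "lin (poly_of pl) a b c \<sigma> \<noteq> 0" using nz u by auto
  then have "poly_of pl (pw \<sigma> a b c) \<noteq> 0" by (simp add: lin_def)
  from hwv_check_sound[OF chk this]
  show fW: "f \<in> Wsp (tcount t0 t1 t2)" and "is_star_id f" "hwv lam f" by (simp_all add: fpl)
  show "subsp (line u)" by (rule subsp_line)
  show "lin f a b c \<in> line u" if "typed3 t0 t1 t2 a b c" for a b c
    using that lin unfolding fpl typed3_iff line_def by blast
  have u': "u = lin f a b c" using u by (auto simp: fpl)
  have f: "f = psmul k (spec u a b c)" using k by (auto simp: fpl psmul_def)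
  show "spec q a' b' c' \<in> gmod f" if q: "q \<in> line u" and a': "typed3 t0 t1 t2 a' b' c'" for q a' b' c'
  proof -
    obtain x where "q = (\<lambda>\<sigma>. x * u \<sigma>)" using q unfolding line_def by auto
    then show ?thesis unfolding u'
      using gsubmod_spec_lin[OF gsubmod_gmod[OF fW] gmod_self[OF fW] fW c a'] gsubmod_gmod[OF fW]
      by (simp add: spec_scale gsubmod_def)
  qed
  show "\<exists>a b c k. typed3 t0 t1 t2 a b c \<and> f = psmul k (spec q a b c)" if q: "q \<in> line u" and "q \<noteq> (\<lambda>_. 0)" for q
  proof -
    obtain x where x: "q = (\<lambda>\<sigma>. x * u \<sigma>)" using q unfolding line_def by auto
    with that(2) have "x \<noteq> 0" by auto
    then have "f = psmul (k / x) (spec q a b c)" unfolding x spec_scale by (subst f) (simp add: psmul_def)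
    then show ?thesis using c by blast
  qed
qed

text \<open>Modelled on a highest weight vector of shape (2,1) in letters 1, 1, 2. Its
  linearizations at (1,1,2), (1,2,1), (2,1,1) add up to zero because substituting letter 1 for
  letter 2 kills it; this explains the pair (-1,-1). The same vanishing, with the stabilizer of
  order 2, gives the values 2 and -1 in the last four assumptions.\<close>

lemma gen_ok_planeI:
  fixes f :: "'a::field_char_0 npoly"
  assumes fpl: "f = poly_of pl" and chk: "hwv_check t0 t1 t2 pl lam"
    and lin: "\<forall>i\<in>{1,2,3}. \<forall>j\<in>{1,2,3}. \<forall>k\<in>{1,2,3}. \<exists>z\<in>{(0,0),(1,0),(0,1),(-1,-1)}.
      \<forall>\<sigma>. lin (poly_of pl) (t0,i) (t1,j) (t2,k) \<sigma> = fst z * u \<sigma> + snd z * v \<sigma>"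
    and c: "typed3 t0 t1 t2 a b c" "typed3 t0 t1 t2 a' b' c'"
    and u: "\<forall>\<sigma>. lin (poly_of pl) a b c \<sigma> = u \<sigma>" and nz: "\<not> (\<forall>\<sigma>. u \<sigma> = 0)" and v: "\<forall>\<sigma>. lin (poly_of pl) a' b' c' \<sigma> = v \<sigma>"
    and s: "\<forall>w. spec u a b c w = 2 * poly_of pl w" "\<forall>w. spec u a' b' c' w = - poly_of pl w"
      "\<forall>w. spec v a b c w = - poly_of pl w" "\<forall>w. spec v a' b' c' w = 2 * poly_of pl w"
  shows "gen_ok t0 t1 t2 f lam (plane u v)"
  unfolding gen_ok_def
proof (intro conjI allI impI ballI)
  obtain \<sigma> where "lin (poly_of pl) a b c \<sigma> \<noteq> 0" using nz u by auto
  then have "poly_of pl (pw \<sigma> a b c) \<noteq> 0" by (simp add: lin_def)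
  from hwv_check_sound[OF chk this]
  show fW: "f \<in> Wsp (tcount t0 t1 t2)" and "is_star_id f" "hwv lam f" by (simp_all add: fpl)
  show "subsp (plane u v)" by (rule subsp_plane)
  show "lin f a b c \<in> plane u v" if ty: "typed3 t0 t1 t2 a b c" for a b c
  proof -
    obtain z where "\<forall>\<sigma>. lin f a b c \<sigma> = fst z * u \<sigma> + snd z * v \<sigma>"
      using ty lin unfolding fpl typed3_iff by blast
    then show ?thesis unfolding plane_def by blast
  qed
  have u': "u = lin f a b c" "v = lin f a' b' c'" using u v by (auto simp: fpl)
  have uf: "spec u a b c = psmul 2 f" "spec u a' b' c' = psmul (-1) f"
    and vf: "spec v a b c = psmul (-1) f" "spec v a' b' c' = psmul 2 f"
    using s by (auto simp: fpl psmul_def)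
  show "spec q a'' b'' c'' \<in> gmod f" if q: "q \<in> plane u v" and t: "typed3 t0 t1 t2 a'' b'' c''" for q a'' b'' c''
  proof -
    obtain x y where xy: "q = (\<lambda>\<sigma>. x * u \<sigma> + y * v \<sigma>)" using q unfolding plane_def by auto
    note t' = gsubmod_spec_lin[OF gsubmod_gmod[OF fW] gmod_self[OF fW] fW _ t]
    show ?thesis unfolding xy spec_add spec_scale u'
      using t'[OF c(1)] t'[OF c(2)] gsubmod_gmod[OF fW] by (simp add: gsubmod_def)
  qed
  show "\<exists>a b c k. typed3 t0 t1 t2 a b c \<and> f = psmul k (spec q a b c)" if q: "q \<in> plane u v" and qnz: "q \<noteq> (\<lambda>_. 0)" for q
  proof -
    obtain x y where xy: "q = (\<lambda>\<sigma>. x * u \<sigma> + y * v \<sigma>)" using q unfolding plane_def by auto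
    have s1: "spec q a b c = psmul (2 * x - y) f" and s2: "spec q a' b' c' = psmul (2 * y - x) f"
      unfolding xy spec_add spec_scale uf vf by (simp_all add: psmul_def padd_def algebra_simps)
    have "x \<noteq> 0 \<or> y \<noteq> 0" using qnz xy by auto
    \<comment> \<open>The two specializations have the matrix with rows (2,-1), (-1,2), whose
      determinant is 3.\<close>
    moreover have "x = 0 \<and> y = 0" if "2 * x - y = 0" "2 * y - x = 0"
    proof -
      have "3 * x = 2 * (2 * x - y) + (2 * y - x)" "3 * y = 2 * (2 * y - x) + (2 * x - y)"
        by (simp_all add: algebra_simps)
      then show ?thesis unfolding that by simp
    qed
    ultimately consider "2 * x - y \<noteq> 0" | "2 * y - x \<noteq> 0" by blast
    then show ?thesis
    proof cases
      case 1
      then have "f = psmul (1 / (2 * x - y)) (spec q a b c)" unfolding s1 by (simp add: psmul_def)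
      then show ?thesis using c(1) by blast
    next
      case 2
      then have "f = psmul (1 / (2 * y - x)) (spec q a' b' c')" unfolding s2 by (simp add: psmul_def)
      then show ?thesis using c(2) by blast
    qed
  qed
qed

lemmas poly_of_simps = pcomm_def St3_def pvar_poly_of padd_poly_of psub_poly_of pmul_poly_of

lemma ball123: "(\<forall>x\<in>{1,2,3}. P x) \<longleftrightarrow> P (Suc 0) \<and> P 2 \<and> P (3::nat)"
  by auto

lemmas gen_check = hwv_check_def tcount_def poly_of_def m3_mult all_less_3 m3_index m3_index(2,4,5,6,8)[unfolded One_nat_def]
  lcoef_UT4 lcoef_Diag4 weight_expand ppart_def power2_eq_square power3_eq_cube algebra_simps
  psmul_def ball123 lin_def all_s3 typed3_def Vars_def spec_expand

lemma all_vt: "(\<forall>t. P t) \<longleftrightarrow> P YP \<and> P YM \<and> P ZP \<and> P ZM"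
  by (metis vt.exhaust)

lemma vec6_eta: "q = vec6 (q P123) (q P132) (q P213) (q P231) (q P312) (q P321)"
  by (simp add: fun_eq_iff all_s3)

section \<open>Projections onto the summands\<close>

fun lsp :: "('b \<Rightarrow> 'a::field) list \<Rightarrow> ('b \<Rightarrow> 'a) set" where
  "lsp [] = {q. \<forall>\<sigma>. q \<sigma> = 0}"
| "lsp (u # us) = {q. \<exists>x. \<exists>p\<in>lsp us. \<forall>\<sigma>. q \<sigma> = x * u \<sigma> + p \<sigma>}"

lemma lsp_line: "lsp [u] = line u"
  by (auto simp: line_def intro!: exI[of _ "\<lambda>_. 0"])

lemma lsp_plane: "lsp [u, v] = plane u v"
  unfolding lsp.simps(2)[of u] lsp_line plane_def line_def by (auto 4 4 intro: exI[of _ "\<lambda>\<sigma>. _ * v \<sigma>"])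

text \<open>The first component of a pair acts as a linear functional, the second is the vector it
  is paired with.\<close>

definition pr :: "((s3 \<Rightarrow> 'a::field) \<times> (s3 \<Rightarrow> 'a)) list \<Rightarrow> (s3 \<Rightarrow> 'a) \<Rightarrow> s3 \<Rightarrow> 'a" where
  "pr L q \<sigma> = (\<Sum>(w,u)\<leftarrow>L. (\<Sum>\<rho>\<in>UNIV. w \<rho> * q \<rho>) * u \<sigma>)"

lemma pr_Cons: "pr ((w,u) # L) q \<sigma> = (\<Sum>\<rho>\<in>UNIV. w \<rho> * q \<rho>) * u \<sigma> + pr L q \<sigma>"
  by (simp add: pr_def)

lemma pr_in_lsp: "pr L q \<in> lsp (map snd L)"
proof (induction L)
  case (Cons a L)
  then show ?case by (cases a) (auto simp: pr_Cons)
qed (simp add: pr_def)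

lemma pr_lincomb: "pr L (\<lambda>\<sigma>. x * u \<sigma> + p \<sigma>) \<sigma> = x * pr L u \<sigma> + pr L p \<sigma>"
proof (induction L)
  case (Cons a L)
  then show ?case
    by (cases a) (simp add: pr_Cons distrib_left distrib_right sum.distrib sum_distrib_left mult_ac)
qed (simp add: pr_def)

lemma pr_zero: "pr L (\<lambda>_. 0) \<sigma> = 0"
  by (induction L) (auto simp: pr_def)

lemma pr_sum: "pr L (\<lambda>\<sigma>. \<Sum>k\<in>A. q k \<sigma>) \<sigma> = (\<Sum>k\<in>A. pr L (q k) \<sigma>)"
proof (induction A rule: infinite_finite_induct)
  case (insert a A)
  then show ?case using pr_lincomb[of L 1 "q a" "\<lambda>\<sigma>. \<Sum>k\<in>A. q k \<sigma>" \<sigma>] by simp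
qed (simp_all add: pr_zero)

text \<open>Used with c = 1 on the summand to which the projection belongs and with c = 0 on the
  other summands.\<close>

lemma pr_lsp:
  assumes "\<forall>u\<in>set us. \<forall>\<sigma>. pr L u \<sigma> = c * u \<sigma>" "q \<in> lsp us"
  shows "pr L q \<sigma> = c * q \<sigma>"
  using assms
proof (induction us arbitrary: q)
  case Nil
  then have "q = (\<lambda>_. 0)" by auto
  then show ?case by (simp add: pr_zero)
next
  case (Cons u us)
  then obtain x p where p: "p \<in> lsp us" and "\<forall>\<sigma>. q \<sigma> = x * u \<sigma> + p \<sigma>" by auto
  then have q: "q = (\<lambda>\<sigma>. x * u \<sigma> + p \<sigma>)" by auto
  show ?case using Cons.IH[OF _ p] Cons.prems(1) by (simp add: q pr_lincomb distrib_left mult_ac)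
qed

text \<open>Each entry of \<open>Ls\<close> lists pairs (dual vector, basis vector) for one summand, so that \<open>pr (Ls ! k)\<close>
  is the projection of the space of multilinear identities onto the k-th summand.\<close>

lemma decomp_projI:
  fixes gens :: "('a::field_char_0 npoly \<times> mpart) list"
  assumes n: "n = tcount t0 t1 t2"
    and ok: "list_all2 (\<lambda>(f,lam) L. gen_ok t0 t1 t2 f lam (lsp (map snd L))) gens Ls"
    and dual: "\<forall>k<length Ls. \<forall>l<length Ls. \<forall>u\<in>set (map snd (Ls ! l)). \<forall>\<sigma>. pr (Ls ! k) u \<sigma> = (if k = l then 1 else 0) * u \<sigma>"
    and compl: "\<And>q0 q1 q2 q3 q4 q5. is_star_id (spec (vec6 q0 q1 q2 q3 q4 q5) (t0,1) (t1,2) (t2,3)) \<Longrightarrow>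
        \<forall>\<sigma>. vec6 q0 q1 q2 q3 q4 q5 \<sigma> = (\<Sum>k<length Ls. pr (Ls ! k) (vec6 q0 q1 q2 q3 q4 q5) \<sigma>)"
  shows "decomp n gens"
proof (rule decompI[OF n])
  have len: "length Ls = length gens" using ok by (simp add: list_all2_lengthD)
  let ?Qs = "map (\<lambda>L. lsp (map snd L)) Ls"
  show "list_all2 (\<lambda>(f,lam) Q. gen_ok t0 t1 t2 f lam Q) gens ?Qs"
    unfolding list_all2_map2 by (rule list_all2_mono[OF ok]) auto
  show "\<forall>k<length gens. \<forall>\<sigma>. q k \<sigma> = 0"
    if q: "\<forall>k<length gens. q k \<in> ?Qs ! k" and z: "\<forall>\<sigma>. (\<Sum>k<length gens. q k \<sigma>) = 0" for q
  proof (intro allI impI)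
    fix k \<sigma> assume k: "k < length gens"
    have "pr (Ls ! k) (q l) \<sigma> = (if k = l then 1 else 0) * q l \<sigma>" if "l < length gens" for l
      using dual q k that by (intro pr_lsp[of "map snd (Ls ! l)"]) (simp_all add: len)
    then have "(\<Sum>l<length gens. pr (Ls ! k) (q l) \<sigma>) = (\<Sum>l<length gens. if l = k then q k \<sigma> else 0)"
      by (intro sum.cong) auto
    then have "q k \<sigma> = pr (Ls ! k) (\<lambda>\<sigma>. \<Sum>l<length gens. q l \<sigma>) \<sigma>" using k by (simp add: pr_sum)
    then show "q k \<sigma> = 0" using z by (simp add: pr_zero)
  qed
  show "\<exists>r. (\<forall>k<length gens. r k \<in> ?Qs ! k) \<and> (\<forall>\<sigma>. q \<sigma> = (\<Sum>k<length gens. r k \<sigma>))"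
    if q: "is_star_id (spec q (t0,1) (t1,2) (t2,3))" for q
  proof -
    have "\<forall>\<sigma>. q \<sigma> = (\<Sum>k<length Ls. pr (Ls ! k) q \<sigma>)"
      using compl[of "q P123" "q P132" "q P213" "q P231" "q P312" "q P321"] q unfolding vec6_eta[of q, symmetric]
      by blast
    then show ?thesis using len by (intro exI[of _ "\<lambda>k. pr (Ls ! k) q"]) (simp add: pr_in_lsp)
  qed
qed

text \<open>Packages one evaluation as the elimination of one coefficient. After instantiation with
  an identity the open arguments are, in order, the row, the column, both sides of the equation, and
  three parameters for each of the three matrices.\<close>

lemma eq_if_star_id:
  fixes q0 :: "'a::field_char_0" and a b c d e f g h k :: 'a and t0 t1 t2 :: vt
  defines "A \<equiv> gen_mat t0 a b c" and "B \<equiv> gen_mat t1 d e f" and "C \<equiv> gen_mat t2 g h k"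
  assumes "is_star_id (spec (vec6 q0 q1 q2 q3 q4 q5) (t0,1) (t1,2) (t2,3))"
    and "i < 3" "j < 3"
    and "l - r = q0 * (A * (B * C)) $$ (i,j) + q1 * (A * (C * B)) $$ (i,j) + q2 * (B * (A * C)) $$ (i,j)
    + q3 * (B * (C * A)) $$ (i,j) + q4 * (C * (A * B)) $$ (i,j) + q5 * (C * (B * A)) $$ (i,j)"
  shows "l = r"
  using is_star_id_spec_eval[OF assms(4) A_def[THEN meta_eq_to_obj_eq] B_def[THEN meta_eq_to_obj_eq]
      C_def[THEN meta_eq_to_obj_eq] assms(5,6)] assms(7) by (simp del: index_mult_mat)

subsection \<open>The twenty decompositions\<close>

lemmas eval_check = m3_mult m3_index m3_index(2,4,5,6,8)[unfolded One_nat_def] algebra_simps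

lemmas proj_check = pr_def UNIV_s3 all_s3 lessThan_Suc All_less_Suc field_simps

text \<open>The matrices diag(a,b,b) commute, so the only condition on a multilinear identity is
  that its six coefficients add up to zero; the dimension 5 is 2 + 2 + 1.\<close>

lemma decomp_3000:
  "decomp (comp4 3 0 0 0)
     [(pcomm (yp 1) (yp 2) \<^bold>* yp 1, mp4 [2,1] [] [] []),
      (pcomm (yp 1 \<^bold>* yp 1) (yp 2), mp4 [2,1] [] [] []),
      (St3 (yp 1) (yp 2) (yp 3) :: 'a::field_char_0 npoly, mp4 [1,1,1] [] [] [])]" (is "decomp ?n ?gens")
proof -
  \<comment> \<open>In each pair the first vector is the functional dual to the second with respect
    to the basis of all second vectors. It is determined only up to functionals vanishing on the
    identities.\<close>
  let ?Ls = "[[(vec6 (-2/3) 0 (-1/3) 0 (-1/3) (-2/3), vec6 0 1 0 1 (-1) (-1)),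
       (vec6 (-1/3) 0 (1/3) 0 (1/3) (-1/3), vec6 (-1) (-1) 1 0 1 0)],
      [(vec6 (1/3) (-1/3) (1/3) 0 (-1/3) 0, vec6 1 0 1 0 (-1) (-1)),
       (vec6 (-1/3) (-2/3) (-1/3) 0 (-2/3) 0, vec6 (-1) (-1) 0 1 0 1)],
      [(vec6 0 (-1/3) (-1/3) 0 0 (-1/3), vec6 1 (-1) (-1) 1 1 (-1))]]"
  \<comment> \<open>The first simplification rewrites the generator as \<open>poly_of\<close> of a
    list and thereby instantiates \<open>pl\<close>; the remaining goals are then computations on
    this list.\<close>
  have "gen_ok YP YP YP (pcomm (yp 1) (yp 2) \<^bold>* yp 1 :: 'a npoly)
      (mp4 [2,1] [] [] []) (plane (vec6 0 1 0 1 (-1) (-1))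
        (vec6 (-1) (-1) 1 0 1 0))"
    by (rule gen_ok_planeI[where a = "(YP,1)" and b = "(YP,1)" and c = "(YP,2)" and
          a' = "(YP,2)" and b' = "(YP,1)" and c' = "(YP,1)"],
        simp add: poly_of_simps) (simp_all add: gen_check)
  moreover have "gen_ok YP YP YP (pcomm (yp 1 \<^bold>* yp 1) (yp 2) :: 'a npoly)
      (mp4 [2,1] [] [] []) (plane (vec6 1 0 1 0 (-1) (-1))
        (vec6 (-1) (-1) 0 1 0 1))"
    by (rule gen_ok_planeI[where a = "(YP,1)" and b = "(YP,1)" and c = "(YP,2)" and
          a' = "(YP,2)" and b' = "(YP,1)" and c' = "(YP,1)"],
        simp add: poly_of_simps) (simp_all add: gen_check)
  moreover have "gen_ok YP YP YP (St3 (yp 1) (yp 2) (yp 3) :: 'a npoly)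
      (mp4 [1,1,1] [] [] []) (line (vec6 1 (-1) (-1) 1 1 (-1)))"
    by (rule gen_ok_lineI[where a = "(YP,1)" and b = "(YP,2)" and c = "(YP,3)" and k = "1"],
        simp add: poly_of_simps) (simp_all add: gen_check)
  ultimately have gens: "list_all2 (\<lambda>(f,lam) L. gen_ok YP YP YP f lam (lsp (map snd L))) ?gens ?Ls"
    by (simp only: list_all2_Cons list_all2_Nil list.map prod.case snd_conv lsp_line lsp_plane simp_thms)
  have compl: "\<forall>\<sigma>. vec6 q0 q1 q2 q3 q4 q5 \<sigma> =
      (\<Sum>k<length ?Ls. pr (?Ls ! k) (vec6 q0 q1 q2 q3 q4 q5) \<sigma>)"
    if id: "is_star_id (spec (vec6 q0 q1 q2 q3 q4 q5) (YP,1) (YP,2) (YP,3))"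
    for q0 q1 q2 q3 q4 q5 :: 'a
  proof -
    \<comment> \<open>All three matrices are the matrix unit at (0,0), so each of the six products
      has entry 1 there.\<close>
    have e1: "q5 = - q0 - q1 - q2 - q3 - q4"
      by (rule eq_if_star_id[OF id, of 0 0 _ _ 1 0 0 1 0 0 1 0 0])
        (simp_all add: eval_check)
    show ?thesis by (simp add: proj_check e1)
  qed
  show ?thesis
    by (rule decomp_projI[OF _ gens _ compl]) (simp_all add: proj_check fun_eq_iff all_vt tcount_def)
qed

text \<open>Even skew matrices are traceless 2 x 2 blocks; the square of such a block is scalar,
  hence commutes with every other one.\<close>

lemma decomp_0300:
  "decomp (comp4 0 3 0 0)
     [(pcomm (ym 1 \<^bold>* ym 1) (ym 2) :: 'a::field_char_0 npoly, mp4 [] [2,1] [] [])]" (is "decomp ?n ?gens")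
proof -
  let ?Ls = "[[(vec6 0 0 1 0 0 0, vec6 1 0 1 0 (-1) (-1)),
       (vec6 0 (-1) 0 0 0 0, vec6 (-1) (-1) 0 1 0 1)]]"
  have "gen_ok YM YM YM (pcomm (ym 1 \<^bold>* ym 1) (ym 2) :: 'a npoly)
      (mp4 [] [2,1] [] []) (plane (vec6 1 0 1 0 (-1) (-1))
        (vec6 (-1) (-1) 0 1 0 1))"
    by (rule gen_ok_planeI[where a = "(YM,1)" and b = "(YM,1)" and c = "(YM,2)" and
          a' = "(YM,2)" and b' = "(YM,1)" and c' = "(YM,1)"],
        simp add: poly_of_simps) (simp_all add: gen_check)
  then have gens: "list_all2 (\<lambda>(f,lam) L. gen_ok YM YM YM f lam (lsp (map snd L))) ?gens ?Ls"
    by (simp only: list_all2_Cons list_all2_Nil list.map prod.case snd_conv lsp_line lsp_plane simp_thms)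
  have compl: "\<forall>\<sigma>. vec6 q0 q1 q2 q3 q4 q5 \<sigma> =
      (\<Sum>k<length ?Ls. pr (?Ls ! k) (vec6 q0 q1 q2 q3 q4 q5) \<sigma>)"
    if id: "is_star_id (spec (vec6 q0 q1 q2 q3 q4 q5) (YM,1) (YM,2) (YM,3))"
    for q0 q1 q2 q3 q4 q5 :: 'a
  proof -
    have e1: "q5 = - q0"
      by (rule eq_if_star_id[OF id, of 1 2 _ _ 0 1 0 0 0 1 0 1 0])
        (simp_all add: eval_check)
    have e2: "q4 = - q2"
      by (rule eq_if_star_id[OF id, of 2 1 _ _ 0 1 0 0 0 1 0 0 1])
        (simp_all add: eval_check e1)
    have e3: "q3 = - q1"
      by (rule eq_if_star_id[OF id, of 1 2 _ _ 0 1 0 0 1 0 0 0 1])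
        (simp_all add: eval_check e1 e2)
    have e4: "q2 = q0 - q1"
      by (rule eq_if_star_id[OF id, of 1 1 _ _ "-1" 0 0 0 1 0 0 0 1])
        (simp_all add: eval_check e1 e2 e3)
    show ?thesis by (simp add: proj_check e1 e2 e3 e4)
  qed
  show ?thesis
    by (rule decomp_projI[OF _ gens _ compl]) (simp_all add: proj_check fun_eq_iff all_vt tcount_def)
qed

text \<open>On the lower block the even symmetric variables act as scalars, so all six words agree
  there and only the sum of the coefficients matters.\<close>

lemma decomp_2100:
  "decomp (comp4 2 1 0 0)
     [(pcomm (yp 1 \<^bold>* yp 1) (ym 1) :: 'a::field_char_0 npoly, mp4 [2] [1] [] []),
      (pcomm (yp 1) (ym 1 \<^bold>* yp 1), mp4 [2] [1] [] []),
      (pcomm (yp 1) (yp 2) \<^bold>* ym 1, mp4 [1,1] [1] [] []),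
      (yp 1 \<^bold>* ym 1 \<^bold>* yp 2 \<^bold>- yp 2 \<^bold>* ym 1 \<^bold>* yp 1, mp4 [1,1] [1] [] []),
      (ym 1 \<^bold>* pcomm (yp 1) (yp 2), mp4 [1,1] [1] [] [])]" (is "decomp ?n ?gens")
proof -
  let ?Ls = "[[(vec6 (1/2) 0 (1/2) 0 0 0, vec6 1 0 1 0 (-1) (-1))],
      [(vec6 0 (1/2) 0 (1/2) 0 0, vec6 0 1 0 1 (-1) (-1))],
      [(vec6 (1/2) 0 (-1/2) 0 0 0, vec6 1 0 (-1) 0 0 0)],
      [(vec6 0 (1/2) 0 (-1/2) 0 0, vec6 0 1 0 (-1) 0 0)],
      [(vec6 (1/2) (1/2) (1/2) (1/2) 1 0, vec6 0 0 0 0 1 (-1))]]"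
  have "gen_ok YP YP YM (pcomm (yp 1 \<^bold>* yp 1) (ym 1) :: 'a npoly)
      (mp4 [2] [1] [] []) (line (vec6 1 0 1 0 (-1) (-1)))"
    by (rule gen_ok_lineI[where a = "(YP,1)" and b = "(YP,1)" and c = "(YM,1)" and k = "1/2"],
        simp add: poly_of_simps) (simp_all add: gen_check)
  moreover have "gen_ok YP YP YM (pcomm (yp 1) (ym 1 \<^bold>* yp 1) :: 'a npoly)
      (mp4 [2] [1] [] []) (line (vec6 0 1 0 1 (-1) (-1)))"
    by (rule gen_ok_lineI[where a = "(YP,1)" and b = "(YP,1)" and c = "(YM,1)" and k = "1/2"],
        simp add: poly_of_simps) (simp_all add: gen_check)
  moreover have "gen_ok YP YP YM (pcomm (yp 1) (yp 2) \<^bold>* ym 1 :: 'a npoly)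
      (mp4 [1,1] [1] [] []) (line (vec6 1 0 (-1) 0 0 0))"
    by (rule gen_ok_lineI[where a = "(YP,1)" and b = "(YP,2)" and c = "(YM,1)" and k = "1"],
        simp add: poly_of_simps) (simp_all add: gen_check)
  moreover have "gen_ok YP YP YM (yp 1 \<^bold>* ym 1 \<^bold>* yp 2 \<^bold>- yp 2 \<^bold>* ym 1 \<^bold>* yp 1 :: 'a npoly)
      (mp4 [1,1] [1] [] []) (line (vec6 0 1 0 (-1) 0 0))"
    by (rule gen_ok_lineI[where a = "(YP,1)" and b = "(YP,2)" and c = "(YM,1)" and k = "1"],
        simp add: poly_of_simps) (simp_all add: gen_check)
  moreover have "gen_ok YP YP YM (ym 1 \<^bold>* pcomm (yp 1) (yp 2) :: 'a npoly)
      (mp4 [1,1] [1] [] []) (line (vec6 0 0 0 0 1 (-1)))"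
    by (rule gen_ok_lineI[where a = "(YP,1)" and b = "(YP,2)" and c = "(YM,1)" and k = "1"],
        simp add: poly_of_simps) (simp_all add: gen_check)
  ultimately have gens: "list_all2 (\<lambda>(f,lam) L. gen_ok YP YP YM f lam (lsp (map snd L))) ?gens ?Ls"
    by (simp only: list_all2_Cons list_all2_Nil list.map prod.case snd_conv lsp_line lsp_plane simp_thms)
  have compl: "\<forall>\<sigma>. vec6 q0 q1 q2 q3 q4 q5 \<sigma> =
      (\<Sum>k<length ?Ls. pr (?Ls ! k) (vec6 q0 q1 q2 q3 q4 q5) \<sigma>)"
    if id: "is_star_id (spec (vec6 q0 q1 q2 q3 q4 q5) (YP,1) (YP,2) (YM,3))"
    for q0 q1 q2 q3 q4 q5 :: 'a
  proof -
    have e1: "q5 = - q0 - q1 - q2 - q3 - q4"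
      by (rule eq_if_star_id[OF id, of 1 1 _ _ 0 1 0 0 1 0 1 0 0])
        (simp_all add: eval_check)
    show ?thesis by (simp add: proj_check e1)
  qed
  show ?thesis
    by (rule decomp_projI[OF _ gens _ compl]) (simp_all add: proj_check fun_eq_iff all_vt tcount_def)
qed

text \<open>The even symmetric variable is scalar on the lower block, so the words fall into two
  classes by the order of the skew variables, and the coefficients of each class must add up to
  zero.\<close>

lemma decomp_1200:
  "decomp (comp4 1 2 0 0)
     [(pcomm (yp 1) (ym 1 \<^bold>* ym 1) :: 'a::field_char_0 npoly, mp4 [1] [2] [] []),
      (ym 1 \<^bold>* pcomm (yp 1) (ym 1), mp4 [1] [2] [] []),
      (pcomm (yp 1) (ym 1 \<^bold>* ym 2 \<^bold>- ym 2 \<^bold>* ym 1), mp4 [1] [1,1] [] []),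
      (ym 1 \<^bold>* pcomm (yp 1) (ym 2) \<^bold>- ym 2 \<^bold>* pcomm (yp 1) (ym 1), mp4 [1] [1,1] [] [])]" (is "decomp ?n ?gens")
proof -
  let ?Ls = "[[(vec6 (1/2) (1/2) 0 0 0 0, vec6 1 1 0 (-1) 0 (-1))],
      [(vec6 0 0 (1/2) 0 (1/2) 0, vec6 0 0 1 (-1) 1 (-1))],
      [(vec6 (1/2) (-1/2) 0 0 0 0, vec6 1 (-1) 0 (-1) 0 1)],
      [(vec6 0 0 (1/2) 0 (-1/2) 0, vec6 0 0 1 (-1) (-1) 1)]]"
  have "gen_ok YP YM YM (pcomm (yp 1) (ym 1 \<^bold>* ym 1) :: 'a npoly)
      (mp4 [1] [2] [] []) (line (vec6 1 1 0 (-1) 0 (-1)))"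
    by (rule gen_ok_lineI[where a = "(YP,1)" and b = "(YM,1)" and c = "(YM,1)" and k = "1/2"],
        simp add: poly_of_simps) (simp_all add: gen_check)
  moreover have "gen_ok YP YM YM (ym 1 \<^bold>* pcomm (yp 1) (ym 1) :: 'a npoly)
      (mp4 [1] [2] [] []) (line (vec6 0 0 1 (-1) 1 (-1)))"
    by (rule gen_ok_lineI[where a = "(YP,1)" and b = "(YM,1)" and c = "(YM,1)" and k = "1/2"],
        simp add: poly_of_simps) (simp_all add: gen_check)
  moreover have "gen_ok YP YM YM (pcomm (yp 1) (ym 1 \<^bold>* ym 2 \<^bold>- ym 2 \<^bold>* ym 1) :: 'a npoly)
      (mp4 [1] [1,1] [] []) (line (vec6 1 (-1) 0 (-1) 0 1))"
    by (rule gen_ok_lineI[where a = "(YP,1)" and b = "(YM,1)" and c = "(YM,2)" and k = "1"],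
        simp add: poly_of_simps) (simp_all add: gen_check)
  moreover have "gen_ok YP YM YM (ym 1 \<^bold>* pcomm (yp 1) (ym 2) \<^bold>- ym 2 \<^bold>* pcomm (yp 1) (ym 1) :: 'a npoly)
      (mp4 [1] [1,1] [] []) (line (vec6 0 0 1 (-1) (-1) 1))"
    by (rule gen_ok_lineI[where a = "(YP,1)" and b = "(YM,1)" and c = "(YM,2)" and k = "1"],
        simp add: poly_of_simps) (simp_all add: gen_check)
  ultimately have gens: "list_all2 (\<lambda>(f,lam) L. gen_ok YP YM YM f lam (lsp (map snd L))) ?gens ?Ls"
    by (simp only: list_all2_Cons list_all2_Nil list.map prod.case snd_conv lsp_line lsp_plane simp_thms)
  have compl: "\<forall>\<sigma>. vec6 q0 q1 q2 q3 q4 q5 \<sigma> =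
      (\<Sum>k<length ?Ls. pr (?Ls ! k) (vec6 q0 q1 q2 q3 q4 q5) \<sigma>)"
    if id: "is_star_id (spec (vec6 q0 q1 q2 q3 q4 q5) (YP,1) (YM,2) (YM,3))"
    for q0 q1 q2 q3 q4 q5 :: 'a
  proof -
    have e1: "q5 = - q1 - q4"
      by (rule eq_if_star_id[OF id, of 2 2 _ _ 0 1 0 0 1 0 0 0 1])
        (simp_all add: eval_check)
    have e2: "q3 = - q0 - q2"
      by (rule eq_if_star_id[OF id, of 1 1 _ _ 0 1 0 0 1 0 0 0 1])
        (simp_all add: eval_check e1)
    show ?thesis by (simp add: proj_check e1 e2)
  qed
  show ?thesis
    by (rule decomp_projI[OF _ gens _ compl]) (simp_all add: proj_check fun_eq_iff all_vt tcount_def)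
qed

text \<open>For y = diag(a,b,b) the first row of a word is the row of z times a1 a2, b1 b2, a1 b2 or
  a2 b1, according to which variables precede z. These four products are independent and give the
  four equations.\<close>

lemma decomp_2010:
  "decomp (comp4 2 0 1 0)
     [(pcomm (yp 1) (yp 2) \<^bold>* zp 1 :: 'a::field_char_0 npoly, mp4 [1,1] [] [1] []),
      (zp 1 \<^bold>* pcomm (yp 1) (yp 2), mp4 [1,1] [] [1] [])]" (is "decomp ?n ?gens")
proof -
  let ?Ls = "[[(vec6 1 0 0 0 0 0, vec6 1 0 (-1) 0 0 0)],
      [(vec6 0 0 0 0 1 0, vec6 0 0 0 0 1 (-1))]]"
  have "gen_ok YP YP ZP (pcomm (yp 1) (yp 2) \<^bold>* zp 1 :: 'a npoly)
      (mp4 [1,1] [] [1] []) (line (vec6 1 0 (-1) 0 0 0))"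
    by (rule gen_ok_lineI[where a = "(YP,1)" and b = "(YP,2)" and c = "(ZP,1)" and k = "1"],
        simp add: poly_of_simps) (simp_all add: gen_check)
  moreover have "gen_ok YP YP ZP (zp 1 \<^bold>* pcomm (yp 1) (yp 2) :: 'a npoly)
      (mp4 [1,1] [] [1] []) (line (vec6 0 0 0 0 1 (-1)))"
    by (rule gen_ok_lineI[where a = "(YP,1)" and b = "(YP,2)" and c = "(ZP,1)" and k = "1"],
        simp add: poly_of_simps) (simp_all add: gen_check)
  ultimately have gens: "list_all2 (\<lambda>(f,lam) L. gen_ok YP YP ZP f lam (lsp (map snd L))) ?gens ?Ls"
    by (simp only: list_all2_Cons list_all2_Nil list.map prod.case snd_conv lsp_line lsp_plane simp_thms)
  have compl: "\<forall>\<sigma>. vec6 q0 q1 q2 q3 q4 q5 \<sigma> =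
      (\<Sum>k<length ?Ls. pr (?Ls ! k) (vec6 q0 q1 q2 q3 q4 q5) \<sigma>)"
    if id: "is_star_id (spec (vec6 q0 q1 q2 q3 q4 q5) (YP,1) (YP,2) (ZP,3))"
    for q0 q1 q2 q3 q4 q5 :: 'a
  proof -
    have e1: "q3 = 0"
      by (rule eq_if_star_id[OF id, of 2 0 _ _ "-1" 0 0 0 1 0 1 0 0])
        (simp_all add: eval_check)
    have e2: "q1 = 0"
      by (rule eq_if_star_id[OF id, of 0 1 _ _ 1 0 0 0 1 0 1 0 0])
        (simp_all add: eval_check e1)
    have e3: "q5 = - q4"
      by (rule eq_if_star_id[OF id, of 2 0 _ _ "-1" 0 0 1 0 0 1 0 0])
        (simp_all add: eval_check e1 e2)
    have e4: "q2 = - q0"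
      by (rule eq_if_star_id[OF id, of 0 1 _ _ 1 0 0 1 0 0 1 0 0])
        (simp_all add: eval_check e1 e2 e3)
    show ?thesis by (simp add: proj_check e1 e2 e3 e4)
  qed
  show ?thesis
    by (rule decomp_projI[OF _ gens _ compl]) (simp_all add: proj_check fun_eq_iff all_vt tcount_def)
qed

lemma decomp_2001:
  "decomp (comp4 2 0 0 1)
     [(pcomm (yp 1) (yp 2) \<^bold>* zm 1 :: 'a::field_char_0 npoly, mp4 [1,1] [] [] [1]),
      (zm 1 \<^bold>* pcomm (yp 1) (yp 2), mp4 [1,1] [] [] [1])]" (is "decomp ?n ?gens")
proof -
  let ?Ls = "[[(vec6 1 0 0 0 0 0, vec6 1 0 (-1) 0 0 0)],
      [(vec6 0 0 0 0 1 0, vec6 0 0 0 0 1 (-1))]]"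
  have "gen_ok YP YP ZM (pcomm (yp 1) (yp 2) \<^bold>* zm 1 :: 'a npoly)
      (mp4 [1,1] [] [] [1]) (line (vec6 1 0 (-1) 0 0 0))"
    by (rule gen_ok_lineI[where a = "(YP,1)" and b = "(YP,2)" and c = "(ZM,1)" and k = "1"],
        simp add: poly_of_simps) (simp_all add: gen_check)
  moreover have "gen_ok YP YP ZM (zm 1 \<^bold>* pcomm (yp 1) (yp 2) :: 'a npoly)
      (mp4 [1,1] [] [] [1]) (line (vec6 0 0 0 0 1 (-1)))"
    by (rule gen_ok_lineI[where a = "(YP,1)" and b = "(YP,2)" and c = "(ZM,1)" and k = "1"],
        simp add: poly_of_simps) (simp_all add: gen_check)
  ultimately have gens: "list_all2 (\<lambda>(f,lam) L. gen_ok YP YP ZM f lam (lsp (map snd L))) ?gens ?Ls"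
    by (simp only: list_all2_Cons list_all2_Nil list.map prod.case snd_conv lsp_line lsp_plane simp_thms)
  have compl: "\<forall>\<sigma>. vec6 q0 q1 q2 q3 q4 q5 \<sigma> =
      (\<Sum>k<length ?Ls. pr (?Ls ! k) (vec6 q0 q1 q2 q3 q4 q5) \<sigma>)"
    if id: "is_star_id (spec (vec6 q0 q1 q2 q3 q4 q5) (YP,1) (YP,2) (ZM,3))"
    for q0 q1 q2 q3 q4 q5 :: 'a
  proof -
    have e1: "q3 = 0"
      by (rule eq_if_star_id[OF id, of 2 0 _ _ 1 0 0 0 1 0 1 0 0])
        (simp_all add: eval_check)
    have e2: "q1 = 0"
      by (rule eq_if_star_id[OF id, of 0 1 _ _ 1 0 0 0 1 0 1 0 0])
        (simp_all add: eval_check e1)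
    have e3: "q5 = - q4"
      by (rule eq_if_star_id[OF id, of 2 0 _ _ 1 0 0 1 0 0 1 0 0])
        (simp_all add: eval_check e1 e2)
    have e4: "q2 = - q0"
      by (rule eq_if_star_id[OF id, of 0 1 _ _ 1 0 0 1 0 0 1 0 0])
        (simp_all add: eval_check e1 e2 e3)
    show ?thesis by (simp add: proj_check e1 e2 e3 e4)
  qed
  show ?thesis
    by (rule decomp_projI[OF _ gens _ compl]) (simp_all add: proj_check fun_eq_iff all_vt tcount_def)
qed

lemma decomp_1110:
  "decomp (comp4 1 1 1 0)
     [(pcomm (yp 1) (ym 1) \<^bold>* zp 1 :: 'a::field_char_0 npoly, mp4 [1] [1] [1] []),
      (zp 1 \<^bold>* pcomm (yp 1) (ym 1), mp4 [1] [1] [1] [])]" (is "decomp ?n ?gens")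
proof -
  let ?Ls = "[[(vec6 1 0 0 0 0 0, vec6 1 0 (-1) 0 0 0)],
      [(vec6 0 0 0 0 1 0, vec6 0 0 0 0 1 (-1))]]"
  have "gen_ok YP YM ZP (pcomm (yp 1) (ym 1) \<^bold>* zp 1 :: 'a npoly)
      (mp4 [1] [1] [1] []) (line (vec6 1 0 (-1) 0 0 0))"
    by (rule gen_ok_lineI[where a = "(YP,1)" and b = "(YM,1)" and c = "(ZP,1)" and k = "1"],
        simp add: poly_of_simps) (simp_all add: gen_check)
  moreover have "gen_ok YP YM ZP (zp 1 \<^bold>* pcomm (yp 1) (ym 1) :: 'a npoly)
      (mp4 [1] [1] [1] []) (line (vec6 0 0 0 0 1 (-1)))"
    by (rule gen_ok_lineI[where a = "(YP,1)" and b = "(YM,1)" and c = "(ZP,1)" and k = "1"],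
        simp add: poly_of_simps) (simp_all add: gen_check)
  ultimately have gens: "list_all2 (\<lambda>(f,lam) L. gen_ok YP YM ZP f lam (lsp (map snd L))) ?gens ?Ls"
    by (simp only: list_all2_Cons list_all2_Nil list.map prod.case snd_conv lsp_line lsp_plane simp_thms)
  have compl: "\<forall>\<sigma>. vec6 q0 q1 q2 q3 q4 q5 \<sigma> =
      (\<Sum>k<length ?Ls. pr (?Ls ! k) (vec6 q0 q1 q2 q3 q4 q5) \<sigma>)"
    if id: "is_star_id (spec (vec6 q0 q1 q2 q3 q4 q5) (YP,1) (YM,2) (ZP,3))"
    for q0 q1 q2 q3 q4 q5 :: 'a
  proof -
    have e1: "q3 = 0"
      by (rule eq_if_star_id[OF id, of 2 0 _ _ 1 0 0 1 0 0 1 0 0])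
        (simp_all add: eval_check)
    have e2: "q1 = 0"
      by (rule eq_if_star_id[OF id, of 0 1 _ _ 1 0 0 1 0 0 1 0 0])
        (simp_all add: eval_check e1)
    have e3: "q5 = - q4"
      by (rule eq_if_star_id[OF id, of 0 1 _ _ 0 1 0 1 0 0 1 0 0])
        (simp_all add: eval_check e1 e2)
    have e4: "q2 = - q0"
      by (rule eq_if_star_id[OF id, of 2 0 _ _ 0 1 0 1 0 0 1 0 0])
        (simp_all add: eval_check e1 e2 e3)
    show ?thesis by (simp add: proj_check e1 e2 e3 e4)
  qed
  show ?thesis
    by (rule decomp_projI[OF _ gens _ compl]) (simp_all add: proj_check fun_eq_iff all_vt tcount_def)
qed

lemma decomp_1101:
  "decomp (comp4 1 1 0 1)
     [(pcomm (yp 1) (ym 1) \<^bold>* zm 1 :: 'a::field_char_0 npoly, mp4 [1] [1] [] [1]),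
      (zm 1 \<^bold>* pcomm (yp 1) (ym 1), mp4 [1] [1] [] [1])]" (is "decomp ?n ?gens")
proof -
  let ?Ls = "[[(vec6 1 0 0 0 0 0, vec6 1 0 (-1) 0 0 0)],
      [(vec6 0 0 0 0 1 0, vec6 0 0 0 0 1 (-1))]]"
  have "gen_ok YP YM ZM (pcomm (yp 1) (ym 1) \<^bold>* zm 1 :: 'a npoly)
      (mp4 [1] [1] [] [1]) (line (vec6 1 0 (-1) 0 0 0))"
    by (rule gen_ok_lineI[where a = "(YP,1)" and b = "(YM,1)" and c = "(ZM,1)" and k = "1"],
        simp add: poly_of_simps) (simp_all add: gen_check)
  moreover have "gen_ok YP YM ZM (zm 1 \<^bold>* pcomm (yp 1) (ym 1) :: 'a npoly)
      (mp4 [1] [1] [] [1]) (line (vec6 0 0 0 0 1 (-1)))"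
    by (rule gen_ok_lineI[where a = "(YP,1)" and b = "(YM,1)" and c = "(ZM,1)" and k = "1"],
        simp add: poly_of_simps) (simp_all add: gen_check)
  ultimately have gens: "list_all2 (\<lambda>(f,lam) L. gen_ok YP YM ZM f lam (lsp (map snd L))) ?gens ?Ls"
    by (simp only: list_all2_Cons list_all2_Nil list.map prod.case snd_conv lsp_line lsp_plane simp_thms)
  have compl: "\<forall>\<sigma>. vec6 q0 q1 q2 q3 q4 q5 \<sigma> =
      (\<Sum>k<length ?Ls. pr (?Ls ! k) (vec6 q0 q1 q2 q3 q4 q5) \<sigma>)"
    if id: "is_star_id (spec (vec6 q0 q1 q2 q3 q4 q5) (YP,1) (YM,2) (ZM,3))"
    for q0 q1 q2 q3 q4 q5 :: 'a
  proof -
    have e1: "q3 = 0"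
      by (rule eq_if_star_id[OF id, of 2 0 _ _ "-1" 0 0 1 0 0 1 0 0])
        (simp_all add: eval_check)
    have e2: "q1 = 0"
      by (rule eq_if_star_id[OF id, of 0 1 _ _ 1 0 0 1 0 0 1 0 0])
        (simp_all add: eval_check e1)
    have e3: "q5 = - q4"
      by (rule eq_if_star_id[OF id, of 0 1 _ _ 0 1 0 1 0 0 1 0 0])
        (simp_all add: eval_check e1 e2)
    have e4: "q2 = - q0"
      by (rule eq_if_star_id[OF id, of 2 0 _ _ 0 "-1" 0 1 0 0 1 0 0])
        (simp_all add: eval_check e1 e2 e3)
    show ?thesis by (simp add: proj_check e1 e2 e3 e4)
  qed
  show ?thesis
    by (rule decomp_projI[OF _ gens _ compl]) (simp_all add: proj_check fun_eq_iff all_vt tcount_def)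
qed

text \<open>A product of two odd matrices is even and thus commutes with diag(a,b,b). The words with
  y in the middle must have coefficient zero.\<close>

lemma decomp_1020:
  "decomp (comp4 1 0 2 0)
     [(pcomm (yp 1) (zp 1 \<^bold>* zp 1) :: 'a::field_char_0 npoly, mp4 [1] [] [2] []),
      (pcomm (yp 1) (zp 1 \<^bold>* zp 2 \<^bold>- zp 2 \<^bold>* zp 1), mp4 [1] [] [1,1] [])]" (is "decomp ?n ?gens")
proof -
  let ?Ls = "[[(vec6 (1/2) (1/2) 0 0 0 0, vec6 1 1 0 (-1) 0 (-1))],
      [(vec6 (1/2) (-1/2) 0 0 0 0, vec6 1 (-1) 0 (-1) 0 1)]]"
  have "gen_ok YP ZP ZP (pcomm (yp 1) (zp 1 \<^bold>* zp 1) :: 'a npoly)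
      (mp4 [1] [] [2] []) (line (vec6 1 1 0 (-1) 0 (-1)))"
    by (rule gen_ok_lineI[where a = "(YP,1)" and b = "(ZP,1)" and c = "(ZP,1)" and k = "1/2"],
        simp add: poly_of_simps) (simp_all add: gen_check)
  moreover have "gen_ok YP ZP ZP (pcomm (yp 1) (zp 1 \<^bold>* zp 2 \<^bold>- zp 2 \<^bold>* zp 1) :: 'a npoly)
      (mp4 [1] [] [1,1] []) (line (vec6 1 (-1) 0 (-1) 0 1))"
    by (rule gen_ok_lineI[where a = "(YP,1)" and b = "(ZP,1)" and c = "(ZP,2)" and k = "1"],
        simp add: poly_of_simps) (simp_all add: gen_check)
  ultimately have gens: "list_all2 (\<lambda>(f,lam) L. gen_ok YP ZP ZP f lam (lsp (map snd L))) ?gens ?Ls"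
    by (simp only: list_all2_Cons list_all2_Nil list.map prod.case snd_conv lsp_line lsp_plane simp_thms)
  have compl: "\<forall>\<sigma>. vec6 q0 q1 q2 q3 q4 q5 \<sigma> =
      (\<Sum>k<length ?Ls. pr (?Ls ! k) (vec6 q0 q1 q2 q3 q4 q5) \<sigma>)"
    if id: "is_star_id (spec (vec6 q0 q1 q2 q3 q4 q5) (YP,1) (ZP,2) (ZP,3))"
    for q0 q1 q2 q3 q4 q5 :: 'a
  proof -
    have e1: "q4 = 0"
      by (rule eq_if_star_id[OF id, of 1 1 _ _ 1 0 0 1 0 0 0 1 0])
        (simp_all add: eval_check)
    have e2: "q2 = 0"
      by (rule eq_if_star_id[OF id, of 2 2 _ _ "-1" 0 0 1 0 0 0 1 0])
        (simp_all add: eval_check e1)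
    have e3: "q5 = - q1"
      by (rule eq_if_star_id[OF id, of 1 1 _ _ 0 1 0 1 0 0 0 1 0])
        (simp_all add: eval_check e1 e2)
    have e4: "q3 = - q0"
      by (rule eq_if_star_id[OF id, of 2 2 _ _ 0 "-1" 0 1 0 0 0 1 0])
        (simp_all add: eval_check e1 e2 e3)
    show ?thesis by (simp add: proj_check e1 e2 e3 e4)
  qed
  show ?thesis
    by (rule decomp_projI[OF _ gens _ compl]) (simp_all add: proj_check fun_eq_iff all_vt tcount_def)
qed

lemma decomp_1002:
  "decomp (comp4 1 0 0 2)
     [(pcomm (yp 1) (zm 1 \<^bold>* zm 1) :: 'a::field_char_0 npoly, mp4 [1] [] [] [2]),
      (pcomm (yp 1) (zm 1 \<^bold>* zm 2 \<^bold>- zm 2 \<^bold>* zm 1), mp4 [1] [] [] [1,1])]" (is "decomp ?n ?gens")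
proof -
  let ?Ls = "[[(vec6 (1/2) (1/2) 0 0 0 0, vec6 1 1 0 (-1) 0 (-1))],
      [(vec6 (1/2) (-1/2) 0 0 0 0, vec6 1 (-1) 0 (-1) 0 1)]]"
  have "gen_ok YP ZM ZM (pcomm (yp 1) (zm 1 \<^bold>* zm 1) :: 'a npoly)
      (mp4 [1] [] [] [2]) (line (vec6 1 1 0 (-1) 0 (-1)))"
    by (rule gen_ok_lineI[where a = "(YP,1)" and b = "(ZM,1)" and c = "(ZM,1)" and k = "1/2"],
        simp add: poly_of_simps) (simp_all add: gen_check)
  moreover have "gen_ok YP ZM ZM (pcomm (yp 1) (zm 1 \<^bold>* zm 2 \<^bold>- zm 2 \<^bold>* zm 1) :: 'a npoly)
      (mp4 [1] [] [] [1,1]) (line (vec6 1 (-1) 0 (-1) 0 1))"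
    by (rule gen_ok_lineI[where a = "(YP,1)" and b = "(ZM,1)" and c = "(ZM,2)" and k = "1"],
        simp add: poly_of_simps) (simp_all add: gen_check)
  ultimately have gens: "list_all2 (\<lambda>(f,lam) L. gen_ok YP ZM ZM f lam (lsp (map snd L))) ?gens ?Ls"
    by (simp only: list_all2_Cons list_all2_Nil list.map prod.case snd_conv lsp_line lsp_plane simp_thms)
  have compl: "\<forall>\<sigma>. vec6 q0 q1 q2 q3 q4 q5 \<sigma> =
      (\<Sum>k<length ?Ls. pr (?Ls ! k) (vec6 q0 q1 q2 q3 q4 q5) \<sigma>)"
    if id: "is_star_id (spec (vec6 q0 q1 q2 q3 q4 q5) (YP,1) (ZM,2) (ZM,3))"
    for q0 q1 q2 q3 q4 q5 :: 'a
  proof -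
    have e1: "q4 = 0"
      by (rule eq_if_star_id[OF id, of 1 1 _ _ "-1" 0 0 1 0 0 0 1 0])
        (simp_all add: eval_check)
    have e2: "q2 = 0"
      by (rule eq_if_star_id[OF id, of 2 2 _ _ 1 0 0 1 0 0 0 1 0])
        (simp_all add: eval_check e1)
    have e3: "q5 = - q1"
      by (rule eq_if_star_id[OF id, of 1 1 _ _ 0 "-1" 0 1 0 0 0 1 0])
        (simp_all add: eval_check e1 e2)
    have e4: "q3 = - q0"
      by (rule eq_if_star_id[OF id, of 2 2 _ _ 0 1 0 1 0 0 0 1 0])
        (simp_all add: eval_check e1 e2 e3)
    show ?thesis by (simp add: proj_check e1 e2 e3 e4)
  qed
  show ?thesis
    by (rule decomp_projI[OF _ gens _ compl]) (simp_all add: proj_check fun_eq_iff all_vt tcount_def)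
qed

lemma decomp_1011:
  "decomp (comp4 1 0 1 1)
     [(pcomm (yp 1) (zp 1 \<^bold>* zm 1) :: 'a::field_char_0 npoly, mp4 [1] [] [1] [1]),
      (pcomm (yp 1) (zm 1 \<^bold>* zp 1), mp4 [1] [] [1] [1])]" (is "decomp ?n ?gens")
proof -
  let ?Ls = "[[(vec6 1 0 0 0 0 0, vec6 1 0 0 (-1) 0 0)],
      [(vec6 0 1 0 0 0 0, vec6 0 1 0 0 0 (-1))]]"
  have "gen_ok YP ZP ZM (pcomm (yp 1) (zp 1 \<^bold>* zm 1) :: 'a npoly)
      (mp4 [1] [] [1] [1]) (line (vec6 1 0 0 (-1) 0 0))"
    by (rule gen_ok_lineI[where a = "(YP,1)" and b = "(ZP,1)" and c = "(ZM,1)" and k = "1"],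
        simp add: poly_of_simps) (simp_all add: gen_check)
  moreover have "gen_ok YP ZP ZM (pcomm (yp 1) (zm 1 \<^bold>* zp 1) :: 'a npoly)
      (mp4 [1] [] [1] [1]) (line (vec6 0 1 0 0 0 (-1)))"
    by (rule gen_ok_lineI[where a = "(YP,1)" and b = "(ZP,1)" and c = "(ZM,1)" and k = "1"],
        simp add: poly_of_simps) (simp_all add: gen_check)
  ultimately have gens: "list_all2 (\<lambda>(f,lam) L. gen_ok YP ZP ZM f lam (lsp (map snd L))) ?gens ?Ls"
    by (simp only: list_all2_Cons list_all2_Nil list.map prod.case snd_conv lsp_line lsp_plane simp_thms)
  have compl: "\<forall>\<sigma>. vec6 q0 q1 q2 q3 q4 q5 \<sigma> =
      (\<Sum>k<length ?Ls. pr (?Ls ! k) (vec6 q0 q1 q2 q3 q4 q5) \<sigma>)"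
    if id: "is_star_id (spec (vec6 q0 q1 q2 q3 q4 q5) (YP,1) (ZP,2) (ZM,3))"
    for q0 q1 q2 q3 q4 q5 :: 'a
  proof -
    have e1: "q4 = 0"
      by (rule eq_if_star_id[OF id, of 1 1 _ _ "-1" 0 0 1 0 0 0 1 0])
        (simp_all add: eval_check)
    have e2: "q2 = 0"
      by (rule eq_if_star_id[OF id, of 2 2 _ _ "-1" 0 0 1 0 0 0 1 0])
        (simp_all add: eval_check e1)
    have e3: "q5 = - q1"
      by (rule eq_if_star_id[OF id, of 1 1 _ _ 0 "-1" 0 1 0 0 0 1 0])
        (simp_all add: eval_check e1 e2)
    have e4: "q3 = - q0"
      by (rule eq_if_star_id[OF id, of 2 2 _ _ 0 "-1" 0 1 0 0 0 1 0])
        (simp_all add: eval_check e1 e2 e3)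
    show ?thesis by (simp add: proj_check e1 e2 e3 e4)
  qed
  show ?thesis
    by (rule decomp_projI[OF _ gens _ compl]) (simp_all add: proj_check fun_eq_iff all_vt tcount_def)
qed

text \<open>Let J have rows (0,1), (-1,0). An odd symmetric matrix has a row r next to the corner
  and the column J r^T below it. Since r J r^T = 0, its cube vanishes; \<open>St3\<close> vanishes
  because it is alternating on a two-dimensional space.\<close>

lemma decomp_0030:
  "decomp (comp4 0 0 3 0)
     [(zp 1 \<^bold>* zp 1 \<^bold>* zp 1 :: 'a::field_char_0 npoly, mp4 [] [] [3] []),
      (St3 (zp 1) (zp 2) (zp 3), mp4 [] [] [1,1,1] [])]" (is "decomp ?n ?gens")
proof -
  let ?Ls = "[[(vec6 (1/2) (1/2) 0 0 0 0, vec6 1 1 1 1 1 1)],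
      [(vec6 (1/2) (-1/2) 0 0 0 0, vec6 1 (-1) (-1) 1 1 (-1))]]"
  have "gen_ok ZP ZP ZP (zp 1 \<^bold>* zp 1 \<^bold>* zp 1 :: 'a npoly)
      (mp4 [] [] [3] []) (line (vec6 1 1 1 1 1 1))"
    by (rule gen_ok_lineI[where a = "(ZP,1)" and b = "(ZP,1)" and c = "(ZP,1)" and k = "1/6"],
        simp add: poly_of_simps) (simp_all add: gen_check)
  moreover have "gen_ok ZP ZP ZP (St3 (zp 1) (zp 2) (zp 3) :: 'a npoly)
      (mp4 [] [] [1,1,1] []) (line (vec6 1 (-1) (-1) 1 1 (-1)))"
    by (rule gen_ok_lineI[where a = "(ZP,1)" and b = "(ZP,2)" and c = "(ZP,3)" and k = "1"],
        simp add: poly_of_simps) (simp_all add: gen_check)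
  ultimately have gens: "list_all2 (\<lambda>(f,lam) L. gen_ok ZP ZP ZP f lam (lsp (map snd L))) ?gens ?Ls"
    by (simp only: list_all2_Cons list_all2_Nil list.map prod.case snd_conv lsp_line lsp_plane simp_thms)
  have compl: "\<forall>\<sigma>. vec6 q0 q1 q2 q3 q4 q5 \<sigma> =
      (\<Sum>k<length ?Ls. pr (?Ls ! k) (vec6 q0 q1 q2 q3 q4 q5) \<sigma>)"
    if id: "is_star_id (spec (vec6 q0 q1 q2 q3 q4 q5) (ZP,1) (ZP,2) (ZP,3))"
    for q0 q1 q2 q3 q4 q5 :: 'a
  proof -
    have e1: "q5 = q1 + q3 - q4"
      by (rule eq_if_star_id[OF id, of 0 1 _ _ "-1" 0 0 1 0 0 0 1 0])
        (simp_all add: eval_check)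
    have e2: "q3 = - q0 + 2 * q4"
      by (rule eq_if_star_id[OF id, of 2 0 _ _ 1 0 0 0 1 0 1 0 0])
        (simp_all add: eval_check e1)
    have e3: "q4 = q0 + q1 - q2"
      by (rule eq_if_star_id[OF id, of 0 1 _ _ "-1" 0 0 0 1 0 1 0 0])
        (simp_all add: eval_check e1 e2)
    \<comment> \<open>With the parameter 1 in place of -1/3 this entry would be -3 (q2 - q1) after
      the earlier eliminations.\<close>
    have e4: "q2 = q1"
      by (rule eq_if_star_id[OF id, of 2 0 _ _ "-1/3" 0 0 1 0 0 0 1 0])
        (simp_all add: eval_check e1 e2 e3)
    show ?thesis by (simp add: proj_check e1 e2 e3 e4)
  qed
  show ?thesis
    by (rule decomp_projI[OF _ gens _ compl]) (simp_all add: proj_check fun_eq_iff all_vt tcount_def)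
qed

text \<open>Put D = diag(1,-1,-1). It anticommutes with odd matrices, and z \<mapsto> D z carries
  the odd symmetric part onto the odd skew part. Substituting D s_i for the variables multiplies all
  six words by the same factor - D, so the identities are those of the odd symmetric case.\<close>

lemma decomp_0003:
  "decomp (comp4 0 0 0 3)
     [(zm 1 \<^bold>* zm 1 \<^bold>* zm 1 :: 'a::field_char_0 npoly, mp4 [] [] [] [3]),
      (St3 (zm 1) (zm 2) (zm 3), mp4 [] [] [] [1,1,1])]" (is "decomp ?n ?gens")
proof -
  let ?Ls = "[[(vec6 (1/2) (1/2) 0 0 0 0, vec6 1 1 1 1 1 1)],
      [(vec6 (1/2) (-1/2) 0 0 0 0, vec6 1 (-1) (-1) 1 1 (-1))]]"
  have "gen_ok ZM ZM ZM (zm 1 \<^bold>* zm 1 \<^bold>* zm 1 :: 'a npoly)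
      (mp4 [] [] [] [3]) (line (vec6 1 1 1 1 1 1))"
    by (rule gen_ok_lineI[where a = "(ZM,1)" and b = "(ZM,1)" and c = "(ZM,1)" and k = "1/6"],
        simp add: poly_of_simps) (simp_all add: gen_check)
  moreover have "gen_ok ZM ZM ZM (St3 (zm 1) (zm 2) (zm 3) :: 'a npoly)
      (mp4 [] [] [] [1,1,1]) (line (vec6 1 (-1) (-1) 1 1 (-1)))"
    by (rule gen_ok_lineI[where a = "(ZM,1)" and b = "(ZM,2)" and c = "(ZM,3)" and k = "1"],
        simp add: poly_of_simps) (simp_all add: gen_check)
  ultimately have gens: "list_all2 (\<lambda>(f,lam) L. gen_ok ZM ZM ZM f lam (lsp (map snd L))) ?gens ?Ls"
    by (simp only: list_all2_Cons list_all2_Nil list.map prod.case snd_conv lsp_line lsp_plane simp_thms)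
  have compl: "\<forall>\<sigma>. vec6 q0 q1 q2 q3 q4 q5 \<sigma> =
      (\<Sum>k<length ?Ls. pr (?Ls ! k) (vec6 q0 q1 q2 q3 q4 q5) \<sigma>)"
    if id: "is_star_id (spec (vec6 q0 q1 q2 q3 q4 q5) (ZM,1) (ZM,2) (ZM,3))"
    for q0 q1 q2 q3 q4 q5 :: 'a
  proof -
    have e1: "q5 = q1 + q3 - q4"
      by (rule eq_if_star_id[OF id, of 0 1 _ _ 1 0 0 1 0 0 0 1 0])
        (simp_all add: eval_check)
    have e2: "q3 = - q0 + 2 * q4"
      by (rule eq_if_star_id[OF id, of 2 0 _ _ 1 0 0 0 1 0 1 0 0])
        (simp_all add: eval_check e1)
    have e3: "q4 = q0 + q1 - q2"
      by (rule eq_if_star_id[OF id, of 0 1 _ _ 1 0 0 0 1 0 1 0 0])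
        (simp_all add: eval_check e1 e2)
    have e4: "q2 = q1"
      by (rule eq_if_star_id[OF id, of 2 0 _ _ "-1/3" 0 0 1 0 0 0 1 0])
        (simp_all add: eval_check e1 e2 e3)
    show ?thesis by (simp add: proj_check e1 e2 e3 e4)
  qed
  show ?thesis
    by (rule decomp_projI[OF _ gens _ compl]) (simp_all add: proj_check fun_eq_iff all_vt tcount_def)
qed

text \<open>An odd matrix has zero lower block, so it vanishes between two even skew matrices. The
  other four words carry independent conditions.\<close>

lemma decomp_0210:
  "decomp (comp4 0 2 1 0)
     [(ym 1 \<^bold>* zp 1 \<^bold>* ym 1 :: 'a::field_char_0 npoly, mp4 [] [2] [1] []),
      (ym 1 \<^bold>* zp 1 \<^bold>* ym 2 \<^bold>- ym 2 \<^bold>* zp 1 \<^bold>* ym 1, mp4 [] [1,1] [1] [])]" (is "decomp ?n ?gens")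
proof -
  let ?Ls = "[[(vec6 0 (1/2) 0 (1/2) 0 0, vec6 0 1 0 1 0 0)],
      [(vec6 0 (1/2) 0 (-1/2) 0 0, vec6 0 1 0 (-1) 0 0)]]"
  have "gen_ok YM YM ZP (ym 1 \<^bold>* zp 1 \<^bold>* ym 1 :: 'a npoly)
      (mp4 [] [2] [1] []) (line (vec6 0 1 0 1 0 0))"
    by (rule gen_ok_lineI[where a = "(YM,1)" and b = "(YM,1)" and c = "(ZP,1)" and k = "1/2"],
        simp add: poly_of_simps) (simp_all add: gen_check)
  moreover have "gen_ok YM YM ZP (ym 1 \<^bold>* zp 1 \<^bold>* ym 2 \<^bold>- ym 2 \<^bold>* zp 1 \<^bold>* ym 1 :: 'a npoly)
      (mp4 [] [1,1] [1] []) (line (vec6 0 1 0 (-1) 0 0))"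
    by (rule gen_ok_lineI[where a = "(YM,1)" and b = "(YM,2)" and c = "(ZP,1)" and k = "1"],
        simp add: poly_of_simps) (simp_all add: gen_check)
  ultimately have gens: "list_all2 (\<lambda>(f,lam) L. gen_ok YM YM ZP f lam (lsp (map snd L))) ?gens ?Ls"
    by (simp only: list_all2_Cons list_all2_Nil list.map prod.case snd_conv lsp_line lsp_plane simp_thms)
  have compl: "\<forall>\<sigma>. vec6 q0 q1 q2 q3 q4 q5 \<sigma> =
      (\<Sum>k<length ?Ls. pr (?Ls ! k) (vec6 q0 q1 q2 q3 q4 q5) \<sigma>)"
    if id: "is_star_id (spec (vec6 q0 q1 q2 q3 q4 q5) (YM,1) (YM,2) (ZP,3))"
    for q0 q1 q2 q3 q4 q5 :: 'a
  proof -
    have e1: "q5 = 0"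
      by (rule eq_if_star_id[OF id, of 0 2 _ _ 0 1 0 0 0 1 0 1 0])
        (simp_all add: eval_check)
    have e2: "q4 = 0"
      by (rule eq_if_star_id[OF id, of 0 1 _ _ 0 1 0 0 0 1 1 0 0])
        (simp_all add: eval_check e1)
    have e3: "q2 = 0"
      by (rule eq_if_star_id[OF id, of 2 0 _ _ 0 "-1" 0 0 0 1 1 0 0])
        (simp_all add: eval_check e1 e2)
    have e4: "q0 = 0"
      by (rule eq_if_star_id[OF id, of 1 0 _ _ 0 1 0 0 0 1 0 1 0])
        (simp_all add: eval_check e1 e2 e3)
    show ?thesis by (simp add: proj_check e1 e2 e3 e4)
  qed
  show ?thesis
    by (rule decomp_projI[OF _ gens _ compl]) (simp_all add: proj_check fun_eq_iff all_vt tcount_def)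
qed

lemma decomp_0201:
  "decomp (comp4 0 2 0 1)
     [(ym 1 \<^bold>* zm 1 \<^bold>* ym 1 :: 'a::field_char_0 npoly, mp4 [] [2] [] [1]),
      (ym 1 \<^bold>* zm 1 \<^bold>* ym 2 \<^bold>- ym 2 \<^bold>* zm 1 \<^bold>* ym 1, mp4 [] [1,1] [] [1])]" (is "decomp ?n ?gens")
proof -
  let ?Ls = "[[(vec6 0 (1/2) 0 (1/2) 0 0, vec6 0 1 0 1 0 0)],
      [(vec6 0 (1/2) 0 (-1/2) 0 0, vec6 0 1 0 (-1) 0 0)]]"
  have "gen_ok YM YM ZM (ym 1 \<^bold>* zm 1 \<^bold>* ym 1 :: 'a npoly)
      (mp4 [] [2] [] [1]) (line (vec6 0 1 0 1 0 0))"
    by (rule gen_ok_lineI[where a = "(YM,1)" and b = "(YM,1)" and c = "(ZM,1)" and k = "1/2"],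
        simp add: poly_of_simps) (simp_all add: gen_check)
  moreover have "gen_ok YM YM ZM (ym 1 \<^bold>* zm 1 \<^bold>* ym 2 \<^bold>- ym 2 \<^bold>* zm 1 \<^bold>* ym 1 :: 'a npoly)
      (mp4 [] [1,1] [] [1]) (line (vec6 0 1 0 (-1) 0 0))"
    by (rule gen_ok_lineI[where a = "(YM,1)" and b = "(YM,2)" and c = "(ZM,1)" and k = "1"],
        simp add: poly_of_simps) (simp_all add: gen_check)
  ultimately have gens: "list_all2 (\<lambda>(f,lam) L. gen_ok YM YM ZM f lam (lsp (map snd L))) ?gens ?Ls"
    by (simp only: list_all2_Cons list_all2_Nil list.map prod.case snd_conv lsp_line lsp_plane simp_thms)
  have compl: "\<forall>\<sigma>. vec6 q0 q1 q2 q3 q4 q5 \<sigma> =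
      (\<Sum>k<length ?Ls. pr (?Ls ! k) (vec6 q0 q1 q2 q3 q4 q5) \<sigma>)"
    if id: "is_star_id (spec (vec6 q0 q1 q2 q3 q4 q5) (YM,1) (YM,2) (ZM,3))"
    for q0 q1 q2 q3 q4 q5 :: 'a
  proof -
    have e1: "q5 = 0"
      by (rule eq_if_star_id[OF id, of 0 2 _ _ 0 1 0 0 0 1 0 1 0])
        (simp_all add: eval_check)
    have e2: "q4 = 0"
      by (rule eq_if_star_id[OF id, of 0 1 _ _ 0 1 0 0 0 1 1 0 0])
        (simp_all add: eval_check e1)
    have e3: "q2 = 0"
      by (rule eq_if_star_id[OF id, of 2 0 _ _ 0 1 0 0 0 1 1 0 0])
        (simp_all add: eval_check e1 e2)
    have e4: "q0 = 0"
      by (rule eq_if_star_id[OF id, of 1 0 _ _ 0 "-1" 0 0 0 1 0 1 0])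
        (simp_all add: eval_check e1 e2 e3)
    show ?thesis by (simp add: proj_check e1 e2 e3 e4)
  qed
  show ?thesis
    by (rule decomp_projI[OF _ gens _ compl]) (simp_all add: proj_check fun_eq_iff all_vt tcount_def)
qed

text \<open>With rows r, r' and columns J r^T, J r'^T as for odd symmetric matrices, z y z' has the
  single entry r y J r'^T, symmetric in z and z' because y J is symmetric for traceless y. On the
  lower block z z' - z' z is J times a skew matrix, hence scalar and commuting with y.\<close>

lemma decomp_0120:
  "decomp (comp4 0 1 2 0)
     [(zp 1 \<^bold>* ym 1 \<^bold>* zp 2 \<^bold>- zp 2 \<^bold>* ym 1 \<^bold>* zp 1 :: 'a::field_char_0 npoly, mp4 [] [1] [1,1] []),
      (pcomm (ym 1) (zp 1 \<^bold>* zp 2 \<^bold>- zp 2 \<^bold>* zp 1), mp4 [] [1] [1,1] [])]" (is "decomp ?n ?gens")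
proof -
  let ?Ls = "[[(vec6 0 0 1 0 0 0, vec6 0 0 1 0 (-1) 0)],
      [(vec6 1 0 0 0 0 0, vec6 1 (-1) 0 (-1) 0 1)]]"
  have "gen_ok YM ZP ZP (zp 1 \<^bold>* ym 1 \<^bold>* zp 2 \<^bold>- zp 2 \<^bold>* ym 1 \<^bold>* zp 1 :: 'a npoly)
      (mp4 [] [1] [1,1] []) (line (vec6 0 0 1 0 (-1) 0))"
    by (rule gen_ok_lineI[where a = "(YM,1)" and b = "(ZP,1)" and c = "(ZP,2)" and k = "1"],
        simp add: poly_of_simps) (simp_all add: gen_check)
  moreover have "gen_ok YM ZP ZP (pcomm (ym 1) (zp 1 \<^bold>* zp 2 \<^bold>- zp 2 \<^bold>* zp 1) :: 'a npoly)
      (mp4 [] [1] [1,1] []) (line (vec6 1 (-1) 0 (-1) 0 1))"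
    by (rule gen_ok_lineI[where a = "(YM,1)" and b = "(ZP,1)" and c = "(ZP,2)" and k = "1"],
        simp add: poly_of_simps) (simp_all add: gen_check)
  ultimately have gens: "list_all2 (\<lambda>(f,lam) L. gen_ok YM ZP ZP f lam (lsp (map snd L))) ?gens ?Ls"
    by (simp only: list_all2_Cons list_all2_Nil list.map prod.case snd_conv lsp_line lsp_plane simp_thms)
  have compl: "\<forall>\<sigma>. vec6 q0 q1 q2 q3 q4 q5 \<sigma> =
      (\<Sum>k<length ?Ls. pr (?Ls ! k) (vec6 q0 q1 q2 q3 q4 q5) \<sigma>)"
    if id: "is_star_id (spec (vec6 q0 q1 q2 q3 q4 q5) (YM,1) (ZP,2) (ZP,3))"
    for q0 q1 q2 q3 q4 q5 :: 'a
  proof -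
    have e1: "q5 = - q1"
      by (rule eq_if_star_id[OF id, of 1 1 _ _ 1 0 0 1 0 0 0 1 0])
        (simp_all add: eval_check)
    have e2: "q4 = - q2"
      by (rule eq_if_star_id[OF id, of 0 0 _ _ 1 0 0 1 0 0 0 1 0])
        (simp_all add: eval_check e1)
    have e3: "q3 = - q0"
      by (rule eq_if_star_id[OF id, of 2 2 _ _ 1 0 0 1 0 0 0 1 0])
        (simp_all add: eval_check e1 e2)
    have e4: "q1 = - q0"
      by (rule eq_if_star_id[OF id, of 1 1 _ _ 0 "-1" 0 1 0 0 1 0 0])
        (simp_all add: eval_check e1 e2 e3)
    show ?thesis by (simp add: proj_check e1 e2 e3 e4)
  qed
  show ?thesis
    by (rule decomp_projI[OF _ gens _ compl]) (simp_all add: proj_check fun_eq_iff all_vt tcount_def)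
qed

lemma decomp_0102:
  "decomp (comp4 0 1 0 2)
     [(zm 1 \<^bold>* ym 1 \<^bold>* zm 2 \<^bold>- zm 2 \<^bold>* ym 1 \<^bold>* zm 1 :: 'a::field_char_0 npoly, mp4 [] [1] [] [1,1]),
      (pcomm (ym 1) (zm 1 \<^bold>* zm 2 \<^bold>- zm 2 \<^bold>* zm 1), mp4 [] [1] [] [1,1])]" (is "decomp ?n ?gens")
proof -
  let ?Ls = "[[(vec6 0 0 1 0 0 0, vec6 0 0 1 0 (-1) 0)],
      [(vec6 1 0 0 0 0 0, vec6 1 (-1) 0 (-1) 0 1)]]"
  have "gen_ok YM ZM ZM (zm 1 \<^bold>* ym 1 \<^bold>* zm 2 \<^bold>- zm 2 \<^bold>* ym 1 \<^bold>* zm 1 :: 'a npoly)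
      (mp4 [] [1] [] [1,1]) (line (vec6 0 0 1 0 (-1) 0))"
    by (rule gen_ok_lineI[where a = "(YM,1)" and b = "(ZM,1)" and c = "(ZM,2)" and k = "1"],
        simp add: poly_of_simps) (simp_all add: gen_check)
  moreover have "gen_ok YM ZM ZM (pcomm (ym 1) (zm 1 \<^bold>* zm 2 \<^bold>- zm 2 \<^bold>* zm 1) :: 'a npoly)
      (mp4 [] [1] [] [1,1]) (line (vec6 1 (-1) 0 (-1) 0 1))"
    by (rule gen_ok_lineI[where a = "(YM,1)" and b = "(ZM,1)" and c = "(ZM,2)" and k = "1"],
        simp add: poly_of_simps) (simp_all add: gen_check)
  ultimately have gens: "list_all2 (\<lambda>(f,lam) L. gen_ok YM ZM ZM f lam (lsp (map snd L))) ?gens ?Ls"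
    by (simp only: list_all2_Cons list_all2_Nil list.map prod.case snd_conv lsp_line lsp_plane simp_thms)
  have compl: "\<forall>\<sigma>. vec6 q0 q1 q2 q3 q4 q5 \<sigma> =
      (\<Sum>k<length ?Ls. pr (?Ls ! k) (vec6 q0 q1 q2 q3 q4 q5) \<sigma>)"
    if id: "is_star_id (spec (vec6 q0 q1 q2 q3 q4 q5) (YM,1) (ZM,2) (ZM,3))"
    for q0 q1 q2 q3 q4 q5 :: 'a
  proof -
    have e1: "q5 = - q1"
      by (rule eq_if_star_id[OF id, of 1 1 _ _ "-1" 0 0 1 0 0 0 1 0])
        (simp_all add: eval_check)
    have e2: "q4 = - q2"
      by (rule eq_if_star_id[OF id, of 0 0 _ _ "-1" 0 0 1 0 0 0 1 0])
        (simp_all add: eval_check e1)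
    have e3: "q3 = - q0"
      by (rule eq_if_star_id[OF id, of 2 2 _ _ "-1" 0 0 1 0 0 0 1 0])
        (simp_all add: eval_check e1 e2)
    have e4: "q1 = - q0"
      by (rule eq_if_star_id[OF id, of 1 1 _ _ 0 1 0 1 0 0 1 0 0])
        (simp_all add: eval_check e1 e2 e3)
    show ?thesis by (simp add: proj_check e1 e2 e3 e4)
  qed
  show ?thesis
    by (rule decomp_projI[OF _ gens _ compl]) (simp_all add: proj_check fun_eq_iff all_vt tcount_def)
qed

text \<open>With D = diag(1,-1,-1) and the odd skew variable written as D s, moving D to the left
  changes the sign of the words with it in the middle. The generators become D times half the
  linearization of the cube at (z_1, z_1, s), and D times \<open>St3\<close> of (z_1, z_2,
  s).\<close>

lemma decomp_0021:
  "decomp (comp4 0 0 2 1)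
     [(zp 1 \<^bold>* zp 1 \<^bold>* zm 1 \<^bold>- zp 1 \<^bold>* zm 1 \<^bold>* zp 1 \<^bold>+ zm 1 \<^bold>* zp 1 \<^bold>* zp 1 :: 'a::field_char_0 npoly,
         mp4 [] [] [2] [1]),
      (pcomm (zp 1) (zp 2) \<^bold>* zm 1 \<^bold>+ (zp 1 \<^bold>* zm 1 \<^bold>* zp 2 \<^bold>- zp 2 \<^bold>* zm 1 \<^bold>* zp 1)
         \<^bold>+ zm 1 \<^bold>* pcomm (zp 1) (zp 2), mp4 [] [] [1,1] [1])]" (is "decomp ?n ?gens")
proof -
  let ?Ls = "[[(vec6 (1/2) (-1/2) 0 0 0 0, vec6 1 (-1) 1 (-1) 1 1)],
      [(vec6 (1/2) (1/2) 0 0 0 0, vec6 1 1 (-1) (-1) 1 (-1))]]"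
  have "gen_ok ZP ZP ZM (zp 1 \<^bold>* zp 1 \<^bold>* zm 1 \<^bold>- zp 1 \<^bold>* zm 1 \<^bold>* zp 1 \<^bold>+ zm 1 \<^bold>* zp 1 \<^bold>* zp 1 :: 'a npoly)
      (mp4 [] [] [2] [1]) (line (vec6 1 (-1) 1 (-1) 1 1))"
    by (rule gen_ok_lineI[where a = "(ZP,1)" and b = "(ZP,1)" and c = "(ZM,1)" and k = "1/2"],
        simp add: poly_of_simps) (simp_all add: gen_check)
  moreover have "gen_ok ZP ZP ZM (pcomm (zp 1) (zp 2) \<^bold>* zm 1 \<^bold>+ (zp 1 \<^bold>* zm 1 \<^bold>* zp 2 \<^bold>- zp 2 \<^bold>* zm 1 \<^bold>* zp 1) \<^bold>+ zm 1 \<^bold>* pcomm (zp 1) (zp 2) :: 'a npoly)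
      (mp4 [] [] [1,1] [1]) (line (vec6 1 1 (-1) (-1) 1 (-1)))"
    by (rule gen_ok_lineI[where a = "(ZP,1)" and b = "(ZP,2)" and c = "(ZM,1)" and k = "1"],
        simp add: poly_of_simps) (simp_all add: gen_check)
  ultimately have gens: "list_all2 (\<lambda>(f,lam) L. gen_ok ZP ZP ZM f lam (lsp (map snd L))) ?gens ?Ls"
    by (simp only: list_all2_Cons list_all2_Nil list.map prod.case snd_conv lsp_line lsp_plane simp_thms)
  have compl: "\<forall>\<sigma>. vec6 q0 q1 q2 q3 q4 q5 \<sigma> =
      (\<Sum>k<length ?Ls. pr (?Ls ! k) (vec6 q0 q1 q2 q3 q4 q5) \<sigma>)"
    if id: "is_star_id (spec (vec6 q0 q1 q2 q3 q4 q5) (ZP,1) (ZP,2) (ZM,3))"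
    for q0 q1 q2 q3 q4 q5 :: 'a
  proof -
    have e1: "q5 = - q1 - q3 - q4"
      by (rule eq_if_star_id[OF id, of 0 1 _ _ "-1" 0 0 1 0 0 0 1 0])
        (simp_all add: eval_check)
    have e2: "q3 = q0 - 2 * q4"
      by (rule eq_if_star_id[OF id, of 2 0 _ _ 1 0 0 0 1 0 1 0 0])
        (simp_all add: eval_check e1)
    have e3: "q4 = q0 - q1 - q2"
      by (rule eq_if_star_id[OF id, of 0 1 _ _ "-1" 0 0 0 1 0 1 0 0])
        (simp_all add: eval_check e1 e2)
    have e4: "q2 = - q1"
      by (rule eq_if_star_id[OF id, of 2 0 _ _ "1/3" 0 0 1 0 0 0 1 0])
        (simp_all add: eval_check e1 e2 e3)
    show ?thesis by (simp add: proj_check e1 e2 e3 e4)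
  qed
  show ?thesis
    by (rule decomp_projI[OF _ gens _ compl]) (simp_all add: proj_check fun_eq_iff all_vt tcount_def)
qed

text \<open>Writing both skew variables as D s_i, with D = diag(1,-1,-1), gives the factor -1 to the
  words with adjacent skew variables and +1 to those with the symmetric variable between them. The
  cube and \<open>St3\<close> again account for both generators.\<close>

lemma decomp_0012:
  "decomp (comp4 0 0 1 2)
     [(zm 1 \<^bold>* zm 1 \<^bold>* zp 1 \<^bold>- zm 1 \<^bold>* zp 1 \<^bold>* zm 1 \<^bold>+ zp 1 \<^bold>* zm 1 \<^bold>* zm 1 :: 'a::field_char_0 npoly,
         mp4 [] [] [1] [2]),
      (pcomm (zm 1) (zm 2) \<^bold>* zp 1 \<^bold>+ (zm 1 \<^bold>* zp 1 \<^bold>* zm 2 \<^bold>- zm 2 \<^bold>* zp 1 \<^bold>* zm 1)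
         \<^bold>+ zp 1 \<^bold>* pcomm (zm 1) (zm 2), mp4 [] [] [1] [1,1])]" (is "decomp ?n ?gens")
proof -
  let ?Ls = "[[(vec6 (1/2) (1/2) 0 0 0 0, vec6 1 1 (-1) 1 (-1) 1)],
      [(vec6 (1/2) (-1/2) 0 0 0 0, vec6 1 (-1) 1 1 (-1) (-1))]]"
  have "gen_ok ZP ZM ZM (zm 1 \<^bold>* zm 1 \<^bold>* zp 1 \<^bold>- zm 1 \<^bold>* zp 1 \<^bold>* zm 1 \<^bold>+ zp 1 \<^bold>* zm 1 \<^bold>* zm 1 :: 'a npoly)
      (mp4 [] [] [1] [2]) (line (vec6 1 1 (-1) 1 (-1) 1))"
    by (rule gen_ok_lineI[where a = "(ZP,1)" and b = "(ZM,1)" and c = "(ZM,1)" and k = "1/2"],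
        simp add: poly_of_simps) (simp_all add: gen_check)
  moreover have "gen_ok ZP ZM ZM (pcomm (zm 1) (zm 2) \<^bold>* zp 1 \<^bold>+ (zm 1 \<^bold>* zp 1 \<^bold>* zm 2 \<^bold>- zm 2 \<^bold>* zp 1 \<^bold>* zm 1) \<^bold>+ zp 1 \<^bold>* pcomm (zm 1) (zm 2) :: 'a npoly)
      (mp4 [] [] [1] [1,1]) (line (vec6 1 (-1) 1 1 (-1) (-1)))"
    by (rule gen_ok_lineI[where a = "(ZP,1)" and b = "(ZM,1)" and c = "(ZM,2)" and k = "1"],
        simp add: poly_of_simps) (simp_all add: gen_check)
  ultimately have gens: "list_all2 (\<lambda>(f,lam) L. gen_ok ZP ZM ZM f lam (lsp (map snd L))) ?gens ?Ls"
    by (simp only: list_all2_Cons list_all2_Nil list.map prod.case snd_conv lsp_line lsp_plane simp_thms)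
  have compl: "\<forall>\<sigma>. vec6 q0 q1 q2 q3 q4 q5 \<sigma> =
      (\<Sum>k<length ?Ls. pr (?Ls ! k) (vec6 q0 q1 q2 q3 q4 q5) \<sigma>)"
    if id: "is_star_id (spec (vec6 q0 q1 q2 q3 q4 q5) (ZP,1) (ZM,2) (ZM,3))"
    for q0 q1 q2 q3 q4 q5 :: 'a
  proof -
    have e1: "q5 = q1 + q3 + q4"
      by (rule eq_if_star_id[OF id, of 0 1 _ _ 1 0 0 1 0 0 0 1 0])
        (simp_all add: eval_check)
    have e2: "q3 = - q0 - 2 * q4"
      by (rule eq_if_star_id[OF id, of 2 0 _ _ "-1" 0 0 0 1 0 1 0 0])
        (simp_all add: eval_check e1)
    have e3: "q4 = - q0 - q1 - q2"
      by (rule eq_if_star_id[OF id, of 0 1 _ _ "-1" 0 0 0 1 0 1 0 0])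
        (simp_all add: eval_check e1 e2)
    have e4: "q2 = - q1"
      by (rule eq_if_star_id[OF id, of 2 0 _ _ "-1/3" 0 0 1 0 0 0 1 0])
        (simp_all add: eval_check e1 e2 e3)
    show ?thesis by (simp add: proj_check e1 e2 e3 e4)
  qed
  show ?thesis
    by (rule decomp_projI[OF _ gens _ compl]) (simp_all add: proj_check fun_eq_iff all_vt tcount_def)
qed

text \<open>Writing the skew variable as D s with D = diag(1,-1,-1), which commutes with y and
  anticommutes with odd matrices, turns the minus signs between z_1 and z_2 in the case of two odd
  symmetric variables into plus signs.\<close>

lemma decomp_0111:
  "decomp (comp4 0 1 1 1)
     [(zp 1 \<^bold>* ym 1 \<^bold>* zm 1 \<^bold>+ zm 1 \<^bold>* ym 1 \<^bold>* zp 1 :: 'a::field_char_0 npoly, mp4 [] [1] [1] [1]),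
      (pcomm (ym 1) (zp 1 \<^bold>* zm 1 \<^bold>+ zm 1 \<^bold>* zp 1), mp4 [] [1] [1] [1])]" (is "decomp ?n ?gens")
proof -
  let ?Ls = "[[(vec6 0 0 1 0 0 0, vec6 0 0 1 0 1 0)],
      [(vec6 1 0 0 0 0 0, vec6 1 1 0 (-1) 0 (-1))]]"
  have "gen_ok YM ZP ZM (zp 1 \<^bold>* ym 1 \<^bold>* zm 1 \<^bold>+ zm 1 \<^bold>* ym 1 \<^bold>* zp 1 :: 'a npoly)
      (mp4 [] [1] [1] [1]) (line (vec6 0 0 1 0 1 0))"
    by (rule gen_ok_lineI[where a = "(YM,1)" and b = "(ZP,1)" and c = "(ZM,1)" and k = "1"],
        simp add: poly_of_simps) (simp_all add: gen_check)
  moreover have "gen_ok YM ZP ZM (pcomm (ym 1) (zp 1 \<^bold>* zm 1 \<^bold>+ zm 1 \<^bold>* zp 1) :: 'a npoly)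
      (mp4 [] [1] [1] [1]) (line (vec6 1 1 0 (-1) 0 (-1)))"
    by (rule gen_ok_lineI[where a = "(YM,1)" and b = "(ZP,1)" and c = "(ZM,1)" and k = "1"],
        simp add: poly_of_simps) (simp_all add: gen_check)
  ultimately have gens: "list_all2 (\<lambda>(f,lam) L. gen_ok YM ZP ZM f lam (lsp (map snd L))) ?gens ?Ls"
    by (simp only: list_all2_Cons list_all2_Nil list.map prod.case snd_conv lsp_line lsp_plane simp_thms)
  have compl: "\<forall>\<sigma>. vec6 q0 q1 q2 q3 q4 q5 \<sigma> =
      (\<Sum>k<length ?Ls. pr (?Ls ! k) (vec6 q0 q1 q2 q3 q4 q5) \<sigma>)"
    if id: "is_star_id (spec (vec6 q0 q1 q2 q3 q4 q5) (YM,1) (ZP,2) (ZM,3))"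
    for q0 q1 q2 q3 q4 q5 :: 'a
  proof -
    have e1: "q5 = - q1"
      by (rule eq_if_star_id[OF id, of 1 1 _ _ "-1" 0 0 1 0 0 0 1 0])
        (simp_all add: eval_check)
    have e2: "q4 = q2"
      by (rule eq_if_star_id[OF id, of 0 0 _ _ 1 0 0 1 0 0 0 1 0])
        (simp_all add: eval_check e1)
    have e3: "q3 = - q0"
      by (rule eq_if_star_id[OF id, of 2 2 _ _ 1 0 0 1 0 0 0 1 0])
        (simp_all add: eval_check e1 e2)
    have e4: "q1 = q0"
      by (rule eq_if_star_id[OF id, of 1 1 _ _ 0 1 0 1 0 0 1 0 0])
        (simp_all add: eval_check e1 e2 e3)
    show ?thesis by (simp add: proj_check e1 e2 e3 e4)
  qed
  show ?thesis
    by (rule decomp_projI[OF _ gens _ compl]) (simp_all add: proj_check fun_eq_iff all_vt tcount_def)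
qed

theorem theorem4p7:
  fixes F :: "'a::field_char_0 itself"
  shows
  "decomp (comp4 3 0 0 0)
     [(pcomm (yp 1) (yp 2) \<^bold>* yp 1, mp4 [2,1] [] [] []),
      (pcomm (yp 1 \<^bold>* yp 1) (yp 2), mp4 [2,1] [] [] []),
      (St3 (yp 1) (yp 2) (yp 3) :: 'a npoly, mp4 [1,1,1] [] [] [])]
 \<and> decomp (comp4 0 3 0 0)
     [(pcomm (ym 1 \<^bold>* ym 1) (ym 2) :: 'a npoly, mp4 [] [2,1] [] [])]
 \<and> decomp (comp4 2 1 0 0)
     [(pcomm (yp 1 \<^bold>* yp 1) (ym 1) :: 'a npoly, mp4 [2] [1] [] []),
      (pcomm (yp 1) (ym 1 \<^bold>* yp 1), mp4 [2] [1] [] []),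
      (pcomm (yp 1) (yp 2) \<^bold>* ym 1, mp4 [1,1] [1] [] []),
      (yp 1 \<^bold>* ym 1 \<^bold>* yp 2 \<^bold>- yp 2 \<^bold>* ym 1 \<^bold>* yp 1, mp4 [1,1] [1] [] []),
      (ym 1 \<^bold>* pcomm (yp 1) (yp 2), mp4 [1,1] [1] [] [])]
 \<and> decomp (comp4 1 2 0 0)
     [(pcomm (yp 1) (ym 1 \<^bold>* ym 1) :: 'a npoly, mp4 [1] [2] [] []),
      (ym 1 \<^bold>* pcomm (yp 1) (ym 1), mp4 [1] [2] [] []),
      (pcomm (yp 1) (ym 1 \<^bold>* ym 2 \<^bold>- ym 2 \<^bold>* ym 1), mp4 [1] [1,1] [] []),
      (ym 1 \<^bold>* pcomm (yp 1) (ym 2) \<^bold>- ym 2 \<^bold>* pcomm (yp 1) (ym 1), mp4 [1] [1,1] [] [])]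
 \<and> decomp (comp4 2 0 1 0)
     [(pcomm (yp 1) (yp 2) \<^bold>* zp 1 :: 'a npoly, mp4 [1,1] [] [1] []),
      (zp 1 \<^bold>* pcomm (yp 1) (yp 2), mp4 [1,1] [] [1] [])]
 \<and> decomp (comp4 2 0 0 1)
     [(pcomm (yp 1) (yp 2) \<^bold>* zm 1 :: 'a npoly, mp4 [1,1] [] [] [1]),
      (zm 1 \<^bold>* pcomm (yp 1) (yp 2), mp4 [1,1] [] [] [1])]
 \<and> decomp (comp4 1 1 1 0)
     [(pcomm (yp 1) (ym 1) \<^bold>* zp 1 :: 'a npoly, mp4 [1] [1] [1] []),
      (zp 1 \<^bold>* pcomm (yp 1) (ym 1), mp4 [1] [1] [1] [])]
 \<and> decomp (comp4 1 1 0 1)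
     [(pcomm (yp 1) (ym 1) \<^bold>* zm 1 :: 'a npoly, mp4 [1] [1] [] [1]),
      (zm 1 \<^bold>* pcomm (yp 1) (ym 1), mp4 [1] [1] [] [1])]
 \<and> decomp (comp4 1 0 2 0)
     [(pcomm (yp 1) (zp 1 \<^bold>* zp 1) :: 'a npoly, mp4 [1] [] [2] []),
      (pcomm (yp 1) (zp 1 \<^bold>* zp 2 \<^bold>- zp 2 \<^bold>* zp 1), mp4 [1] [] [1,1] [])]
 \<and> decomp (comp4 1 0 0 2)
     [(pcomm (yp 1) (zm 1 \<^bold>* zm 1) :: 'a npoly, mp4 [1] [] [] [2]),
      (pcomm (yp 1) (zm 1 \<^bold>* zm 2 \<^bold>- zm 2 \<^bold>* zm 1), mp4 [1] [] [] [1,1])]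
 \<and> decomp (comp4 1 0 1 1)
     [(pcomm (yp 1) (zp 1 \<^bold>* zm 1) :: 'a npoly, mp4 [1] [] [1] [1]),
      (pcomm (yp 1) (zm 1 \<^bold>* zp 1), mp4 [1] [] [1] [1])]
 \<and> decomp (comp4 0 0 3 0)
     [(zp 1 \<^bold>* zp 1 \<^bold>* zp 1 :: 'a npoly, mp4 [] [] [3] []),
      (St3 (zp 1) (zp 2) (zp 3), mp4 [] [] [1,1,1] [])]
 \<and> decomp (comp4 0 0 0 3)
     [(zm 1 \<^bold>* zm 1 \<^bold>* zm 1 :: 'a npoly, mp4 [] [] [] [3]),
      (St3 (zm 1) (zm 2) (zm 3), mp4 [] [] [] [1,1,1])]
 \<and> decomp (comp4 0 2 1 0)
     [(ym 1 \<^bold>* zp 1 \<^bold>* ym 1 :: 'a npoly, mp4 [] [2] [1] []),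
      (ym 1 \<^bold>* zp 1 \<^bold>* ym 2 \<^bold>- ym 2 \<^bold>* zp 1 \<^bold>* ym 1, mp4 [] [1,1] [1] [])]
 \<and> decomp (comp4 0 2 0 1)
     [(ym 1 \<^bold>* zm 1 \<^bold>* ym 1 :: 'a npoly, mp4 [] [2] [] [1]),
      (ym 1 \<^bold>* zm 1 \<^bold>* ym 2 \<^bold>- ym 2 \<^bold>* zm 1 \<^bold>* ym 1, mp4 [] [1,1] [] [1])]
 \<and> decomp (comp4 0 1 2 0)
     [(zp 1 \<^bold>* ym 1 \<^bold>* zp 2 \<^bold>- zp 2 \<^bold>* ym 1 \<^bold>* zp 1 :: 'a npoly, mp4 [] [1] [1,1] []),
      (pcomm (ym 1) (zp 1 \<^bold>* zp 2 \<^bold>- zp 2 \<^bold>* zp 1), mp4 [] [1] [1,1] [])]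
 \<and> decomp (comp4 0 1 0 2)
     [(zm 1 \<^bold>* ym 1 \<^bold>* zm 2 \<^bold>- zm 2 \<^bold>* ym 1 \<^bold>* zm 1 :: 'a npoly, mp4 [] [1] [] [1,1]),
      (pcomm (ym 1) (zm 1 \<^bold>* zm 2 \<^bold>- zm 2 \<^bold>* zm 1), mp4 [] [1] [] [1,1])]
 \<and> decomp (comp4 0 0 2 1)
     [(zp 1 \<^bold>* zp 1 \<^bold>* zm 1 \<^bold>- zp 1 \<^bold>* zm 1 \<^bold>* zp 1 \<^bold>+ zm 1 \<^bold>* zp 1 \<^bold>* zp 1 :: 'a npoly,
         mp4 [] [] [2] [1]),
      (pcomm (zp 1) (zp 2) \<^bold>* zm 1 \<^bold>+ (zp 1 \<^bold>* zm 1 \<^bold>* zp 2 \<^bold>- zp 2 \<^bold>* zm 1 \<^bold>* zp 1)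
         \<^bold>+ zm 1 \<^bold>* pcomm (zp 1) (zp 2), mp4 [] [] [1,1] [1])]
 \<and> decomp (comp4 0 0 1 2)
     [(zm 1 \<^bold>* zm 1 \<^bold>* zp 1 \<^bold>- zm 1 \<^bold>* zp 1 \<^bold>* zm 1 \<^bold>+ zp 1 \<^bold>* zm 1 \<^bold>* zm 1 :: 'a npoly,
         mp4 [] [] [1] [2]),
      (pcomm (zm 1) (zm 2) \<^bold>* zp 1 \<^bold>+ (zm 1 \<^bold>* zp 1 \<^bold>* zm 2 \<^bold>- zm 2 \<^bold>* zp 1 \<^bold>* zm 1)
         \<^bold>+ zp 1 \<^bold>* pcomm (zm 1) (zm 2), mp4 [] [] [1] [1,1])]
 \<and> decomp (comp4 0 1 1 1)
     [(zp 1 \<^bold>* ym 1 \<^bold>* zm 1 \<^bold>+ zm 1 \<^bold>* ym 1 \<^bold>* zp 1 :: 'a npoly, mp4 [] [1] [1] [1]),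
      (pcomm (ym 1) (zp 1 \<^bold>* zm 1 \<^bold>+ zm 1 \<^bold>* zp 1), mp4 [] [1] [1] [1])]"
  by (intro conjI decomp_3000 decomp_0300 decomp_2100 decomp_1200 decomp_2010 decomp_2001
      decomp_1110 decomp_1101 decomp_1020 decomp_1002 decomp_1011 decomp_0030
      decomp_0003 decomp_0210 decomp_0201 decomp_0120 decomp_0102 decomp_0021
      decomp_0012 decomp_0111)

end
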